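(* The functor $J^-\Sigma:\mathbf{Map}\to\mathbf{RWFlowGS}$ is left adjoint to the functor $PJ^+:\mathbf{RWFlowGS}\to\mathbf{Map}$, i.e. $J^-\Sigma\dashv PJ^+$.
   Context: Topological manifolds are assumed second countable and Hausdorff. $\mathbf{Map}$: objects are pairs $(f,X)$ with $X$ a topological manifold without boundary and $f:X\to X$ a homeomorphism; morphisms $h:(f,X)\to(g,Y)$ are continuous maps $h:X\to Y$ with $h\circ f=g\circ h$. Flows. A flow $(\Phi,X)$ is a topological manifold $X$ without boundary together with a continuous map $\Phi: X\times\mathbb{R}\to X$ with $\Phi(x,0)=x$ and $\Phi(\Phi(x,t),s)=\Phi(x,t+s)$. A morphism of flows $h:(\Phi,X)\to(\Psi,Y)$ is a continuous map with $h(\Phi(x,t))=\Psi(h(x),t)$ for all $x,t$. A weak morphism $(h,\tau):(\Phi,X)\to(\Psi,Y)$ is a pair of a continuous map $h:X\to Y$ and a map $\tau:X\times\mathbb{R}\to\mathbb{R}$ such that $h(\Phi(x,t))=\Psi(h(x),\tau(x,t))$ for all $x,t$, and for each $x$, $\tau(x,-)$ is an increasing homeomorphism of $\mathbb{R}$ with $\tau(x,0)=0$. Composition: $(h_2,\tau_2)\circ(h_1,\tau_1)=(h_2\circ h_1,\tau_2\circ\tau_1)$ with $\tau_2\circ\tau_1(x,t):=\tau_2(h_1(x),\tau_1(x,t))$. A morphism $h$ is regarded as the weak morphism $(h,\mathrm{id})$, with time part $(x,t)\mapsto t$. Sections. Let $X$ be $n$-dimensional. A submanifold $S\subset X$ without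 boundary is topologically transversal to $\Phi$ if: (1) $S$ is of codimension one and locally flat. (2) For each $x\in S$ there exist a neighborhood $U$ of $x$ in $X$ and a homeomorphism $\phi:U\to B\subset\mathbb{R}^n$, where $B$ is the unit ball, such that $\phi(U\cap S)=B\cap(\mathbb{R}^{n-1}\times\{0\})$. Further, there exist $\delta_+(x)>0$ and $\delta_-(x)<0$ such that $\Phi(x,[\delta_-(x),0))$ and $\Phi(x,(0,\delta_+(x)])$ are contained in different connected components of $U\setminus S$ and $\Phi(x,[\delta_-(x),\delta_+(x)])\cap S=\{x\}$. Here $\delta_+$ and $\delta_-$ can be taken locally uniformly, that is, there exist a neighborhood $V\subset U$ of $x$ and $\delta>0$ such that $\delta_+(y)>\delta$ and $\delta_-(y)<-\delta$ for all $y\in V\cap S$. (3) For each set of the form $\Phi(y,[a,b])$, where $y\in X$ and $a,b\in\mathbb{R}$, $\Phi(y,[a,b])\cap S$ is compact in $S$. A submanifold $S\subset X$ is a global Poincaré section if $S$ is topologically transversal to $\Phi$ and for each $x\in X$ there exist $t_+>0$ and $t_-<0$ with $\Phi(x,t_+)\in S$ and $\Phi(x,t_-)\in S$. For a global Poincaré section $S$ and $x\in S$, $T_\Phi(x)>0$ is the first return time (the smallest $t>0$ with $\Phi(x,t)\in S$) and $P\Phi:S\to S$, $P\Phi(x)=\Phi(x,T_\Phi(x))$, is the Poincaré map. Put $R_\Phi(x)(u):=\sum_{i\in\mathbb{Z}}T_\Phi((P\Phi)^i(x))\,\chi_{[i,i+1)}(u)$ for $x\in S$, $u\in\mathbb{R}$,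 where $\chi_{[i,i+1)}$ is the indicator function. Categories. $\mathbf{FlowGS}$, $\mathbf{WFlowGS}$, $\mathbf{RWFlowGS}$ all have as objects the triples $(\Phi,X,S)$ with $(\Phi,X)$ a flow and $S$ a global Poincaré section. Morphisms $(\Phi,X,S)\to(\Psi,Y,S')$ in $\mathbf{FlowGS}$ (resp. $\mathbf{WFlowGS}$) are morphisms $h$ of flows (resp. weak morphisms $(h,\tau)$) with $S=h^{-1}(S')$. Morphisms in $\mathbf{RWFlowGS}$ are the morphisms $(h,\sigma):(\Phi_1,X_1,S_1)\to(\Phi_2,X_2,S_2)$ of $\mathbf{WFlowGS}$ that are rate-preserving, i.e. $$\sigma\Big(\Phi_1(x,tT_{\Phi_1}(x)),\int_0^{s+t}R_{\Phi_1}(x)(u)\,du-tT_{\Phi_1}(x)\Big)=\int_0^{s+t}R_{\Phi_2}(h(x))(u)\,du-tT_{\Phi_2}(h(x))$$ for all $x\in S_1$, $0\le t<1$, $s\in\mathbb{R}$. The inclusion functors are $J^-:\mathbf{FlowGS}\to\mathbf{RWFlowGS}$ and $J^+:\mathbf{RWFlowGS}\to\mathbf{WFlowGS}$. Functors. The Poincaré map functor $P:\mathbf{WFlowGS}\to\mathbf{Map}$ is $P(\Phi,X,S)=(P\Phi,S)$, $P(h,\tau)=h|_{S}$ for $(h,\tau)$ with source $(\Phi,X,S)$. For a homeomorphism $f:X\to X$, the mapping torus is $X_f:=X\times[0,1]/\sim$, with $\sim$ the smallest equivalence relation with $(x,1)\sim(f(x),0)$; its points are written $[x,t]$, $x\in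 X$, $0\le t<1$. The suspension flow is $\Sigma f([x,t],s):=[f^n(x),s+t-n]$, with $n$ the unique integer satisfying $s+t-1<n\le s+t$. The suspension functor $\Sigma:\mathbf{Map}\to\mathbf{FlowGS}$ is $\Sigma(f,X)=(\Sigma f,X_f,(X_f)_0)$ with $(X_f)_0=\{[x,0]\mid x\in X\}$, and $\Sigma(h)=\bar h$, $\bar h([x,t])=[h(x),t]$.
   Formalization: A global Poincaré section S is required to be a closed subset of X; without this the Poincaré map can be discontinuous (vertical flow on R^2, S = R×Z ∪ (0,∞)×(Z+1/2)), so P would not map into Map; given the other conditions, S is closed exactly when PΦ is continuous. *)

theory Defs
  imports "HOL-Analysis.Analysis"
begin

section \<open>Categories, functors, adjunctions\<close>

text \<open>Hom-sets are indexed by objects and need not be disjoint, so composition and the arrow part of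
  a functor take the objects as additional arguments: \<open>cmp C A B D g f\<close> is \<open>g \<circ> f\<close> for
  \<open>f : A \<rightarrow> B\<close> and \<open>g : B \<rightarrow> D\<close>, and \<open>amap F A B\<close> acts on the arrows \<open>A \<rightarrow> B\<close>.\<close>

record ('o, 'm) cat =
  objs :: "'o set"
  homs :: "'o \<Rightarrow> 'o \<Rightarrow> 'm set"
  ident :: "'o \<Rightarrow> 'm"
  cmp :: "'o \<Rightarrow> 'o \<Rightarrow> 'o \<Rightarrow> 'm \<Rightarrow> 'm \<Rightarrow> 'm"

definition is_category :: "('o, 'm) cat \<Rightarrow> bool" where
  "is_category C \<longleftrightarrow>
     (\<forall>A\<in>objs C. ident C A \<in> homs C A A) \<and>
     (\<forall>A\<in>objs C. \<forall>B\<in>objs C. \<forall>D\<in>objs C. \<forall>f\<in>homs C A B. \<forall>g\<in>homs C B D.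
        cmp C A B D g f \<in> homs C A D) \<and>
     (\<forall>A\<in>objs C. \<forall>B\<in>objs C. \<forall>f\<in>homs C A B.
        cmp C A A B f (ident C A) = f \<and> cmp C A B B (ident C B) f = f) \<and>
     (\<forall>A\<in>objs C. \<forall>B\<in>objs C. \<forall>D\<in>objs C. \<forall>E\<in>objs C.
        \<forall>f\<in>homs C A B. \<forall>g\<in>homs C B D. \<forall>h\<in>homs C D E.
        cmp C A D E h (cmp C A B D g f) = cmp C A B E (cmp C B D E h g) f)"

record ('o, 'm, 'p, 'n) func =
  src :: "('o, 'm) cat"
  tgt :: "('p, 'n) cat"
  omap :: "'o \<Rightarrow> 'p"
  amap :: "'o \<Rightarrow> 'o \<Rightarrow> 'm \<Rightarrow> 'n"

definition is_functor :: "('o, 'm) cat \<Rightarrow> ('p, 'n) cat \<Rightarrow> ('o, 'm, 'p, 'n) func \<Rightarrow> bool" where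
  "is_functor C D F \<longleftrightarrow>
     is_category C \<and> is_category D \<and> src F = C \<and> tgt F = D \<and>
     (\<forall>A\<in>objs C. omap F A \<in> objs D) \<and>
     (\<forall>A\<in>objs C. \<forall>B\<in>objs C. \<forall>f\<in>homs C A B. amap F A B f \<in> homs D (omap F A) (omap F B)) \<and>
     (\<forall>A\<in>objs C. amap F A A (ident C A) = ident D (omap F A)) \<and>
     (\<forall>A\<in>objs C. \<forall>B\<in>objs C. \<forall>E\<in>objs C. \<forall>f\<in>homs C A B. \<forall>g\<in>homs C B E.
        amap F A E (cmp C A B E g f) =
        cmp D (omap F A) (omap F B) (omap F E) (amap F B E g) (amap F A B f))"

definition fcomp :: "('p, 'n, 'q, 'k) func \<Rightarrow> ('o, 'm, 'p, 'n) func \<Rightarrow> ('o, 'm, 'q, 'k) func"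
    (infixl \<open>\<circ>\<^sub>F\<close> 75) where
  "G \<circ>\<^sub>F F = \<lparr>src = src F, tgt = tgt G, omap = omap G \<circ> omap F,
     amap = (\<lambda>A B. amap G (omap F A) (omap F B) \<circ> amap F A B)\<rparr>"

text \<open>\<open>L : C \<rightarrow> D\<close> is left adjoint to \<open>R : D \<rightarrow> C\<close>: there are bijections
  \<open>\<theta> A B : D(L A, B) \<cong> C(A, R B)\<close>, natural in both variables.\<close>

definition left_adjoint ::
    "('o, 'm) cat \<Rightarrow> ('p, 'n) cat \<Rightarrow> ('o, 'm, 'p, 'n) func \<Rightarrow> ('p, 'n, 'o, 'm) func \<Rightarrow> bool" where
  "left_adjoint C D L R \<longleftrightarrow>
     is_functor C D L \<and> is_functor D C R \<and>
     (\<exists>\<theta>.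
       (\<forall>A\<in>objs C. \<forall>B\<in>objs D. bij_betw (\<theta> A B) (homs D (omap L A) B) (homs C A (omap R B))) \<and>
       (\<forall>A\<in>objs C. \<forall>A'\<in>objs C. \<forall>B\<in>objs D. \<forall>B'\<in>objs D.
        \<forall>a\<in>homs C A' A. \<forall>b\<in>homs D B B'. \<forall>k\<in>homs D (omap L A) B.
          \<theta> A' B' (cmp D (omap L A') B B' b (cmp D (omap L A') (omap L A) B k (amap L A' A a))) =
          cmp C A' (omap R B) (omap R B') (amap R B B' b) (cmp C A' A (omap R B) (\<theta> A B k) a)))"


section \<open>Manifolds, homeomorphisms, flows\<close>

definition manifold :: "nat \<Rightarrow> 'a topology \<Rightarrow> bool" where
  "manifold n X \<longleftrightarrow> Hausdorff_space X \<and> second_countable X \<and>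
     (\<forall>x\<in>topspace X. \<exists>U V. openin X U \<and> x \<in> U \<and> openin (Euclidean_space n) V \<and>
        subtopology X U homeomorphic_space subtopology (Euclidean_space n) V)"

definition top_manifold :: "'a topology \<Rightarrow> bool" where
  "top_manifold X \<longleftrightarrow> (\<exists>n. manifold n X)"

text \<open>Functions on a space are total functions of HOL that are \<open>undefined\<close> outside it
  (\<open>extensional\<close>), so that equality of objects and of arrows is equality of functions on the
  space.\<close>

type_synonym 'u map_obj = "('u \<Rightarrow> 'u) \<times> 'u topology"

definition map_objs :: "'u map_obj set" where
  "map_objs = {(f, X). top_manifold X \<and> f \<in> extensional (topspace X) \<and> homeomorphic_map X X f}"

definition map_homs :: "'u map_obj \<Rightarrow> 'u map_obj \<Rightarrow> ('u \<Rightarrow> 'u) set" where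
  "map_homs = (\<lambda>(f, X) (g, Y). {h. h \<in> extensional (topspace X) \<and> continuous_map X Y h \<and>
     (\<forall>x\<in>topspace X. h (f x) = g (h x))})"

definition MapCat :: "('u map_obj, 'u \<Rightarrow> 'u) cat" where
  "MapCat = \<lparr>objs = map_objs, homs = map_homs,
     ident = (\<lambda>(f, X). \<lambda>x\<in>topspace X. x),
     cmp = (\<lambda>(f, X) _ _ h\<^sub>2 h\<^sub>1. compose (topspace X) h\<^sub>2 h\<^sub>1)\<rparr>"

definition is_flow :: "('u \<times> real \<Rightarrow> 'u) \<Rightarrow> 'u topology \<Rightarrow> bool" where
  "is_flow \<Phi> X \<longleftrightarrow> top_manifold X \<and> \<Phi> \<in> extensional (topspace X \<times> UNIV) \<and>
     continuous_map (prod_topology X euclideanreal) X \<Phi> \<and>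
     (\<forall>x\<in>topspace X. \<Phi> (x, 0) = x) \<and>
     (\<forall>x\<in>topspace X. \<forall>t s. \<Phi> (\<Phi> (x, t), s) = \<Phi> (x, t + s))"


section \<open>Global Poincare sections\<close>

definition unit_ball :: "nat \<Rightarrow> (nat \<Rightarrow> real) set" where
  "unit_ball n = {x \<in> topspace (Euclidean_space n). (\<Sum>i<n. (x i)\<^sup>2) < 1}"

text \<open>\<open>Euclidean_space n\<close> consists of the sequences vanishing from index \<open>n\<close> on, so the hyperplane
  \<open>\<real>\<^sup>m \<times> {0}\<close> of \<open>\<real>\<^sup>m\<^sup>+\<^sup>1\<close> is \<open>topspace (Euclidean_space m)\<close>.\<close>

definition locally_flat :: "nat \<Rightarrow> 'a topology \<Rightarrow> 'a set \<Rightarrow> bool" where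
  "locally_flat m X S \<longleftrightarrow>
     (\<forall>x\<in>S. \<exists>U \<phi>. openin X U \<and> x \<in> U \<and>
        homeomorphic_map (subtopology X U) (Euclidean_space (Suc m)) \<phi> \<and>
        \<phi> ` (U \<inter> S) = topspace (Euclidean_space m))"

text \<open>\<open>X\<close> has dimension \<open>Suc m\<close>. A submanifold \<open>S\<close> of \<open>X\<close> is understood to be a closed subset.
  Closedness cannot be dropped: for the vertical flow on \<open>\<real>\<^sup>2\<close> the set
  \<open>\<real> \<times> \<int> \<union> {x > 0} \<times> (\<int> + 1/2)\<close> has all the other properties below and meets every orbit in
  both directions, but its return map is not continuous; for a global section, the return map is
  continuous precisely when the section is closed. The return-free times \<open>\<delta>\<^sub>+\<close>, \<open>\<delta>\<^sub>-\<close> are functions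
  on \<open>S\<close>, chosen once for all points, because their local uniformity compares different points.\<close>

definition transversal_dim :: "nat \<Rightarrow> ('a \<times> real \<Rightarrow> 'a) \<Rightarrow> 'a topology \<Rightarrow> 'a set \<Rightarrow> bool" where
  "transversal_dim m \<Phi> X S \<longleftrightarrow>
     manifold (Suc m) X \<and> closedin X S \<and>
     manifold m (subtopology X S) \<and> locally_flat m X S \<and>
     (\<exists>\<delta>\<^sub>p \<delta>\<^sub>m :: 'a \<Rightarrow> real. \<forall>x\<in>S. \<delta>\<^sub>p x > 0 \<and> \<delta>\<^sub>m x < 0 \<and>
        (\<exists>U \<phi>. openin X U \<and> x \<in> U \<and>
           homeomorphic_map (subtopology X U)
             (subtopology (Euclidean_space (Suc m)) (unit_ball (Suc m))) \<phi> \<and>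
           \<phi> ` (U \<inter> S) = unit_ball (Suc m) \<inter> topspace (Euclidean_space m) \<and>
           (\<exists>C\<in>connected_components_of (subtopology X (U - S)).
            \<exists>D\<in>connected_components_of (subtopology X (U - S)).
              C \<noteq> D \<and> \<Phi> ` ({x} \<times> {\<delta>\<^sub>m x..<0}) \<subseteq> C \<and> \<Phi> ` ({x} \<times> {0<..\<delta>\<^sub>p x}) \<subseteq> D) \<and>
           \<Phi> ` ({x} \<times> {\<delta>\<^sub>m x..\<delta>\<^sub>p x}) \<inter> S = {x} \<and>
           (\<exists>V \<delta>. openin X V \<and> x \<in> V \<and> V \<subseteq> U \<and> \<delta> > 0 \<and>
              (\<forall>y\<in>V \<inter> S. \<delta>\<^sub>p y > \<delta> \<and> \<delta>\<^sub>m y < -\<delta>)))) \<and>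
     (\<forall>y\<in>topspace X. \<forall>a b. compactin (subtopology X S) (\<Phi> ` ({y} \<times> {a..b}) \<inter> S))"

definition transversal :: "('a \<times> real \<Rightarrow> 'a) \<Rightarrow> 'a topology \<Rightarrow> 'a set \<Rightarrow> bool" where
  "transversal \<Phi> X S \<longleftrightarrow> (\<exists>m. transversal_dim m \<Phi> X S)"

definition global_section :: "('a \<times> real \<Rightarrow> 'a) \<Rightarrow> 'a topology \<Rightarrow> 'a set \<Rightarrow> bool" where
  "global_section \<Phi> X S \<longleftrightarrow> transversal \<Phi> X S \<and>
     (\<forall>x\<in>topspace X. (\<exists>t>0. \<Phi> (x, t) \<in> S) \<and> (\<exists>t<0. \<Phi> (x, t) \<in> S))"

definition return_time :: "('a \<times> real \<Rightarrow> 'a) \<Rightarrow> 'a set \<Rightarrow> 'a \<Rightarrow> real" where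
  "return_time \<Phi> S x = (LEAST t. t > 0 \<and> \<Phi> (x, t) \<in> S)"

definition poincare_map :: "('a \<times> real \<Rightarrow> 'a) \<Rightarrow> 'a set \<Rightarrow> 'a \<Rightarrow> 'a" where
  "poincare_map \<Phi> S = (\<lambda>x\<in>S. \<Phi> (x, return_time \<Phi> S x))"

definition int_iter :: "'a set \<Rightarrow> ('a \<Rightarrow> 'a) \<Rightarrow> int \<Rightarrow> 'a \<Rightarrow> 'a" where
  "int_iter A f i = (if 0 \<le> i then f ^^ nat i else inv_into A f ^^ nat (- i))"

definition rate :: "('a \<times> real \<Rightarrow> 'a) \<Rightarrow> 'a set \<Rightarrow> 'a \<Rightarrow> real \<Rightarrow> real" where
  "rate \<Phi> S x u = (\<Sum>\<^sub>\<infinity>i\<in>(UNIV :: int set).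
     return_time \<Phi> S (int_iter S (poincare_map \<Phi> S) i x) * indicator {real_of_int i..<real_of_int i + 1} u)"


section \<open>Categories of flows with global sections\<close>

type_synonym 'u flow_obj = "('u \<times> real \<Rightarrow> 'u) \<times> 'u topology \<times> 'u set"
type_synonym 'u weak_arr = "('u \<Rightarrow> 'u) \<times> ('u \<times> real \<Rightarrow> real)"

definition flow_objs :: "'u flow_obj set" where
  "flow_objs = {(\<Phi>, X, S). is_flow \<Phi> X \<and> global_section \<Phi> X S}"

definition flow_homs :: "'u flow_obj \<Rightarrow> 'u flow_obj \<Rightarrow> ('u \<Rightarrow> 'u) set" where
  "flow_homs = (\<lambda>(\<Phi>, X, S) (\<Psi>, Y, S').
     {h. h \<in> extensional (topspace X) \<and> continuous_map X Y h \<and>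
         (\<forall>x\<in>topspace X. \<forall>t. h (\<Phi> (x, t)) = \<Psi> (h x, t)) \<and>
         S = {x \<in> topspace X. h x \<in> S'}})"

definition FlowGS :: "('u flow_obj, 'u \<Rightarrow> 'u) cat" where
  "FlowGS = \<lparr>objs = flow_objs, homs = flow_homs,
     ident = (\<lambda>(\<Phi>, X, S). \<lambda>x\<in>topspace X. x),
     cmp = (\<lambda>(\<Phi>, X, S) _ _ h\<^sub>2 h\<^sub>1. compose (topspace X) h\<^sub>2 h\<^sub>1)\<rparr>"

definition weak_homs :: "'u flow_obj \<Rightarrow> 'u flow_obj \<Rightarrow> 'u weak_arr set" where
  "weak_homs = (\<lambda>(\<Phi>, X, S) (\<Psi>, Y, S').
     {(h, \<tau>). h \<in> extensional (topspace X) \<and> \<tau> \<in> extensional (topspace X \<times> UNIV) \<and>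
         continuous_map X Y h \<and>
         (\<forall>x\<in>topspace X. \<forall>t. h (\<Phi> (x, t)) = \<Psi> (h x, \<tau> (x, t))) \<and>
         (\<forall>x\<in>topspace X. strict_mono (\<lambda>t. \<tau> (x, t)) \<and>
            homeomorphic_map euclideanreal euclideanreal (\<lambda>t. \<tau> (x, t)) \<and> \<tau> (x, 0) = 0) \<and>
         S = {x \<in> topspace X. h x \<in> S'}})"

definition weak_ident :: "'u flow_obj \<Rightarrow> 'u weak_arr" where
  "weak_ident = (\<lambda>(\<Phi>, X, S). (\<lambda>x\<in>topspace X. x, \<lambda>(x, t)\<in>topspace X \<times> UNIV. t))"

definition weak_comp ::
    "'u flow_obj \<Rightarrow> 'u flow_obj \<Rightarrow> 'u flow_obj \<Rightarrow> 'u weak_arr \<Rightarrow> 'u weak_arr \<Rightarrow> 'u weak_arr" where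
  "weak_comp = (\<lambda>(\<Phi>, X, S) _ _ (h\<^sub>2, \<tau>\<^sub>2) (h\<^sub>1, \<tau>\<^sub>1).
     (compose (topspace X) h\<^sub>2 h\<^sub>1, \<lambda>(x, t)\<in>topspace X \<times> UNIV. \<tau>\<^sub>2 (h\<^sub>1 x, \<tau>\<^sub>1 (x, t))))"

definition WFlowGS :: "('u flow_obj, 'u weak_arr) cat" where
  "WFlowGS = \<lparr>objs = flow_objs, homs = weak_homs, ident = weak_ident, cmp = weak_comp\<rparr>"

definition rate_preserving :: "'u flow_obj \<Rightarrow> 'u flow_obj \<Rightarrow> 'u weak_arr \<Rightarrow> bool" where
  "rate_preserving = (\<lambda>(\<Phi>\<^sub>1, X\<^sub>1, S\<^sub>1) (\<Phi>\<^sub>2, X\<^sub>2, S\<^sub>2) (h, \<sigma>).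
     \<forall>x\<in>S\<^sub>1. \<forall>t s :: real. 0 \<le> t \<and> t < 1 \<longrightarrow>
       \<sigma> (\<Phi>\<^sub>1 (x, t * return_time \<Phi>\<^sub>1 S\<^sub>1 x),
          (LBINT u=0..s + t. rate \<Phi>\<^sub>1 S\<^sub>1 x u) - t * return_time \<Phi>\<^sub>1 S\<^sub>1 x) =
       (LBINT u=0..s + t. rate \<Phi>\<^sub>2 S\<^sub>2 (h x) u) - t * return_time \<Phi>\<^sub>2 S\<^sub>2 (h x))"

definition RWFlowGS :: "('u flow_obj, 'u weak_arr) cat" where
  "RWFlowGS = \<lparr>objs = flow_objs, homs = (\<lambda>A B. {k \<in> weak_homs A B. rate_preserving A B k}),
     ident = weak_ident, cmp = weak_comp\<rparr>"

definition Jminus :: "('u flow_obj, 'u \<Rightarrow> 'u, 'u flow_obj, 'u weak_arr) func" where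
  "Jminus = \<lparr>src = FlowGS, tgt = RWFlowGS, omap = (\<lambda>A. A),
     amap = (\<lambda>(\<Phi>, X, S) _ h. (h, \<lambda>(x, t)\<in>topspace X \<times> UNIV. t))\<rparr>"

definition Jplus :: "('u flow_obj, 'u weak_arr, 'u flow_obj, 'u weak_arr) func" where
  "Jplus = \<lparr>src = RWFlowGS, tgt = WFlowGS, omap = (\<lambda>A. A), amap = (\<lambda>_ _ k. k)\<rparr>"

definition Poincare :: "('u flow_obj, 'u weak_arr, 'u map_obj, 'u \<Rightarrow> 'u) func" where
  "Poincare = \<lparr>src = WFlowGS, tgt = MapCat,
     omap = (\<lambda>(\<Phi>, X, S). (poincare_map \<Phi> S, subtopology X S)),
     amap = (\<lambda>(\<Phi>, X, S) _ (h, \<tau>). restrict h S)\<rparr>"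


section \<open>Suspension\<close>

text \<open>All manifolds have their points in one type \<open>'u\<close>, which plays the role of the universe of sets.
  A point of the mapping torus is an equivalence class in \<open>topspace X \<times> {0..1}\<close>, that is, a set
  over \<open>'u \<times> real\<close>; to get a space with points in \<open>'u\<close> again, such a class is named by the image of
  one of its elements under a fixed injection \<open>code :: 'u \<times> real \<Rightarrow> 'u\<close>. Distinct classes are
  disjoint and hence get distinct names.\<close>

definition torus_rel :: "('u \<Rightarrow> 'u) \<Rightarrow> 'u topology \<Rightarrow> (('u \<times> real) \<times> ('u \<times> real)) set" where
  "torus_rel f X = \<Inter>{r. equiv (topspace X \<times> {0..1}) r \<and> (\<forall>x\<in>topspace X. ((x, 1), (f x, 0)) \<in> r)}"

definition torus_pt :: "('u \<times> real \<Rightarrow> 'u) \<Rightarrow> ('u \<Rightarrow> 'u) \<Rightarrow> 'u topology \<Rightarrow> 'u \<times> real \<Rightarrow> 'u" where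
  "torus_pt code f X p = code (SOME q. q \<in> torus_rel f X `` {p})"

definition quotient_topology :: "'a topology \<Rightarrow> ('a \<Rightarrow> 'b) \<Rightarrow> 'b topology" where
  "quotient_topology Z q =
     topology (\<lambda>U. U \<subseteq> q ` topspace Z \<and> openin Z {z \<in> topspace Z. q z \<in> U})"

lemma quotient_map_quotient_topology: "quotient_map Z (quotient_topology Z q) q"
proof -
  let ?P = "\<lambda>U. U \<subseteq> q ` topspace Z \<and> openin Z {z \<in> topspace Z. q z \<in> U}"
  have "istopology ?P"
    unfolding istopology_def
  proof (intro conjI allI impI)
    fix S T assume "?P S" "?P T"
    moreover have "{z \<in> topspace Z. q z \<in> S \<inter> T} =
        {z \<in> topspace Z. q z \<in> S} \<inter> {z \<in> topspace Z. q z \<in> T}"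
      by auto
    ultimately show "S \<inter> T \<subseteq> q ` topspace Z" "openin Z {z \<in> topspace Z. q z \<in> S \<inter> T}"
      by auto
  next
    fix K assume K: "\<forall>U\<in>K. ?P U"
    have eq: "{z \<in> topspace Z. q z \<in> \<Union>K} = \<Union>((\<lambda>U. {z \<in> topspace Z. q z \<in> U}) ` K)"
      by auto
    show "openin Z {z \<in> topspace Z. q z \<in> \<Union>K}"
      unfolding eq using K by (intro openin_Union) auto
    show "\<Union>K \<subseteq> q ` topspace Z"
      using K by auto
  qed
  then have op: "openin (quotient_topology Z q) = ?P"
    unfolding quotient_topology_def by (rule topology_inverse')
  have "{z \<in> topspace Z. q z \<in> q ` topspace Z} = topspace Z"
    by auto
  then have "?P (q ` topspace Z)"
    by simp
  then have "topspace (quotient_topology Z q) = q ` topspace Z"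
    unfolding topspace_def op by blast
  then show ?thesis
    unfolding quotient_map_def op by auto
qed

definition torus :: "('u \<times> real \<Rightarrow> 'u) \<Rightarrow> ('u \<Rightarrow> 'u) \<Rightarrow> 'u topology \<Rightarrow> 'u topology" where
  "torus code f X =
     quotient_topology (prod_topology X (top_of_set {0..1})) (torus_pt code f X)"

definition torus_coord :: "('u \<times> real \<Rightarrow> 'u) \<Rightarrow> ('u \<Rightarrow> 'u) \<Rightarrow> 'u topology \<Rightarrow> 'u \<Rightarrow> 'u \<times> real" where
  "torus_coord code f X p =
     (THE (x, t). x \<in> topspace X \<and> 0 \<le> t \<and> t < 1 \<and> p = torus_pt code f X (x, t))"

definition suspension_flow ::
    "('u \<times> real \<Rightarrow> 'u) \<Rightarrow> ('u \<Rightarrow> 'u) \<Rightarrow> 'u topology \<Rightarrow> 'u \<times> real \<Rightarrow> 'u" where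
  "suspension_flow code f X = (\<lambda>(p, s)\<in>topspace (torus code f X) \<times> UNIV.
     let (x, t) = torus_coord code f X p;
         n = (THE n :: int. s + t - 1 < real_of_int n \<and> real_of_int n \<le> s + t)
     in torus_pt code f X (int_iter (topspace X) f n x, s + t - real_of_int n))"

definition Suspension ::
    "('u \<times> real \<Rightarrow> 'u) \<Rightarrow> ('u map_obj, 'u \<Rightarrow> 'u, 'u flow_obj, 'u \<Rightarrow> 'u) func" where
  "Suspension code = \<lparr>src = MapCat, tgt = FlowGS,
     omap = (\<lambda>(f, X). (suspension_flow code f X, torus code f X,
               {torus_pt code f X (x, 0) | x. x \<in> topspace X})),
     amap = (\<lambda>(f, X) (g, Y) h. \<lambda>p\<in>topspace (torus code f X).
               let (x, t) = torus_coord code f X p in torus_pt code g Y (h x, t))\<rparr>"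

end

theory Submission
  imports Defs
begin

text \<open>
  The unit of the adjunction is the identification of \<open>x\<close> with the point \<open>[x, 0]\<close> of the
  mapping torus, so the bijection of hom-sets restricts a morphism \<open>(k, \<sigma>)\<close> from the suspension of
  \<open>f\<close> to \<open>(\<Psi>, Y, S')\<close> to the section \<open>X \<times> {0}\<close>. The whole point is that a rate-preserving \<open>(k, \<sigma>)\<close>
  can be recovered from this restriction \<open>g\<close>, and that every \<open>g\<close> with \<open>g \<circ> f = P\<Psi> \<circ> g\<close> arises.

  For a point \<open>y\<close> of a global section let \<open>hit y v\<close> be the integral of the rate function of \<open>y\<close>
  from 0 to \<open>v\<close>. It is piecewise linear and \<open>hit y n\<close> is the time of the \<open>n\<close>-th return of \<open>y\<close>. In a
  suspension every return time is 1, so \<open>hit\<close> is the identity there, and being rate-preserving says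
  \<open>\<sigma> ([x, t], s) = hit (g x) (s + t) - t T (g x)\<close>, where \<open>T\<close> is the return time of \<open>\<Psi>\<close>. Since
  \<open>[x, t]\<close> lies on the orbit of \<open>[x, 0]\<close>, it follows that \<open>k [x, t] = \<Psi> (g x, t T (g x))\<close>
  (\<open>morphism_determined\<close>). Conversely, these two formulas define a morphism for every \<open>g\<close>
  (\<open>lift_in_homs\<close>), because \<open>k\<close> then maps the point reached from \<open>[x, 0]\<close> after any time \<open>t\<close>, not
  only \<open>0 \<le> t < 1\<close>, to \<open>\<Psi> (g x, hit (g x) t)\<close> (\<open>lift_cov\<close>).

  Three facts about a global section \<open>S\<close> make these formulas meaningful. The return time is
  attained and continuous on \<open>S\<close> (\<open>continuous_map_return_time\<close>), which makes \<open>k\<close> continuous. The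
  Poincare map is a homeomorphism (\<open>homeomorphic_map_poincare\<close>), its inverse being the Poincare map
  of the reversed flow. Return times of one orbit do not accumulate (\<open>return_times_no_limit\<close>), so
  \<open>hit y\<close> is an increasing homeomorphism of \<open>\<real>\<close> (\<open>hit_surj\<close>), and hence so is \<open>\<sigma> (p, _)\<close>. All this
  uses only that \<open>S\<close> is closed, that returns are locally uniformly isolated, that orbits passing
  near \<open>S\<close> meet it at nearly the same time, and that all orbits return in both directions of time;
  the locale \<open>section_flow\<close> collects these properties.

  The other half of the work is that the suspension is an object at all. The mapping torus is
  the quotient of \<open>X \<times> \<real>\<close> by the action of \<open>\<int>\<close> generated by \<open>(x, s) \<mapsto> (f x, s - 1)\<close>, and the
  suspension flow is the translation of the second coordinate. The covering map \<open>cov\<close> is open, so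
  continuity and separation can be checked on \<open>X \<times> \<real>\<close>, and it is injective on strips of width 1, which
  gives charts in which the flow is vertical and the section is a hyperplane.
\<close>

section \<open>Integer iterates of a bijection\<close>

lemma int_iter_0 [simp]: "int_iter A f 0 x = x"
  by (simp add: int_iter_def)

context
  fixes A :: "'a set" and f :: "'a \<Rightarrow> 'a"
  assumes bij: "bij_betw f A A"
begin

lemma int_iter_closed: "x \<in> A \<Longrightarrow> int_iter A f i x \<in> A"
proof -
  assume x: "x \<in> A"
  have "(f ^^ k) x \<in> A" "(inv_into A f ^^ k) x \<in> A" for k
    using x bij by (induction k) (auto simp: bij_betw_def inv_into_into)
  then show ?thesis by (simp add: int_iter_def)
qed

lemma int_iter_succ:
  assumes "x \<in> A" shows "int_iter A f (i + 1) x = f (int_iter A f i x)"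
proof (cases "0 \<le> i")
  case True
  then show ?thesis by (simp add: int_iter_def nat_add_distrib)
next
  case False
  define k where "k = nat (- (i + 1))"
  have i: "i = - int (Suc k)" using False by (simp add: k_def)
  have "int_iter A f (i + 1) x = (inv_into A f ^^ k) x"
    using i by (auto simp: int_iter_def)
  moreover from this have "(inv_into A f ^^ k) x \<in> A"
    using int_iter_closed[OF assms, of "i+1"] by simp
  moreover have "int_iter A f i x = inv_into A f ((inv_into A f ^^ k) x)"
    using i by (simp add: int_iter_def nat_add_distrib)
  ultimately show ?thesis
    using bij by (simp add: bij_betw_def f_inv_into_f)
qed

lemma int_iter_add:
  assumes "x \<in> A" shows "int_iter A f (i + j) x = int_iter A f i (int_iter A f j x)"
proof (induction i rule: int_induct[where k=0])
  case base show ?case by simp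
next
  case (step1 i)
  then show ?case
    using int_iter_succ[OF assms, of "i + j"] int_iter_succ[OF int_iter_closed[OF assms], of i j]
    by (simp add: algebra_simps)
next
  case (step2 i)
  have "f (int_iter A f (i - 1 + j) x) = f (int_iter A f (i - 1) (int_iter A f j x))"
    using step2 int_iter_succ[OF assms, of "i - 1 + j"]
      int_iter_succ[OF int_iter_closed[OF assms], of "i - 1" j]
    by (simp add: algebra_simps)
  then show ?case
    using bij assms by (meson bij_betw_imp_inj_on inj_onD int_iter_closed)
qed

end

text \<open>For negative powers, apply \<open>g\<close> to the two sides at \<open>i - 1\<close>: the results are the two sides at
  \<open>i\<close>, and \<open>g\<close> is injective.\<close>

lemma int_iter_semiconj:
  assumes f: "bij_betw f A A" and g: "bij_betw g B B" and h: "\<And>x. x \<in> A \<Longrightarrow> h x \<in> B"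
    and hf: "\<And>x. x \<in> A \<Longrightarrow> h (f x) = g (h x)" and x: "x \<in> A"
  shows "h (int_iter A f i x) = int_iter B g i (h x)"
proof (induction i rule: int_induct[where k=0])
  case base show ?case by simp
next
  case (step1 i)
  then show ?case
    using hf[OF int_iter_closed[OF f x]] int_iter_succ[OF f x] int_iter_succ[OF g h[OF x]] by simp
next
  case (step2 i)
  have "g (h (int_iter A f (i - 1) x)) = g (int_iter B g (i - 1) (h x))"
    using step2 hf[OF int_iter_closed[OF f x], of "i - 1"] int_iter_succ[OF f x, of "i - 1"]
      int_iter_succ[OF g h[OF x], of "i - 1"] by simp
  then show ?case
    using g h x int_iter_closed[OF f] int_iter_closed[OF g]
    by (meson bij_betw_imp_inj_on inj_onD)
qed

lemma homeomorphic_map_imp_bij_betw: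
  assumes "homeomorphic_map X Y f" shows "bij_betw f (topspace X) (topspace Y)"
  using assms by (simp add: bij_betw_def homeomorphic_eq_everything_map)

lemma continuous_map_int_iter:
  assumes f: "homeomorphic_map X X f"
  shows "continuous_map X X (int_iter (topspace X) f i)"
proof (induction i rule: int_induct[where k=0])
  case base
  show ?case by (rule continuous_map_eq[OF continuous_map_id]) simp
next
  case (step1 i)
  show ?case
    by (rule continuous_map_eq[OF continuous_map_compose[OF step1(2) homeomorphic_imp_continuous_map[OF f]]])
      (simp add: int_iter_succ[OF homeomorphic_map_imp_bij_betw[OF f]])
next
  case (step2 i)
  obtain g where g: "homeomorphic_maps X X f g"
    using f homeomorphic_map_maps by blast
  have "continuous_map X X (g \<circ> int_iter (topspace X) f i)"
    using step2(2) g unfolding homeomorphic_maps_def by (blast intro: continuous_map_compose)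
  then show ?case
  proof (rule continuous_map_eq)
    fix x assume x: "x \<in> topspace X"
    have "int_iter (topspace X) f i x = f (int_iter (topspace X) f (i - 1) x)"
      using int_iter_succ[OF homeomorphic_map_imp_bij_betw[OF f] x, of "i - 1"] by simp
    then show "(g \<circ> int_iter (topspace X) f i) x = int_iter (topspace X) f (i - 1) x"
      using g int_iter_closed[OF homeomorphic_map_imp_bij_betw[OF f] x]
      by (simp add: homeomorphic_maps_def)
  qed
qed

section \<open>Antiderivatives of step functions\<close>

lemma strict_mono_surj_homeomorphic_map:
  fixes f :: "real \<Rightarrow> real"
  assumes "strict_mono f" "surj f"
  shows "homeomorphic_map euclideanreal euclideanreal f"
proof -
  have f: "bij f" using assms by (simp add: bij_def strict_mono_imp_inj_on)
  have g: "inv f x \<le> inv f y" if "x \<le> y" for x y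
    using that assms by (metis strict_mono_less_eq surj_f_inv_f)
  have "continuous_on UNIV f"
    using assms by (intro continuous_onI_mono) (auto simp: strict_mono_less_eq)
  moreover have "continuous_on UNIV (inv f)"
    using f g by (intro continuous_onI_mono) (auto simp: bij_imp_bij_inv bij_is_surj)
  ultimately have "homeomorphic_maps euclideanreal euclideanreal f (inv f)"
    using f by (simp add: homeomorphic_maps_def bij_is_inj bij_is_surj surj_f_inv_f)
  then show ?thesis using homeomorphic_map_maps by blast
qed

text \<open>With \<open>c i\<close> the \<open>i\<close>-th return time of a point of a section, the integrand is the rate function
  of this point.\<close>

definition step_integral :: "(int \<Rightarrow> real) \<Rightarrow> real \<Rightarrow> real" where
  "step_integral c v = (LBINT u=0..v. c \<lfloor>u\<rfloor>)"

lemma step_integrable: "interval_lebesgue_integrable lborel (ereal a) (ereal b) (\<lambda>u. c \<lfloor>u\<rfloor> :: real)"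
proof -
  have *: "set_integrable lborel {a..b} (\<lambda>u. c \<lfloor>u\<rfloor>)" for a b :: real
  proof -
    define M where "M = (\<Sum>i\<in>{\<lfloor>a\<rfloor>..\<lfloor>b\<rfloor>}. \<bar>c i\<bar>)"
    have le: "norm (c \<lfloor>u\<rfloor>) \<le> M" if "u \<in> {a..b}" for u
      unfolding M_def real_norm_def
      by (rule member_le_sum) (use that in \<open>auto intro: floor_mono\<close>)
    have meas: "(\<lambda>u::real. c \<lfloor>u\<rfloor>) \<in> borel_measurable borel"
      by (rule measurable_compose[OF measurable_real_floor]) simp
    show "set_integrable lborel {a..b} (\<lambda>u. c \<lfloor>u\<rfloor>)"
      unfolding set_integrable_def
    proof (rule Bochner_Integration.integrable_bound)
      show "integrable lborel (\<lambda>u. indicator {a..b} u *\<^sub>R M)"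
        by (rule borel_integrable_compact) auto
      show "AE u in lborel. norm (indicator {a..b} u *\<^sub>R c \<lfloor>u\<rfloor>) \<le> norm (indicator {a..b} u *\<^sub>R M)"
        using le by (intro always_eventually) (force simp: indicator_def)
    qed (use meas in measurable)
  qed
  show ?thesis
    using set_integrable_subset[OF *[of a b], of "{a<..<b}"]
      set_integrable_subset[OF *[of b a], of "{b<..<a}"]
    by (auto simp: interval_lebesgue_integrable_def greaterThanLessThan_subseteq_atLeastAtMost_iff)
qed

lemma step_integral_0 [simp]: "step_integral c 0 = 0"
  by (simp add: step_integral_def zero_ereal_def[symmetric])

lemma step_integral_linear:
  assumes "of_int n \<le> a" "a \<le> b" "b \<le> of_int n + 1"
  shows "step_integral c b = step_integral c a + (b - a) * c n"
proof -
  have "(LBINT u=a..b. c \<lfloor>u\<rfloor>) = (LBINT u=a..b. c n)"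
  proof (rule interval_integral_cong)
    fix u assume "u \<in> einterval (min (ereal a) (ereal b)) (max (ereal a) (ereal b))"
    then have "\<lfloor>u\<rfloor> = n" using assms by (intro floor_unique) (auto simp: einterval_def)
    then show "c \<lfloor>u\<rfloor> = c n" by simp
  qed
  also have "\<dots> = (b - a) * c n"
    using assms by simp
  finally have ab: "(LBINT u=a..b. c \<lfloor>u\<rfloor>) = (b - a) * c n" .
  have "(LBINT u=0..a. c \<lfloor>u\<rfloor>) + (LBINT u=a..b. c \<lfloor>u\<rfloor>) = (LBINT u=0..b. c \<lfloor>u\<rfloor>)"
    by (rule interval_integral_sum)
      (simp add: zero_ereal_def min_def max_def step_integrable)
  then show ?thesis using ab by (simp add: step_integral_def)
qed

lemma step_integral_floor:
  "step_integral c v = step_integral c (of_int \<lfloor>v\<rfloor>) + (v - of_int \<lfloor>v\<rfloor>) * c \<lfloor>v\<rfloor>"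
  by (rule step_integral_linear) (auto intro: less_imp_le)

lemma step_integral_unit: "0 \<le> v \<Longrightarrow> v \<le> 1 \<Longrightarrow> step_integral c v = v * c 0"
  using step_integral_linear[of 0 0 v c] by simp

lemma step_integral_Suc: "step_integral c (of_int n + 1) = step_integral c (of_int n) + c n"
  using step_integral_linear[of n "of_int n" "of_int n + 1" c] by simp

lemma step_integral_const_1: "step_integral (\<lambda>_. 1) v = v"
  unfolding step_integral_def zero_ereal_def interval_integral_const by simp

lemma step_integral_ints_strict_mono:
  fixes m n :: int
  assumes pos: "\<And>i. c i > 0" and "m < n"
  shows "step_integral c (of_int m) < step_integral c (of_int n)"
proof -
  have "step_integral c (of_int m) < step_integral c (of_int (m + 1 + int k))" for k
  proof (induction k)
    case 0 then show ?case using step_integral_Suc[of c m] pos[of m] by simp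
  next
    case (Suc k)
    then show ?case using step_integral_Suc[of c "m + 1 + int k"] pos[of "m + 1 + int k"]
      by (simp add: algebra_simps)
  qed
  from this[of "nat (n - m - 1)"] show ?thesis using \<open>m < n\<close> by simp
qed

lemma step_integral_strict_mono:
  assumes pos: "\<And>i. c i > 0"
  shows "strict_mono (step_integral c)"
proof (rule strict_monoI)
  fix v w :: real assume "v < w"
  show "step_integral c v < step_integral c w"
  proof (cases "\<lfloor>v\<rfloor> = \<lfloor>w\<rfloor>")
    case True
    have "step_integral c w = step_integral c v + (w - v) * c \<lfloor>v\<rfloor>"
      using \<open>v < w\<close> True by (intro step_integral_linear) linarith+
    then show ?thesis using pos \<open>v < w\<close> by simp
  next
    case False
    then have lt: "\<lfloor>v\<rfloor> + 1 \<le> \<lfloor>w\<rfloor>" using \<open>v < w\<close> by (simp add: floor_mono order_neq_le_trans zless_imp_add1_zle less_imp_le)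
    have "step_integral c (of_int \<lfloor>v\<rfloor> + 1) = step_integral c v + (of_int \<lfloor>v\<rfloor> + 1 - v) * c \<lfloor>v\<rfloor>"
      by (intro step_integral_linear) linarith+
    moreover have "(of_int \<lfloor>v\<rfloor> + 1 - v) * c \<lfloor>v\<rfloor> > 0"
      using pos[of "\<lfloor>v\<rfloor>"] by (intro mult_pos_pos) linarith+
    moreover have "step_integral c (of_int (\<lfloor>v\<rfloor> + 1)) \<le> step_integral c (of_int \<lfloor>w\<rfloor>)"
      using step_integral_ints_strict_mono[of c, OF pos] lt by (metis order_le_less)
    moreover have "step_integral c (of_int \<lfloor>w\<rfloor>) \<le> step_integral c w"
      using pos[of "\<lfloor>w\<rfloor>"] by (subst (2) step_integral_floor) (simp add: less_imp_le)
    ultimately show ?thesis by simp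
  qed
qed

text \<open>The values at integers are unbounded in both directions, so some interval between consecutive
  ones contains \<open>y\<close>; on this interval the function is affine with positive slope.\<close>

lemma step_integral_surj:
  assumes pos: "\<And>i. c i > 0"
    and up: "\<And>y. \<exists>k::nat. y < step_integral c (of_int (int k))"
    and down: "\<And>y. \<exists>k::nat. step_integral c (of_int (- int k)) < y"
  shows "surj (step_integral c)"
proof (rule surjI[where g = "\<lambda>v. step_integral c v" and f = "\<lambda>y. SOME v. step_integral c v = y"], rule someI_ex)
  fix y :: real
  obtain k l where k: "step_integral c (of_int (- int k)) < y" and l: "y < step_integral c (of_int (int l))"
    using up down by blast
  \<comment> \<open>The integers are searched upwards from \<open>- k\<close>, so that the least solution is a natural number.\<close>
  let ?Q = "\<lambda>j::nat. y < step_integral c (of_int (int j - int k))"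
  have "?Q (l + k)" using l by simp
  define j where "j = (LEAST j. ?Q j)"
  have Q: "?Q j" unfolding j_def using \<open>?Q (l + k)\<close> by (rule LeastI)
  have "j \<noteq> 0"
  proof
    assume "j = 0"
    with Q k show False by simp
  qed
  then obtain i where i: "j = Suc i" by (cases j) auto
  have "\<not> ?Q i" using i not_less_Least[of i ?Q] by (simp add: j_def)
  define n where "n = int i - int k"
  have lo: "step_integral c (of_int n) \<le> y" using \<open>\<not> ?Q i\<close> by (simp add: n_def)
  have hi: "y < step_integral c (of_int n) + c n"
    using Q i step_integral_Suc[of c n] by (simp add: n_def algebra_simps)
  define v where "v = of_int n + (y - step_integral c (of_int n)) / c n"
  have "step_integral c v = step_integral c (of_int n) + (v - of_int n) * c n"
    using lo hi pos[of n] by (intro step_integral_linear) (auto simp: v_def field_simps)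
  then show "\<exists>v. step_integral c v = y"
    using pos[of n] by (intro exI[of _ v]) (simp add: v_def)
qed

section \<open>Flows with a section\<close>

lemma continuous_map_to_realI:
  fixes f :: "'a \<Rightarrow> real"
  assumes "\<And>x e. \<lbrakk>x \<in> topspace X; 0 < e\<rbrakk> \<Longrightarrow>
    \<exists>U. openin X U \<and> x \<in> U \<and> (\<forall>y\<in>U. \<bar>f y - f x\<bar> < e)"
  shows "continuous_map X euclideanreal f"
  unfolding continuous_map_def
proof (intro conjI allI impI)
  fix W assume "openin euclideanreal W"
  then have W: "open W" by simp
  show "openin X {x \<in> topspace X. f x \<in> W}"
  proof (subst openin_subopen, intro ballI)
    fix x assume x: "x \<in> {x \<in> topspace X. f x \<in> W}"
    then obtain e where e: "e > 0" "\<And>r. \<bar>r - f x\<bar> < e \<Longrightarrow> r \<in> W"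
      using W by (auto simp: open_dist dist_real_def)
    with assms[of x e] x obtain U where "openin X U" "x \<in> U" "\<forall>y\<in>U. \<bar>f y - f x\<bar> < e"
      by auto
    then show "\<exists>T. openin X T \<and> x \<in> T \<and> T \<subseteq> {x \<in> topspace X. f x \<in> W}"
      using e openin_subset[of X U] by (intro exI[of _ U]) auto
  qed
qed simp

lemma return_time_eqI:
  assumes "0 < t" "\<Phi> (x, t) \<in> S" "\<And>s. 0 < s \<Longrightarrow> s < t \<Longrightarrow> \<Phi> (x, s) \<notin> S"
  shows "return_time \<Phi> S x = t"
  unfolding return_time_def using assms by (intro Least_equality) (auto simp: not_less[symmetric])

text \<open>These are the consequences of topological transversality from which the properties of the
  return map follow. \<open>isolated\<close> says that there are no quick returns, uniformly near each point of
  the section, and \<open>crossing\<close>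
  that the section cannot be avoided by orbits that pass close to it. Both are symmetric in time, so they
  hold for the reversed flow as well; this gives the continuity of the inverse of the Poincare map for free.\<close>

locale section_flow =
  fixes X :: "'a topology" and \<Phi> :: "'a \<times> real \<Rightarrow> 'a" and S :: "'a set"
  assumes cont: "continuous_map (prod_topology X euclideanreal) X \<Phi>"
    and flow_0: "x \<in> topspace X \<Longrightarrow> \<Phi> (x, 0) = x"
    and flow_add: "x \<in> topspace X \<Longrightarrow> \<Phi> (\<Phi> (x, t), s) = \<Phi> (x, t + s)"
    and closed: "closedin X S"
    and isolated: "x \<in> S \<Longrightarrow> \<exists>V d. openin X V \<and> x \<in> V \<and> 0 < d \<and>
      (\<forall>y\<in>V \<inter> S. \<forall>t. t \<noteq> 0 \<and> \<bar>t\<bar> < d \<longrightarrow> \<Phi> (y, t) \<notin> S)"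
    and crossing: "x \<in> S \<Longrightarrow> 0 < e \<Longrightarrow> \<exists>W. openin X W \<and> x \<in> W \<and> (\<forall>y\<in>W. \<exists>t. \<bar>t\<bar> < e \<and> \<Phi> (y, t) \<in> S)"
    and forward: "x \<in> topspace X \<Longrightarrow> \<exists>t>0. \<Phi> (x, t) \<in> S"
    and backward: "x \<in> topspace X \<Longrightarrow> \<exists>t<0. \<Phi> (x, t) \<in> S"
begin

abbreviation T where "T \<equiv> return_time \<Phi> S"
abbreviation P where "P \<equiv> poincare_map \<Phi> S"

lemma reversed: "section_flow X (\<lambda>(x, t). \<Phi> (x, - t)) S"
proof
  have "continuous_map (prod_topology X euclideanreal) X (\<Phi> \<circ> (\<lambda>p. (fst p, - snd p)))"
    by (intro continuous_map_compose[OF _ cont] continuous_map_pairedI continuous_map_fst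
        continuous_map_minus continuous_map_snd)
  then show "continuous_map (prod_topology X euclideanreal) X (\<lambda>(x, t). \<Phi> (x, - t))"
    by (simp add: o_def case_prod_unfold)
next
  fix x assume "x \<in> S"
  with isolated[OF this] show "\<exists>V d. openin X V \<and> x \<in> V \<and> 0 < d \<and>
      (\<forall>y\<in>V \<inter> S. \<forall>t. t \<noteq> 0 \<and> \<bar>t\<bar> < d \<longrightarrow> (\<lambda>(x, t). \<Phi> (x, - t)) (y, t) \<notin> S)"
    by (metis (mono_tags, lifting) abs_minus case_prod_conv neg_equal_0_iff_equal)
next
  fix x and e :: real assume "x \<in> S" "0 < e"
  with crossing[OF this] show "\<exists>W. openin X W \<and> x \<in> W \<and>
      (\<forall>y\<in>W. \<exists>t. \<bar>t\<bar> < e \<and> (\<lambda>(x, t). \<Phi> (x, - t)) (y, t) \<in> S)"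
    by (metis (mono_tags, lifting) abs_minus case_prod_conv minus_minus)
next
  fix x assume x: "x \<in> topspace X"
  show "\<exists>t>0. (\<lambda>(x, t). \<Phi> (x, - t)) (x, t) \<in> S"
    using backward[OF x] by (metis case_prod_conv minus_minus neg_0_less_iff_less)
  show "\<exists>t<0. (\<lambda>(x, t). \<Phi> (x, - t)) (x, t) \<in> S"
    using forward[OF x] by (metis case_prod_conv minus_minus neg_less_0_iff_less)
qed (auto simp: flow_0 flow_add closed add.commute)

lemma in_space: "x \<in> S \<Longrightarrow> x \<in> topspace X"
  using closedin_subset[OF closed] by auto

lemma flow_in: "x \<in> topspace X \<Longrightarrow> \<Phi> (x, t) \<in> topspace X"
  using continuous_map_funspace[OF cont] by auto

lemma flow_time_continuous: "x \<in> topspace X \<Longrightarrow> continuous_map euclideanreal X (\<lambda>t. \<Phi> (x, t))"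
  using continuous_map_compose[OF _ cont, of euclideanreal "\<lambda>t. (x, t)"]
  by (simp add: o_def continuous_map_pairwise)

lemma flow_space_continuous: "continuous_map X X (\<lambda>x. \<Phi> (x, t))"
  using continuous_map_compose[OF _ cont, of X "\<lambda>x. (x, t)"]
  by (simp add: o_def continuous_map_pairwise)

lemma closed_times:
  assumes "x \<in> topspace X" shows "closed {t. \<Phi> (x, t) \<in> S}"
  using closedin_continuous_map_preimage[OF flow_time_continuous[OF assms] closed] by simp

text \<open>The set of times spent in the section is closed and 0 is isolated in it, so its positive part
  is closed too and has a least element.\<close>

lemma return_time:
  assumes x: "x \<in> S"
  shows return_time_pos: "T x > 0" and return_time_in: "\<Phi> (x, T x) \<in> S"
    and return_time_first: "\<And>s. 0 < s \<Longrightarrow> s < T x \<Longrightarrow> \<Phi> (x, s) \<notin> S"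
proof -
  obtain d where d: "d > 0" "\<And>t. t \<noteq> 0 \<Longrightarrow> \<bar>t\<bar> < d \<Longrightarrow> \<Phi> (x, t) \<notin> S"
    using isolated[OF x] x by auto
  define R where "R = {t. \<Phi> (x, t) \<in> S} \<inter> {d..}"
  have R: "t \<in> R" if "t > 0" "\<Phi> (x, t) \<in> S" for t
    using that d(2)[of t] by (force simp: R_def)
  have "closed R" unfolding R_def using closed_times[OF in_space[OF x]] by (intro closed_Int) auto
  moreover have ne: "R \<noteq> {}" using forward[OF in_space[OF x]] R by blast
  moreover have bdd: "bdd_below R" by (auto simp: R_def)
  ultimately have inf: "Inf R \<in> R" by (intro closed_contains_Inf)
  have "T x = Inf R"
  proof (rule return_time_eqI)
    show "0 < Inf R" "\<Phi> (x, Inf R) \<in> S" using inf d(1) by (auto simp: R_def)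
    show "\<Phi> (x, s) \<notin> S" if "0 < s" "s < Inf R" for s
      using that R[of s] cInf_lower[OF _ bdd, of s] by fastforce
  qed
  then show "T x > 0" "\<Phi> (x, T x) \<in> S" using inf d(1) by (auto simp: R_def)
  show "\<Phi> (x, s) \<notin> S" if "0 < s" "s < T x" for s
    using that R[of s] cInf_lower[OF _ bdd, of s] \<open>T x = Inf R\<close> by fastforce
qed

lemma return_time_le: "x \<in> S \<Longrightarrow> 0 < t \<Longrightarrow> \<Phi> (x, t) \<in> S \<Longrightarrow> T x \<le> t"
  using return_time_first by (meson not_le)

text \<open>Upper semicontinuity is the crossing property at the point of return. For lower
  semicontinuity, the orbit of \<open>x\<close> avoids the closed section during the compact interval
  \<open>[d / 2, T x - e]\<close>, hence so do the orbits of nearby points, and these points do not return before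
  time \<open>d\<close> if they are in the section.\<close>

lemma continuous_map_return_time:
  "continuous_map (subtopology X S) euclideanreal T"
proof (rule continuous_map_to_realI)
  fix x and e :: real assume "x \<in> topspace (subtopology X S)" and e: "0 < e"
  then have x: "x \<in> S" "x \<in> topspace X" by auto
  obtain W where W: "openin X W" "\<Phi> (x, T x) \<in> W" "\<And>y. y \<in> W \<Longrightarrow> \<exists>t. \<bar>t\<bar> < min e (T x) \<and> \<Phi> (y, t) \<in> S"
    using crossing[OF return_time_in[OF x(1)], of "min e (T x)"] e return_time_pos[OF x(1)] by auto
  define U1 where "U1 = {y \<in> topspace X. \<Phi> (y, T x) \<in> W}"
  have U1: "openin X U1"
    unfolding U1_def by (rule openin_continuous_map_preimage[OF flow_space_continuous W(1)])
  have upper: "T y < T x + e" if y: "y \<in> U1" "y \<in> S" for y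
  proof -
    obtain t where t: "\<bar>t\<bar> < min e (T x)" "\<Phi> (\<Phi> (y, T x), t) \<in> S"
      using y(1) W(3)[of "\<Phi> (y, T x)"] unfolding U1_def by blast
    then have "T y \<le> T x + t"
      using y in_space by (intro return_time_le) (auto simp: flow_add)
    then show ?thesis using t(1) by linarith
  qed
  obtain V d where V: "openin X V" "x \<in> V" "0 < d"
    "\<And>y t. y \<in> V \<Longrightarrow> y \<in> S \<Longrightarrow> t \<noteq> 0 \<Longrightarrow> \<bar>t\<bar> < d \<Longrightarrow> \<Phi> (y, t) \<notin> S"
    using isolated[OF x(1)] by auto
  define O' where "O' = {p \<in> topspace (prod_topology X euclideanreal). \<Phi> p \<in> topspace X - S}"
  have "openin (prod_topology X euclideanreal) O'"
    unfolding O'_def using closed by (intro openin_continuous_map_preimage[OF cont]) auto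
  moreover have "{x} \<times> {d/2..T x - e} \<subseteq> O'"
    using return_time_first[OF x(1)] flow_in[OF x(2)] x e V(3) by (auto simp: O'_def)
  ultimately obtain U2 K where U2: "openin X U2" "x \<in> U2" "{d/2..T x - e} \<subseteq> K" "U2 \<times> K \<subseteq> O'"
    using tube_lemma_right[of X euclideanreal O' "{d/2..T x - e}" x] x(2) by auto
  have lower: "T x - e < T y" if "y \<in> U2" "y \<in> V" "y \<in> S" for y
  proof (rule ccontr)
    assume "\<not> T x - e < T y"
    moreover have "T y \<ge> d" using V(4)[of y "T y"] that return_time[of y] by force
    ultimately have "T y \<in> {d/2..T x - e}" using V(3) by simp
    then have "(y, T y) \<in> O'" using U2(3,4) that(1) by blast
    then show False using return_time_in[OF that(3)] by (simp add: O'_def)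
  qed
  show "\<exists>U. openin (subtopology X S) U \<and> x \<in> U \<and> (\<forall>y\<in>U. \<bar>T y - T x\<bar> < e)"
  proof (intro exI[of _ "S \<inter> (U1 \<inter> U2 \<inter> V)"] conjI ballI)
    show "openin (subtopology X S) (S \<inter> (U1 \<inter> U2 \<inter> V))"
      using U1 U2 V by (intro openin_subtopology_Int2) auto
    show "x \<in> S \<inter> (U1 \<inter> U2 \<inter> V)" using x U2 V W by (simp add: U1_def)
    fix y assume "y \<in> S \<inter> (U1 \<inter> U2 \<inter> V)"
    then show "\<bar>T y - T x\<bar> < e" using upper[of y] lower[of y] by auto
  qed
qed

lemma poincare_map_eq: "x \<in> S \<Longrightarrow> P x = \<Phi> (x, T x)"
  by (simp add: poincare_map_def)

lemma poincare_map_in: "x \<in> S \<Longrightarrow> P x \<in> S"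
  by (simp add: poincare_map_eq return_time_in)

lemma continuous_map_poincare:
  "continuous_map (subtopology X S) (subtopology X S) P"
proof -
  have "continuous_map (subtopology X S) X (\<Phi> \<circ> (\<lambda>x. (x, T x)))"
    by (intro continuous_map_compose[OF _ cont] continuous_map_pairedI continuous_map_return_time
        continuous_map_from_subtopology continuous_map_id[unfolded id_def])
  then have "continuous_map (subtopology X S) X P"
    by (rule continuous_map_eq) (simp add: poincare_map_def)
  then show ?thesis by (auto simp: continuous_map_in_subtopology poincare_map_in)
qed

text \<open>Backwards from \<open>P x\<close>, the first visit to the section is \<open>x\<close> itself, as there is none between
  \<open>x\<close> and \<open>P x\<close>.\<close>

lemma poincare_map_reversed:
  assumes x: "x \<in> S"
  shows "poincare_map (\<lambda>(x, t). \<Phi> (x, - t)) S (P x) = x"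
proof -
  have "return_time (\<lambda>(x, t). \<Phi> (x, - t)) S (P x) = T x"
    by (rule return_time_eqI)
      (use x return_time[OF x] in_space[OF x] in \<open>auto simp: poincare_map_def flow_add flow_0\<close>)
  then show ?thesis
    using x poincare_map_in[OF x] in_space[OF x]
    by (simp add: poincare_map_def flow_add flow_0)
qed

lemma homeomorphic_map_poincare:
  "homeomorphic_map (subtopology X S) (subtopology X S) P"
proof -
  interpret r: section_flow X "\<lambda>(x, t). \<Phi> (x, - t)" S by (rule reversed)
  have "homeomorphic_maps (subtopology X S) (subtopology X S) P r.P"
    using continuous_map_poincare r.continuous_map_poincare poincare_map_reversed
      r.poincare_map_reversed
    by (auto simp: homeomorphic_maps_def)
  then show ?thesis using homeomorphic_map_maps by blast
qed

lemma poincare_bij: "bij_betw P S S"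
  using homeomorphic_map_imp_bij_betw[OF homeomorphic_map_poincare] closedin_subset[OF closed]
  by (simp add: Int_absorb1)

abbreviation iter where "iter \<equiv> int_iter S P"

lemma iter_in: "x \<in> S \<Longrightarrow> iter n x \<in> S"
  by (rule int_iter_closed[OF poincare_bij])

text \<open>\<open>hit x n\<close> is the time of the \<open>n\<close>-th return of \<open>x\<close>, interpolated linearly in \<open>n\<close>.\<close>

definition hit :: "'a \<Rightarrow> real \<Rightarrow> real" where
  "hit x = step_integral (\<lambda>i. T (iter i x))"

lemma hit_0 [simp]: "hit x 0 = 0"
  by (simp add: hit_def)

lemma hit_unit: "0 \<le> v \<Longrightarrow> v \<le> 1 \<Longrightarrow> hit x v = v * T x"
  by (simp add: hit_def step_integral_unit)

lemma integral_rate: "(LBINT u=0..v. rate \<Phi> S x u) = hit x v"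
proof -
  have "rate \<Phi> S x u = T (iter \<lfloor>u\<rfloor> x)" for u
  proof -
    have "rate \<Phi> S x u = (\<Sum>\<^sub>\<infinity>i\<in>{\<lfloor>u\<rfloor>}. T (iter i x) * indicator {real_of_int i..<real_of_int i + 1} u)"
      unfolding rate_def
      by (rule infsum_cong_neutral) (auto simp: indicator_def intro: floor_unique[symmetric])
    then show ?thesis by (simp add: indicator_def)
  qed
  then show ?thesis by (simp add: hit_def step_integral_def)
qed

lemma hit_flow_int:
  assumes x: "x \<in> S" shows "\<Phi> (x, hit x (of_int n)) = iter n x"
proof (induction n rule: int_induct[where k=0])
  case base show ?case by (simp add: flow_0 in_space[OF x])
next
  case (step1 i)
  have "\<Phi> (x, hit x (of_int i + 1)) = \<Phi> (\<Phi> (x, hit x (of_int i)), T (iter i x))"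
    using in_space[OF x] by (simp add: hit_def step_integral_Suc flow_add)
  also have "\<dots> = P (iter i x)"
    using step1 poincare_map_eq[OF iter_in[OF x, of i]] by simp
  finally show ?case by (simp add: int_iter_succ[OF poincare_bij x])
next
  case (step2 i)
  define z where "z = iter (i - 1) x"
  have z: "z \<in> S" using iter_in[OF x] by (simp add: z_def)
  have "hit x (of_int i) = hit x (of_int (i - 1)) + T z"
    using step_integral_Suc[of "\<lambda>i. T (iter i x)" "i - 1"] by (simp add: hit_def z_def)
  then have "\<Phi> (x, hit x (of_int (i - 1))) = \<Phi> (\<Phi> (x, hit x (of_int i)), - T z)"
    using in_space[OF x] by (simp add: flow_add)
  also have "\<Phi> (x, hit x (of_int i)) = \<Phi> (z, T z)"
    using step2 int_iter_succ[OF poincare_bij x, of "i - 1"] poincare_map_eq[OF z] by (simp add: z_def)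
  also have "\<Phi> (\<dots>, - T z) = z"
    using in_space[OF z] by (simp add: flow_add flow_0)
  finally show ?case by (simp add: z_def)
qed

lemma hit_flow:
  assumes x: "x \<in> S"
  shows "\<Phi> (x, hit x v) = \<Phi> (iter \<lfloor>v\<rfloor> x, (v - of_int \<lfloor>v\<rfloor>) * T (iter \<lfloor>v\<rfloor> x))"
proof -
  have "hit x v = hit x (of_int \<lfloor>v\<rfloor>) + (v - of_int \<lfloor>v\<rfloor>) * T (iter \<lfloor>v\<rfloor> x)"
    unfolding hit_def by (rule step_integral_floor)
  then show ?thesis
    using in_space[OF x] by (metis flow_add hit_flow_int[OF x])
qed

lemma hit_strict_mono: "x \<in> S \<Longrightarrow> strict_mono (hit x)"
  unfolding hit_def by (intro step_integral_strict_mono return_time_pos iter_in)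

text \<open>The section is closed, so the limit is a return time too; but each return time is isolated.\<close>

lemma return_times_no_limit:
  assumes x: "x \<in> S" and a: "\<And>k::nat. \<Phi> (x, a k) \<in> S" "a \<longlonglongrightarrow> L"
  shows "\<exists>k. a k = L"
proof (rule ccontr)
  assume ne: "\<nexists>k. a k = L"
  have "L \<in> {t. \<Phi> (x, t) \<in> S}"
    by (rule closed_sequentially[OF closed_times[OF in_space[OF x]] _ a(2)]) (simp add: a)
  then have L: "\<Phi> (x, L) \<in> S" by simp
  obtain d where d: "d > 0" "\<And>t. t \<noteq> 0 \<Longrightarrow> \<bar>t\<bar> < d \<Longrightarrow> \<Phi> (\<Phi> (x, L), t) \<notin> S"
    using isolated[OF L] L by auto
  obtain k where "\<bar>a k - L\<bar> < d"
    using a(2) d(1) by (auto simp: lim_sequentially dist_real_def)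
  then have "\<Phi> (\<Phi> (x, L), a k - L) \<notin> S" using ne by (intro d(2)) auto
  then show False using a(1)[of k] in_space[OF x] by (simp add: flow_add)
qed

lemma hit_int_in: "x \<in> S \<Longrightarrow> \<Phi> (x, hit x (of_int n)) \<in> S"
  by (simp add: hit_flow_int iter_in)

lemma hit_unbounded_above:
  assumes x: "x \<in> S" shows "\<exists>k::nat. y < hit x (of_int (int k))"
proof (rule ccontr)
  assume "\<nexists>k::nat. y < hit x (of_int (int k))"
  then have b: "hit x (real k) \<le> y" for k by (auto simp: not_less)
  have inc: "incseq (\<lambda>k. hit x (real k))"
    using hit_strict_mono[OF x] by (auto simp: incseq_def strict_mono_less_eq)
  obtain L where L: "(\<lambda>k. hit x (real k)) \<longlonglongrightarrow> L" "\<forall>k. hit x (real k) \<le> L"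
    using incseq_convergent[OF inc] b by blast
  obtain k where k: "hit x (real k) = L"
    using return_times_no_limit[OF x _ L(1)] hit_int_in[OF x, of "int _"] by auto
  have "hit x (real k) < hit x (real (Suc k))"
    using hit_strict_mono[OF x] by (simp add: strict_mono_less)
  then show False using L(2) k by (metis not_less)
qed

lemma hit_unbounded_below:
  assumes x: "x \<in> S" shows "\<exists>k::nat. hit x (of_int (- int k)) < y"
proof (rule ccontr)
  assume "\<nexists>k::nat. hit x (of_int (- int k)) < y"
  then have b: "y \<le> hit x (- real k)" for k by (auto simp: not_less)
  have dec: "decseq (\<lambda>k. hit x (- real k))"
    using hit_strict_mono[OF x] by (auto simp: decseq_def strict_mono_less_eq)
  obtain L where L: "(\<lambda>k. hit x (- real k)) \<longlonglongrightarrow> L" "\<forall>k. L \<le> hit x (- real k)"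
    using decseq_convergent[OF dec] b by blast
  obtain k where k: "hit x (- real k) = L"
    using return_times_no_limit[OF x _ L(1)] hit_int_in[OF x, of "- int _"] by auto
  have "hit x (- real (Suc k)) < hit x (- real k)"
    using hit_strict_mono[OF x] by (simp add: strict_mono_less)
  then show False using L(2) k by (metis not_less)
qed

lemma hit_surj: "x \<in> S \<Longrightarrow> surj (hit x)"
  using hit_unbounded_above hit_unbounded_below unfolding hit_def
  by (intro step_integral_surj return_time_pos iter_in)

end

text \<open>The orbit of \<open>h x\<close> is the reparametrized orbit of \<open>x\<close>, and since \<open>S\<close> is the full preimage of
  \<open>S'\<close>, the times of return correspond to each other under the increasing bijection \<open>\<tau> (x, _)\<close>.\<close>

lemma weak_morphism_return:
  assumes "section_flow X \<Phi> S" "section_flow Y \<Psi> S'"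
    and h: "\<And>x t. x \<in> topspace X \<Longrightarrow> h (\<Phi> (x, t)) = \<Psi> (h x, \<tau> (x, t))"
    and \<tau>: "\<And>x. x \<in> topspace X \<Longrightarrow> strict_mono (\<lambda>t. \<tau> (x, t)) \<and>
      homeomorphic_map euclideanreal euclideanreal (\<lambda>t. \<tau> (x, t)) \<and> \<tau> (x, 0) = 0"
    and S: "S = {x \<in> topspace X. h x \<in> S'}" and x: "x \<in> S"
  shows "return_time \<Psi> S' (h x) = \<tau> (x, return_time \<Phi> S x)"
    and "h (poincare_map \<Phi> S x) = poincare_map \<Psi> S' (h x)"
proof -
  interpret A: section_flow X \<Phi> S by fact
  interpret B: section_flow Y \<Psi> S' by fact
  note xX = A.in_space[OF x]
  have in_iff: "\<Psi> (h x, \<tau> (x, t)) \<in> S' \<longleftrightarrow> \<Phi> (x, t) \<in> S" for t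
    using h[OF xX, of t] A.flow_in[OF xX, of t] S by auto
  have surj: "\<exists>t. \<tau> (x, t) = s" for s
    using \<tau>[OF xX] homeomorphic_imp_surjective_map[of euclideanreal euclideanreal "\<lambda>t. \<tau> (x, t)"]
    by (metis UNIV_I imageE topspace_euclidean)
  have less: "\<tau> (x, s) < \<tau> (x, t) \<longleftrightarrow> s < t" for s t
    using \<tau>[OF xX] strict_mono_less[of "\<lambda>t. \<tau> (x, t)"] by blast
  have pos: "0 < \<tau> (x, t) \<longleftrightarrow> 0 < t" for t
    using less[of 0 t] \<tau>[OF xX] by simp
  show *: "return_time \<Psi> S' (h x) = \<tau> (x, A.T x)"
  proof (rule return_time_eqI)
    show "0 < \<tau> (x, A.T x)" "\<Psi> (h x, \<tau> (x, A.T x)) \<in> S'"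
      using A.return_time[OF x] by (auto simp: pos in_iff)
    fix s assume s: "0 < s" "s < \<tau> (x, A.T x)"
    obtain t where "s = \<tau> (x, t)" using surj[of s] by blast
    then show "\<Psi> (h x, s) \<notin> S'"
      using s A.return_time_first[OF x, of t] by (auto simp: pos less in_iff)
  qed
  have "h x \<in> S'" using x S by blast
  then show "h (A.P x) = B.P (h x)"
    using x h[OF xX, of "A.T x"] * by (simp add: poincare_map_def)
qed

section \<open>Transversality\<close>

text \<open>The crossing property is the only one that needs an argument. Just before and just after \<open>x\<close>,
  the orbit of \<open>x\<close> is in different components of \<open>U - S\<close>. These components are open, because \<open>U\<close> is
  locally connected. So for \<open>y\<close> near \<open>x\<close> a short piece of the orbit of \<open>y\<close> stays in \<open>U\<close> and leads
  from one component to the other; being connected, it must meet \<open>S\<close>.\<close>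

lemma global_section_imp_section_flow:
  assumes "is_flow \<Phi> X" "global_section \<Phi> X S"
  shows "section_flow X \<Phi> S"
proof -
  have cont: "continuous_map (prod_topology X euclideanreal) X \<Phi>"
    and flow_0: "\<And>x. x \<in> topspace X \<Longrightarrow> \<Phi> (x, 0) = x"
    and flow_add: "\<And>x t s. x \<in> topspace X \<Longrightarrow> \<Phi> (\<Phi> (x, t), s) = \<Phi> (x, t + s)"
    using assms(1) by (auto simp: is_flow_def)
  obtain m where m: "transversal_dim m \<Phi> X S"
    using assms(2) by (auto simp: global_section_def transversal_def)
  then have closed: "closedin X S" by (auto simp: transversal_dim_def)
  obtain dp dm :: "'a \<Rightarrow> real" where d: "\<forall>x\<in>S. dp x > 0 \<and> dm x < 0 \<and>
        (\<exists>U \<phi>. openin X U \<and> x \<in> U \<and>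
           homeomorphic_map (subtopology X U)
             (subtopology (Euclidean_space (Suc m)) (unit_ball (Suc m))) \<phi> \<and>
           \<phi> ` (U \<inter> S) = unit_ball (Suc m) \<inter> topspace (Euclidean_space m) \<and>
           (\<exists>C\<in>connected_components_of (subtopology X (U - S)).
            \<exists>D\<in>connected_components_of (subtopology X (U - S)).
              C \<noteq> D \<and> \<Phi> ` ({x} \<times> {dm x..<0}) \<subseteq> C \<and> \<Phi> ` ({x} \<times> {0<..dp x}) \<subseteq> D) \<and>
           \<Phi> ` ({x} \<times> {dm x..dp x}) \<inter> S = {x} \<and>
           (\<exists>V \<delta>. openin X V \<and> x \<in> V \<and> V \<subseteq> U \<and> \<delta> > 0 \<and>
              (\<forall>y\<in>V \<inter> S. dp y > \<delta> \<and> dm y < -\<delta>)))"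
    using m unfolding transversal_dim_def by (elim conjE exE) (rule that)
  have avoid: "\<Phi> (x, t) \<notin> S" if x: "x \<in> S" and t: "t \<noteq> 0" "dm x \<le> t" "t \<le> dp x" for x t
  proof -
    obtain U C D where "C \<in> connected_components_of (subtopology X (U - S))"
      "D \<in> connected_components_of (subtopology X (U - S))"
      and CD: "\<Phi> ` ({x} \<times> {dm x..<0}) \<subseteq> C" "\<Phi> ` ({x} \<times> {0<..dp x}) \<subseteq> D"
      using bspec[OF d x] by (elim conjE exE bexE) (rule that)
    then have "C \<subseteq> topspace (subtopology X (U - S))" "D \<subseteq> topspace (subtopology X (U - S))"
      by (simp_all only: connected_components_of_subset)
    then have "C \<inter> S = {}" "D \<inter> S = {}" by auto
    moreover have "\<Phi> (x, t) \<in> C \<or> \<Phi> (x, t) \<in> D"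
    proof (cases "t < 0")
      case True
      then have "(x, t) \<in> {x} \<times> {dm x..<0}" using t by simp
      then show ?thesis using CD(1) by blast
    next
      case False
      then have "(x, t) \<in> {x} \<times> {0<..dp x}" using t by simp
      then show ?thesis using CD(2) by blast
    qed
    ultimately show ?thesis by blast
  qed
  show ?thesis
  proof
    fix x assume x: "x \<in> S"
    obtain V \<delta> where V: "openin X V" "x \<in> V" "\<delta> > 0" "\<forall>y\<in>V \<inter> S. dp y > \<delta> \<and> dm y < -\<delta>"
      using bspec[OF d x] by (elim conjE exE bexE) (rule that)
    show "\<exists>V d. openin X V \<and> x \<in> V \<and> 0 < d \<and>
      (\<forall>y\<in>V \<inter> S. \<forall>t. t \<noteq> 0 \<and> \<bar>t\<bar> < d \<longrightarrow> \<Phi> (y, t) \<notin> S)"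
    proof (intro exI[of _ V] exI[of _ \<delta>] conjI ballI allI impI)
      fix y t assume y: "y \<in> V \<inter> S" and t: "t \<noteq> 0 \<and> \<bar>t\<bar> < \<delta>"
      then show "\<Phi> (y, t) \<notin> S"
        using bspec[OF V(4), of y] by (intro avoid) auto
    qed (use V in auto)
  next
    fix x and e :: real assume x: "x \<in> S" and e: "e > 0"
    then have xX: "x \<in> topspace X" using closedin_subset[OF closed] by auto
    obtain U \<phi> C D where U: "openin X U" "x \<in> U"
      and hom: "homeomorphic_map (subtopology X U)
             (subtopology (Euclidean_space (Suc m)) (unit_ball (Suc m))) \<phi>"
      and CD: "C \<in> connected_components_of (subtopology X (U - S))"
      "D \<in> connected_components_of (subtopology X (U - S))" "C \<noteq> D"
      "\<Phi> ` ({x} \<times> {dm x..<0}) \<subseteq> C" "\<Phi> ` ({x} \<times> {0<..dp x}) \<subseteq> D"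
      using bspec[OF d x] by (elim conjE exE bexE) (rule that)
    have US: "openin X (U - S)" using U closed by (simp add: openin_diff)
    have "openin (Euclidean_space (Suc m)) (unit_ball (Suc m))"
    proof -
      have "continuous_map (Euclidean_space (Suc m)) euclideanreal (\<lambda>x. \<Sum>i<Suc m. (x i)\<^sup>2)"
        unfolding Euclidean_space_def
        by (intro continuous_map_sum continuous_map_real_pow continuous_map_from_subtopology
            continuous_map_product_coordinates) auto
      from openin_continuous_map_preimage[OF this, of "{..<1}"] show ?thesis
        by (simp add: unit_ball_def)
    qed
    then have "locally_connected_space (subtopology X U)"
      using homeomorphic_locally_connected_space[OF homeomorphic_map_imp_homeomorphic_space[OF hom]]
        locally_connected_space_open_subset[OF locally_connected_Euclidean_space] by blast
    then have "locally_connected_space (subtopology (subtopology X U) (U - S))"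
      by (rule locally_connected_space_open_subset) (simp add: openin_open_subtopology U US)
    then have lc: "locally_connected_space (subtopology X (U - S))"
      by (simp add: subtopology_subtopology Int_absorb1 Diff_subset)
    have openC: "openin X C" "openin X D"
      using openin_connected_components_of_locally_connected_space[OF lc] CD(1,2) openin_trans_full[OF _ US]
      by blast+
    define O' where "O' = {p \<in> topspace (prod_topology X euclideanreal). \<Phi> p \<in> U}"
    have O': "openin (prod_topology X euclideanreal) O'"
      unfolding O'_def by (rule openin_continuous_map_preimage[OF cont U(1)])
    have "(x, 0) \<in> O'" using U flow_0[OF xX] xX by (simp add: O'_def)
    then obtain A I where AI: "openin X A" "open I" "x \<in> A" "0 \<in> I" "A \<times> I \<subseteq> O'"
      using O' unfolding openin_prod_topology_alt by (metis open_openin)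
    obtain r where r: "r > 0" "\<And>t. \<bar>t\<bar> < r \<Longrightarrow> t \<in> I"
      using AI(2,4) by (force simp: open_dist dist_real_def)
    \<comment> \<open>half the length of the piece of orbit that is followed\<close>
    define \<eta> where "\<eta> = min (min (e/2) (r/2)) (min (dp x) (- dm x))"
    have "dp x > 0" "dm x < 0" using bspec[OF d x] by simp_all
    then have \<eta>: "\<eta> > 0" "\<eta> < e" "\<eta> < r" "\<eta> \<le> dp x" "dm x \<le> - \<eta>"
      using e r(1) by (auto simp: \<eta>_def)
    have sp: "continuous_map X X (\<lambda>x. \<Phi> (x, t))" for t
      using continuous_map_compose[OF _ cont, of X "\<lambda>x. (x, t)"]
      by (simp add: o_def continuous_map_pairwise)
    define W where "W = A \<inter> {y \<in> topspace X. \<Phi> (y, - \<eta>) \<in> C} \<inter> {y \<in> topspace X. \<Phi> (y, \<eta>) \<in> D}"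
    have "openin X W"
      unfolding W_def using AI openC by (intro openin_Int openin_continuous_map_preimage[OF sp])
    moreover have "x \<in> W" using AI CD \<eta> xX by (auto simp: W_def image_subset_iff)
    moreover have "\<exists>t. \<bar>t\<bar> < e \<and> \<Phi> (y, t) \<in> S" if y: "y \<in> W" for y
    proof (rule ccontr)
      assume none: "\<nexists>t. \<bar>t\<bar> < e \<and> \<Phi> (y, t) \<in> S"
      have yX: "y \<in> topspace X" using y by (simp add: W_def)
      let ?J = "(\<lambda>t. \<Phi> (y, t)) ` {- \<eta>..\<eta>}"
      have "continuous_map euclideanreal X (\<lambda>t. \<Phi> (y, t))"
        using continuous_map_compose[OF _ cont, of euclideanreal "\<lambda>t. (y, t)"] yX
        by (simp add: o_def continuous_map_pairwise)
      then have "connectedin X ?J"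
        by (rule connectedin_continuous_map_image) (simp add: connectedin_iff_connected)
      moreover have "?J \<subseteq> U - S"
      proof -
        have "\<Phi> (y, t) \<in> U" if "\<bar>t\<bar> \<le> \<eta>" for t
          using AI(5) y r(2)[of t] that \<eta>(3) by (force simp: W_def O'_def)
        then show ?thesis using none \<eta>(2) by (auto simp: abs_le_iff)
      qed
      ultimately have J: "connectedin (subtopology X (U - S)) ?J"
        by (simp add: connectedin_subtopology)
      have "C = D"
      proof -
        have J\<eta>: "\<Phi> (y, - \<eta>) \<in> ?J" "\<Phi> (y, \<eta>) \<in> ?J" using \<eta>(1) by auto
        have yC: "\<Phi> (y, - \<eta>) \<in> C" and yD: "\<Phi> (y, \<eta>) \<in> D" using y by (simp_all add: W_def)
        have "?J \<subseteq> C"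
          using J\<eta>(1) yC by (intro connected_components_of_maximal[OF CD(1) J]) (auto simp: disjnt_iff)
        then have "\<Phi> (y, \<eta>) \<in> C \<inter> D" using J\<eta>(2) yD by blast
        then show ?thesis using connected_components_of_overlap[OF CD(1,2)] by blast
      qed
      then show False using CD by blast
    qed
    ultimately show "\<exists>W. openin X W \<and> x \<in> W \<and> (\<forall>y\<in>W. \<exists>t. \<bar>t\<bar> < e \<and> \<Phi> (y, t) \<in> S)" by blast
  next
    fix x assume "x \<in> topspace X"
    then show "\<exists>t>0. \<Phi> (x, t) \<in> S" "\<exists>t<0. \<Phi> (x, t) \<in> S"
      using assms(2) by (auto simp: global_section_def)
  qed (use cont flow_0 flow_add closed in auto)
qed

section \<open>Charts\<close>

lemma continuous_map_into_Euclidean_space: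
  "continuous_map Z (Euclidean_space n) f \<longleftrightarrow>
     (\<forall>i. continuous_map Z euclideanreal (\<lambda>z. f z i)) \<and> (\<forall>z\<in>topspace Z. \<forall>i\<ge>n. f z i = 0)"
  by (auto simp: Euclidean_space_def continuous_map_in_subtopology continuous_map_componentwise_UNIV)

lemma continuous_map_Euclidean_space_coordinate:
  "continuous_map (Euclidean_space n) euclideanreal (\<lambda>y. y i)"
  unfolding Euclidean_space_def
  by (intro continuous_map_from_subtopology continuous_map_product_coordinates) auto

lemma homeomorphic_map_Euclidean_space_Suc:
  "homeomorphic_map (prod_topology (Euclidean_space m) euclideanreal) (Euclidean_space (Suc m))
     (\<lambda>(y, s). y(m := s))"
proof -
  have c: "continuous_map (prod_topology (Euclidean_space m) euclideanreal) euclideanreal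
      (\<lambda>p. (case p of (y, s) \<Rightarrow> y(m := s)) i)" for i
  proof (cases "i = m")
    case True
    then show ?thesis by (simp add: case_prod_unfold continuous_map_snd)
  next
    case False
    then show ?thesis
      using continuous_map_compose[OF continuous_map_fst continuous_map_Euclidean_space_coordinate]
      by (simp add: case_prod_unfold o_def)
  qed
  have d: "continuous_map (Euclidean_space (Suc m)) euclideanreal (\<lambda>z. (z(m := 0)) i)" for i
    by (cases "i = m") (simp_all add: continuous_map_Euclidean_space_coordinate)
  have "homeomorphic_maps (prod_topology (Euclidean_space m) euclideanreal) (Euclidean_space (Suc m))
     (\<lambda>(y, s). y(m := s)) (\<lambda>z. (z(m := 0), z m))"
    unfolding homeomorphic_maps_def
  proof (intro conjI ballI)
    show "continuous_map (prod_topology (Euclidean_space m) euclideanreal) (Euclidean_space (Suc m))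
       (\<lambda>(y, s). y(m := s))"
      unfolding continuous_map_into_Euclidean_space using c
      by (auto simp: topspace_Euclidean_space)
    show "continuous_map (Euclidean_space (Suc m)) (prod_topology (Euclidean_space m) euclideanreal)
       (\<lambda>z. (z(m := 0), z m))"
    proof (intro continuous_map_pairedI continuous_map_Euclidean_space_coordinate)
      show "continuous_map (Euclidean_space (Suc m)) (Euclidean_space m) (\<lambda>z. z(m := 0))"
        unfolding continuous_map_into_Euclidean_space using d
        by (auto simp: topspace_Euclidean_space)
    qed
  qed (auto simp: topspace_Euclidean_space fun_eq_iff)
  then show ?thesis using homeomorphic_map_maps by blast
qed

definition open_ball :: "nat \<Rightarrow> (nat \<Rightarrow> real) \<Rightarrow> real \<Rightarrow> (nat \<Rightarrow> real) set" where
  "open_ball n a e = {z \<in> topspace (Euclidean_space n). (\<Sum>i<n. (z i - a i)\<^sup>2) < e\<^sup>2}"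

text \<open>The homeomorphism of Euclidean space onto a ball that contracts the rays from the origin. It
  preserves the hyperplanes through the origin if the ball is centred there.\<close>

definition ball_map :: "nat \<Rightarrow> (nat \<Rightarrow> real) \<Rightarrow> real \<Rightarrow> (nat \<Rightarrow> real) \<Rightarrow> nat \<Rightarrow> real" where
  "ball_map n a e y = (\<lambda>i. if i < n then a i + e * y i / sqrt (1 + (\<Sum>j<n. (y j)\<^sup>2)) else 0)"

lemma homeomorphic_map_ball_map:
  assumes e: "0 < e"
  shows "homeomorphic_map (Euclidean_space n) (subtopology (Euclidean_space n) (open_ball n a e)) (ball_map n a e)"
proof -
  define inv where "inv z = (\<lambda>i. if i < n then (z i - a i) / sqrt (e\<^sup>2 - (\<Sum>j<n. (z j - a j)\<^sup>2)) else 0)"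
    for z :: "nat \<Rightarrow> real"
  have pos: "1 + (\<Sum>j<n. (y j)\<^sup>2) > 0" for y :: "nat \<Rightarrow> real"
    using sum_nonneg[of "{..<n}" "\<lambda>j. (y j)\<^sup>2"] by (simp add: add_pos_nonneg)
  have sq: "(\<Sum>i<n. (ball_map n a e y i - a i)\<^sup>2) = e\<^sup>2 * (\<Sum>j<n. (y j)\<^sup>2) / (1 + (\<Sum>j<n. (y j)\<^sup>2))" for y
    using pos[of y] by (simp add: ball_map_def power_divide power_mult_distrib sum_distrib_left sum_divide_distrib)
  \<comment> \<open>This is the quantity under the root in the inverse map.\<close>
  have rest: "e\<^sup>2 - (\<Sum>i<n. (ball_map n a e y i - a i)\<^sup>2) = e\<^sup>2 / (1 + (\<Sum>j<n. (y j)\<^sup>2))" for y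
    unfolding sq using pos[of y] by (simp add: field_simps)
  have c: "continuous_map (Euclidean_space n) euclideanreal (\<lambda>y. ball_map n a e y i)" for i
    unfolding ball_map_def using pos
    by (auto intro!: continuous_intros continuous_map_sqrt continuous_map_Euclidean_space_coordinate
        simp: less_imp_neq[symmetric])
  have d: "continuous_map (subtopology (Euclidean_space n) (open_ball n a e)) euclideanreal (\<lambda>z. inv z i)" for i
    unfolding inv_def
    using continuous_map_from_subtopology[OF continuous_map_Euclidean_space_coordinate]
    by (auto intro!: continuous_intros continuous_map_sqrt simp: open_ball_def)
  have "homeomorphic_maps (Euclidean_space n) (subtopology (Euclidean_space n) (open_ball n a e)) (ball_map n a e) inv"
    unfolding homeomorphic_maps_def
  proof (intro conjI ballI)
    have "continuous_map (Euclidean_space n) (Euclidean_space n) (ball_map n a e)"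
      unfolding continuous_map_into_Euclidean_space using c by (simp add: ball_map_def)
    moreover have "ball_map n a e y \<in> open_ball n a e" for y
    proof -
      have "e\<^sup>2 - (\<Sum>i<n. (ball_map n a e y i - a i)\<^sup>2) > 0"
        unfolding rest using pos[of y] e by simp
      then show ?thesis by (simp add: open_ball_def topspace_Euclidean_space) (simp add: ball_map_def)
    qed
    ultimately show "continuous_map (Euclidean_space n) (subtopology (Euclidean_space n) (open_ball n a e)) (ball_map n a e)"
      by (auto simp: continuous_map_in_subtopology)
    show "continuous_map (subtopology (Euclidean_space n) (open_ball n a e)) (Euclidean_space n) inv"
      unfolding continuous_map_into_Euclidean_space using d by (simp add: inv_def)
  next
    fix y assume y: "y \<in> topspace (Euclidean_space n)"
    show "inv (ball_map n a e y) = y"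
    proof
      fix i
      show "inv (ball_map n a e y) i = y i"
        using y pos[of y] e unfolding inv_def rest
        by (auto simp: ball_map_def topspace_Euclidean_space real_sqrt_divide)
    qed
  next
    fix z assume "z \<in> topspace (subtopology (Euclidean_space n) (open_ball n a e))"
    then have z: "\<And>i. i \<ge> n \<Longrightarrow> z i = 0" and lt: "(\<Sum>i<n. (z i - a i)\<^sup>2) < e\<^sup>2"
      by (auto simp: open_ball_def topspace_Euclidean_space)
    define Q where "Q = (\<Sum>i<n. (z i - a i)\<^sup>2)"
    have "(\<Sum>j<n. (inv z j)\<^sup>2) = Q / (e\<^sup>2 - Q)"
      using lt by (simp add: inv_def power_divide sum_divide_distrib Q_def)
    then have "1 + (\<Sum>j<n. (inv z j)\<^sup>2) = e\<^sup>2 / (e\<^sup>2 - Q)"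
      using lt by (simp add: Q_def field_simps)
    then have s: "sqrt (1 + (\<Sum>j<n. (inv z j)\<^sup>2)) = e / sqrt (e\<^sup>2 - Q)"
      using e by (simp add: real_sqrt_divide)
    show "ball_map n a e (inv z) = z"
    proof
      fix i
      show "ball_map n a e (inv z) i = z i"
        using z lt e unfolding ball_map_def s by (auto simp: inv_def Q_def)
    qed
  qed
  then show ?thesis using homeomorphic_map_maps by blast
qed

lemma openin_open_ball: "openin (Euclidean_space n) (open_ball n a e)"
proof -
  have "continuous_map (Euclidean_space n) euclideanreal (\<lambda>z. \<Sum>i<n. (z i - a i)\<^sup>2)"
    by (intro continuous_intros continuous_map_Euclidean_space_coordinate) auto
  from openin_continuous_map_preimage[OF this, of "{..<e\<^sup>2}"] show ?thesis
    by (simp add: open_ball_def)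
qed

lemma open_ball_neighbourhood:
  assumes V: "openin (Euclidean_space n) V" and a: "a \<in> V"
  obtains e where "e > 0" "open_ball n a e \<subseteq> V"
proof -
  obtain W where W: "openin (powertop_real UNIV) W" "V = W \<inter> {x. \<forall>i\<ge>n. x i = 0}"
    using V by (auto simp: Euclidean_space_def openin_subtopology)
  obtain B where B: "a \<in> (\<Pi>\<^sub>E i\<in>UNIV. B i)" "\<And>i. open (B i)" "(\<Pi>\<^sub>E i\<in>UNIV. B i) \<subseteq> W"
    using product_topology_open_contains_basis[OF W(1), of a] a W(2) by auto
  have "\<exists>e>0. \<forall>r. \<bar>r - a i\<bar> < e \<longrightarrow> r \<in> B i" for i
    using B(1) B(2)[of i] by (auto simp: open_dist dist_real_def PiE_iff)
  then obtain d where d: "\<And>i. d i > 0" "\<And>i r. \<bar>r - a i\<bar> < d i \<Longrightarrow> r \<in> B i" by metis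
  define e where "e = Min (insert 1 (d ` {..<n}))"
  have e: "e > 0" "\<And>i. i < n \<Longrightarrow> e \<le> d i" using d(1) by (auto simp: e_def)
  have "open_ball n a e \<subseteq> V"
  proof
    fix z assume z: "z \<in> open_ball n a e"
    then have z0: "z i = 0" if "i \<ge> n" for i using that by (simp add: open_ball_def topspace_Euclidean_space)
    have "z i \<in> B i" for i
    proof (cases "i < n")
      case True
      then have "(z i - a i)\<^sup>2 \<le> (\<Sum>i<n. (z i - a i)\<^sup>2)" by (intro member_le_sum) auto
      then have "(z i - a i)\<^sup>2 < e\<^sup>2" using z by (simp add: open_ball_def)
      then have "\<bar>z i - a i\<bar> < e" using e(1) power2_less_imp_less[of "\<bar>z i - a i\<bar>" e] by simp
      then show ?thesis using d(2) e(2)[OF True] by force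
    next
      case False
      then have "z i = a i" using z0[of i] a W(2) by simp
      then show ?thesis using B(1) by (simp add: PiE_iff)
    qed
    then show "z \<in> V" using B(3) W(2) z0 by (auto simp: PiE_iff)
  qed
  then show thesis using that e(1) by blast
qed

lemma homeomorphic_map_unit_ball:
  "homeomorphic_map (Euclidean_space n) (subtopology (Euclidean_space n) (unit_ball n)) (ball_map n (\<lambda>_. 0) 1)"
  using homeomorphic_map_ball_map[of 1 n "\<lambda>_. 0"] by (simp add: open_ball_def unit_ball_def)

text \<open>Around each point there is a chart onto the whole Euclidean space: shrink to a ball and blow
  the ball up.\<close>

lemma manifold_chart:
  assumes "manifold n X" "x \<in> topspace X"
  obtains U \<phi> where "openin X U" "x \<in> U" "homeomorphic_map (subtopology X U) (Euclidean_space n) \<phi>"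
proof -
  obtain U V f where U: "openin X U" "x \<in> U" and V: "openin (Euclidean_space n) V"
    and f: "homeomorphic_map (subtopology X U) (subtopology (Euclidean_space n) V) f"
    using assms unfolding manifold_def homeomorphic_space by blast
  have tU: "topspace (subtopology X U) = U" "topspace (subtopology (Euclidean_space n) V) = V"
    using openin_subset[OF U(1)] openin_subset[OF V] by auto
  have fim: "f ` U = V"
    using homeomorphic_imp_surjective_map[OF f] unfolding tU .
  then obtain e where e: "e > 0" "open_ball n (f x) e \<subseteq> V"
    using open_ball_neighbourhood[OF V, of "f x"] U(2) by auto
  define U' where "U' = {y \<in> U. f y \<in> open_ball n (f x) e}"
  have "openin (subtopology X U) {y \<in> topspace (subtopology X U). f y \<in> open_ball n (f x) e}"
    by (rule openin_continuous_map_preimage[OF homeomorphic_imp_continuous_map[OF f]])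
      (simp add: openin_open_subtopology V e openin_open_ball)
  then have U': "openin X U'"
    using U(1) unfolding tU U'_def by (simp add: openin_open_subtopology)
  have "homeomorphic_map (subtopology (subtopology X U) U')
      (subtopology (subtopology (Euclidean_space n) V) (open_ball n (f x) e)) f"
    by (rule homeomorphic_map_subtopologies[OF f]) (unfold tU, use fim in \<open>auto simp: U'_def\<close>)
  moreover have "U \<inter> U' = U'" "V \<inter> open_ball n (f x) e = open_ball n (f x) e"
    using e(2) by (auto simp: U'_def)
  ultimately have "homeomorphic_map (subtopology X U') (subtopology (Euclidean_space n) (open_ball n (f x) e)) f"
    by (simp add: subtopology_subtopology)
  then have "subtopology X U' homeomorphic_space subtopology (Euclidean_space n) (open_ball n (f x) e)"
    by (rule homeomorphic_map_imp_homeomorphic_space)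
  also have "subtopology (Euclidean_space n) (open_ball n (f x) e) homeomorphic_space Euclidean_space n"
    by (rule homeomorphic_space_sym[THEN iffD1,
          OF homeomorphic_map_imp_homeomorphic_space[OF homeomorphic_map_ball_map[OF e(1)]]])
  finally obtain \<phi> where "homeomorphic_map (subtopology X U') (Euclidean_space n) \<phi>"
    unfolding homeomorphic_space ..
  moreover have "x \<in> U'" using U(2) e(1) openin_subset[OF V] fim by (auto simp: U'_def open_ball_def)
  ultimately show thesis using that U' by blast
qed

lemma homeomorphic_map_tan:
  "homeomorphic_map (top_of_set {-1/2<..<1/2}) euclideanreal (\<lambda>s. tan (pi * s))"
proof -
  have c: "cos (pi * s) \<noteq> 0" if "\<bar>s\<bar> < 1/2" for s :: real
  proof -
    have "\<bar>pi * s\<bar> < pi / 2" using that mult_strict_left_mono[OF that, of pi] by (simp add: abs_mult)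
    then have "- (pi / 2) < pi * s" "pi * s < pi / 2" by linarith+
    then show ?thesis using cos_gt_zero_pi[of "pi * s"] by linarith
  qed
  have "homeomorphic_maps (top_of_set {-1/2<..<1/2}) euclideanreal (\<lambda>s. tan (pi * s)) (\<lambda>t. arctan t / pi)"
    unfolding homeomorphic_maps_def
  proof (intro conjI ballI)
    show "continuous_map (top_of_set {-1/2<..<1/2}) euclideanreal (\<lambda>s. tan (pi * s))"
      using c by (auto intro!: continuous_intros simp: abs_less_iff)
    have "continuous_on UNIV (\<lambda>t. arctan t / pi)" by (auto intro!: continuous_intros)
    moreover have "arctan t / pi \<in> {-1/2<..<1/2}" for t
      using arctan_bounded[of t] by (simp add: field_simps)
    ultimately show "continuous_map euclideanreal (top_of_set {-1/2<..<1/2}) (\<lambda>t. arctan t / pi)"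
      by (auto simp: continuous_map_in_subtopology)
  next
    fix s :: real assume "s \<in> topspace (top_of_set {-1/2<..<1/2})"
    then have "- 1 / 2 < s" "s < 1 / 2" by auto
    then have "arctan (tan (pi * s)) = pi * s"
      using mult_strict_left_mono[of "-1/2" s pi] mult_strict_left_mono[of s "1/2" pi]
      by (intro arctan_tan) auto
    then show "arctan (tan (pi * s)) / pi = s" by simp
  qed (simp add: tan_arctan)
  then show ?thesis using homeomorphic_map_maps by blast
qed

lemma second_countable_prod_real:
  assumes "second_countable X" shows "second_countable (prod_topology X euclideanreal)"
proof -
  obtain A where A: "countable A" "\<forall>V\<in>A. openin X V"
    "\<forall>U x. openin X U \<and> x \<in> U \<longrightarrow> (\<exists>V\<in>A. x \<in> V \<and> V \<subseteq> U)"
    using assms unfolding second_countable_def by (elim exE conjE) (rule that)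
  obtain B :: "real set set" where B: "countable B" "topological_basis B"
    using ex_countable_basis by (elim exE conjE) (rule that)
  show ?thesis
    unfolding second_countable_def
  proof (intro exI[of _ "(\<lambda>(U, V). U \<times> V) ` (A \<times> B)"] conjI allI impI ballI)
    show "countable ((\<lambda>(U, V). U \<times> V) ` (A \<times> B))"
      using A(1) B(1) by (intro countable_image countable_SIGMA)
    fix W assume "W \<in> (\<lambda>(U, V). U \<times> V) ` (A \<times> B)"
    then obtain U V where "W = U \<times> V" "U \<in> A" "V \<in> B" by (auto elim!: imageE)
    then show "openin (prod_topology X euclideanreal) W"
      using A(2) topological_basis_open[OF B(2), of V] by (simp add: openin_prod_Times_iff)
  next
    fix W p assume W: "openin (prod_topology X euclideanreal) W \<and> p \<in> W"
    obtain x s where p: "p = (x, s)" by (cases p)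
    have "\<exists>U V. openin X U \<and> open V \<and> x \<in> U \<and> s \<in> V \<and> U \<times> V \<subseteq> W"
      using W unfolding openin_prod_topology_alt p by simp
    then obtain U V where UV: "openin X U" "open V" "x \<in> U" "s \<in> V" "U \<times> V \<subseteq> W"
      by (elim exE conjE) (rule that)
    obtain U' where U': "U' \<in> A" "x \<in> U'" "U' \<subseteq> U" using A(3) UV(1,3) by meson
    obtain V' where V': "V' \<in> B" "s \<in> V'" "V' \<subseteq> V" using topological_basisE[OF B(2) UV(2,4)] by blast
    have "p \<in> U' \<times> V'" "U' \<times> V' \<subseteq> W" using U' V' UV(5) by (auto simp: p)
    then show "\<exists>V\<in>(\<lambda>(U, V). U \<times> V) ` (A \<times> B). p \<in> V \<and> V \<subseteq> W" using U'(1) V'(1) by (intro bexI[of _ "U' \<times> V'"]) auto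
  qed
qed

text \<open>A chart of \<open>X\<close> onto \<open>\<real>\<^sup>m\<close> extends to one of \<open>X \<times> (-1/2, 1/2)\<close> onto \<open>\<real>\<^sup>m\<^sup>+\<^sup>1\<close>; the tangent
  stretches the time interval to \<open>\<real>\<close> and fixes 0, so that \<open>X \<times> {0}\<close> becomes the hyperplane.\<close>

definition flow_box_chart :: "nat \<Rightarrow> ('a \<Rightarrow> nat \<Rightarrow> real) \<Rightarrow> 'a \<times> real \<Rightarrow> nat \<Rightarrow> real" where
  "flow_box_chart m \<phi> = (\<lambda>(x, s). (\<phi> x)(m := tan (pi * s)))"

lemma homeomorphic_map_flow_box_chart:
  assumes "homeomorphic_map (subtopology X U) (Euclidean_space m) \<phi>"
  shows "homeomorphic_map (subtopology (prod_topology X euclideanreal) (U \<times> {-1/2<..<1/2}))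
    (Euclidean_space (Suc m)) (flow_box_chart m \<phi>)"
proof -
  obtain \<psi> g where "homeomorphic_maps (subtopology X U) (Euclidean_space m) \<phi> \<psi>"
    "homeomorphic_maps (top_of_set {-1/2<..<1/2}) euclideanreal (\<lambda>s. tan (pi * s)) g"
    using assms homeomorphic_map_tan unfolding homeomorphic_map_maps by blast
  then have "homeomorphic_maps (subtopology (prod_topology X euclideanreal) (U \<times> {-1/2<..<1/2}))
      (prod_topology (Euclidean_space m) euclideanreal)
      (\<lambda>(x, s). (\<phi> x, tan (pi * s))) (\<lambda>(y, t). (\<psi> y, g t))"
    unfolding subtopology_Times by (intro homeomorphic_maps_prod[THEN iffD2] disjI2 conjI)
  then have "homeomorphic_map (subtopology (prod_topology X euclideanreal) (U \<times> {-1/2<..<1/2}))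
      (prod_topology (Euclidean_space m) euclideanreal) (\<lambda>(x, s). (\<phi> x, tan (pi * s)))"
    using homeomorphic_map_maps by blast
  from homeomorphic_map_compose[OF this homeomorphic_map_Euclidean_space_Suc]
  show ?thesis by (simp add: flow_box_chart_def o_def case_prod_unfold)
qed

lemma manifold_homeomorphic_space:
  assumes X: "manifold n X" and h: "homeomorphic_map X Y h"
  shows "manifold n Y"
  unfolding manifold_def
proof (intro conjI ballI)
  have hs: "X homeomorphic_space Y" using h by (rule homeomorphic_map_imp_homeomorphic_space)
  show "Hausdorff_space Y" "second_countable Y"
    using X homeomorphic_Hausdorff_space[OF hs] homeomorphic_space_second_countability[OF hs]
    by (simp_all add: manifold_def)
  fix y assume "y \<in> topspace Y"
  then obtain x where x: "x \<in> topspace X" "y = h x"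
    using homeomorphic_imp_surjective_map[OF h] by blast
  obtain U \<phi> where U: "openin X U" "x \<in> U" "homeomorphic_map (subtopology X U) (Euclidean_space n) \<phi>"
    using manifold_chart[OF X x(1)] .
  have UX: "U \<subseteq> topspace X" using openin_subset[OF U(1)] .
  have "homeomorphic_map (subtopology X U) (subtopology Y (h ` U)) h"
    using UX homeomorphic_imp_surjective_map[OF h]
    by (intro homeomorphic_map_subtopologies[OF h]) (auto simp: Int_absorb1)
  then have "subtopology Y (h ` U) homeomorphic_space subtopology X U"
    using homeomorphic_map_imp_homeomorphic_space homeomorphic_space_sym by blast
  also have "subtopology X U homeomorphic_space Euclidean_space n"
    using U(3) by (rule homeomorphic_map_imp_homeomorphic_space)
  finally (homeomorphic_space_trans)
  have "subtopology Y (h ` U) homeomorphic_space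
      subtopology (Euclidean_space n) (topspace (Euclidean_space n))" by simp
  moreover have "openin Y (h ` U)" "y \<in> h ` U"
    using homeomorphic_map_openness[OF h UX] U x by auto
  ultimately show "\<exists>U V. openin Y U \<and> y \<in> U \<and> openin (Euclidean_space n) V \<and>
      subtopology Y U homeomorphic_space subtopology (Euclidean_space n) V"
    using openin_topspace by blast
qed

text \<open>In both spaces the hyperplane is where the last coordinate vanishes, and the radial
  contraction does not change the sign of a coordinate.\<close>

lemma ball_map_hyperplane:
  "ball_map (Suc m) (\<lambda>_. 0) 1 ` topspace (Euclidean_space m) =
     unit_ball (Suc m) \<inter> topspace (Euclidean_space m)"
proof -
  let ?b = "ball_map (Suc m) (\<lambda>_. 0) 1"
  have pos: "0 < 1 + (\<Sum>j<Suc m. (y j)\<^sup>2)" for y :: "nat \<Rightarrow> real"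
    by (intro add_pos_nonneg sum_nonneg) auto
  have surj: "?b ` topspace (Euclidean_space (Suc m)) = unit_ball (Suc m)"
    using homeomorphic_imp_surjective_map[OF homeomorphic_map_unit_ball[of "Suc m"]]
    by (auto simp: unit_ball_def)
  have *: "y \<in> topspace (Euclidean_space m) \<longleftrightarrow> y \<in> topspace (Euclidean_space (Suc m)) \<and> y m = 0"
    for y :: "nat \<Rightarrow> real"
    unfolding topspace_Euclidean_space by (auto simp: Suc_le_eq) (metis le_neq_implies_less)
  have m: "?b y m = 0 \<longleftrightarrow> y m = 0" for y
    using pos[of y] by (simp add: ball_map_def)
  have "unit_ball (Suc m) \<subseteq> topspace (Euclidean_space (Suc m))" by (auto simp: unit_ball_def)
  then show ?thesis using surj m * by (auto 4 4)
qed

section \<open>The mapping torus as a quotient of \<open>X \<times> \<real>\<close>\<close>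

locale suspension =
  fixes code :: "'u \<times> real \<Rightarrow> 'u" and f :: "'u \<Rightarrow> 'u" and X :: "'u topology"
  assumes inj_code: "inj code" and homeo: "homeomorphic_map X X f"
begin

abbreviation q where "q \<equiv> torus_pt code f X"
abbreviation M where "M \<equiv> torus code f X"
abbreviation iter where "iter \<equiv> int_iter (topspace X) f"
abbreviation cyl where "cyl \<equiv> topspace X \<times> {0..1::real}"

lemma bij: "bij_betw f (topspace X) (topspace X)"
  using homeo by (rule homeomorphic_map_imp_bij_betw)

lemma f_in: "x \<in> topspace X \<Longrightarrow> f x \<in> topspace X"
  using bij by (rule bij_betwE[rule_format])

lemmas iter_in = int_iter_closed[OF bij]
lemmas iter_succ = int_iter_succ[OF bij]
lemmas iter_add = int_iter_add[OF bij]

text \<open>The point of the fundamental domain \<open>X \<times> [0, 1)\<close> that is equivalent to the given one.\<close>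

definition rep :: "'u \<times> real \<Rightarrow> 'u \<times> real" where
  "rep = (\<lambda>(x, t). if t = 1 then (f x, 0) else (x, t))"

text \<open>The kernel of \<open>rep\<close> is an equivalence relation that makes the required identifications. It is
  the smallest one because each point is equivalent to its image under \<open>rep\<close> in every such relation.\<close>

lemma torus_rel_eq: "torus_rel f X = {(p, p'). p \<in> cyl \<and> p' \<in> cyl \<and> rep p = rep p'}" (is "_ = ?r")
proof
  have "equiv cyl ?r"
    by (rule equivI) (auto simp: refl_on_def sym_def trans_def)
  moreover have "((x, 1), (f x, 0)) \<in> ?r" if "x \<in> topspace X" for x
    using that by (simp add: rep_def f_in)
  ultimately show "torus_rel f X \<subseteq> ?r" unfolding torus_rel_def by (intro Inter_lower) blast
  show "?r \<subseteq> torus_rel f X"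
    unfolding torus_rel_def
  proof (rule Inter_greatest)
    fix r :: "(('u \<times> real) \<times> ('u \<times> real)) set"
    assume "r \<in> {r. equiv cyl r \<and> (\<forall>x\<in>topspace X. ((x, 1), (f x, 0)) \<in> r)}"
    then have eq: "equiv cyl r" and r: "\<And>x. x \<in> topspace X \<Longrightarrow> ((x, 1), (f x, 0)) \<in> r" by auto
    have "(p, rep p) \<in> r" if "p \<in> cyl" for p
      using that r equiv_class_self[OF eq that] by (cases p) (auto simp: rep_def)
    moreover have "sym r" "trans r" using eq by (auto elim: equivE)
    ultimately have "(p, p') \<in> r" if "p \<in> cyl" "p' \<in> cyl" "rep p = rep p'" for p p'
      using that by (metis (no_types, lifting) symD transD)
    then show "?r \<subseteq> r" by blast
  qed
qed

text \<open>The name of a class depends only on the class, and \<open>code\<close> does not confuse different classes.\<close>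

lemma q_eq_iff:
  assumes "p \<in> cyl" "p' \<in> cyl"
  shows "q p = q p' \<longleftrightarrow> rep p = rep p'"
proof
  define z where "z p = (SOME z. z \<in> torus_rel f X `` {p})" for p
  have z: "rep (z p) = rep p" if "p \<in> cyl" for p
  proof -
    have "z p \<in> torus_rel f X `` {p}"
      unfolding z_def using that by (intro someI[of "\<lambda>z. z \<in> torus_rel f X `` {p}" p]) (simp add: torus_rel_eq)
    then show ?thesis by (simp add: torus_rel_eq)
  qed
  assume "q p = q p'"
  then have "z p = z p'"
    using inj_code by (simp add: torus_pt_def z_def inj_eq)
  then show "rep p = rep p'" using z assms by metis
next
  assume "rep p = rep p'"
  then have "torus_rel f X `` {p} = torus_rel f X `` {p'}"
    using assms by (auto simp: torus_rel_eq)
  then show "q p = q p'" by (simp add: torus_pt_def)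
qed

lemma q_inj:
  assumes "x \<in> topspace X" "y \<in> topspace X" "0 \<le> t" "t < 1" "0 \<le> s" "s < 1"
  shows "q (x, t) = q (y, s) \<longleftrightarrow> x = y \<and> t = s"
  using assms by (subst q_eq_iff) (auto simp: rep_def)

lemma q_glue: "x \<in> topspace X \<Longrightarrow> q (x, 1) = q (f x, 0)"
  by (subst q_eq_iff) (auto simp: rep_def f_in)

text \<open>The covering of the mapping torus by \<open>X \<times> \<real>\<close>, whose deck transformations are the powers of
  \<open>(x, s) \<mapsto> (f x, s - 1)\<close>.\<close>

definition cov :: "'u \<times> real \<Rightarrow> 'u" where
  "cov = (\<lambda>(x, s). q (iter \<lfloor>s\<rfloor> x, s - of_int \<lfloor>s\<rfloor>))"

lemma floor_frac: "0 \<le> s - of_int \<lfloor>s\<rfloor>" "s - of_int \<lfloor>s\<rfloor> < 1" for s :: real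
  by linarith+

lemma cov_cell:
  assumes x: "x \<in> topspace X" and s: "of_int n \<le> s" "s \<le> of_int n + 1"
  shows "cov (x, s) = q (iter n x, s - of_int n)"
proof (cases "s = of_int n + 1")
  case True
  then have "\<lfloor>s\<rfloor> = n + 1" by simp
  then show ?thesis using True iter_in[OF x] by (simp add: cov_def iter_succ[OF x] q_glue)
next
  case False
  then have "\<lfloor>s\<rfloor> = n" using s by (intro floor_unique) auto
  then show ?thesis by (simp add: cov_def)
qed

lemma cov_unit: "x \<in> topspace X \<Longrightarrow> 0 \<le> t \<Longrightarrow> t \<le> 1 \<Longrightarrow> cov (x, t) = q (x, t)"
  using cov_cell[of x 0 t] by simp

lemma cov_iter:
  assumes x: "x \<in> topspace X"
  shows "cov (iter n x, s) = cov (x, s + of_int n)"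
proof -
  have "\<lfloor>s + of_int n\<rfloor> = \<lfloor>s\<rfloor> + n" by simp
  then show ?thesis by (simp add: cov_def iter_add[OF x])
qed

lemma cov_eq_iff:
  assumes x: "x \<in> topspace X" and y: "y \<in> topspace X"
  shows "cov (x, s) = cov (y, r) \<longleftrightarrow> (\<exists>n::int. y = iter n x \<and> r = s - of_int n)"
proof
  assume "cov (x, s) = cov (y, r)"
  then have eq: "iter \<lfloor>s\<rfloor> x = iter \<lfloor>r\<rfloor> y" "s - of_int \<lfloor>s\<rfloor> = r - of_int \<lfloor>r\<rfloor>"
    using q_inj[OF iter_in[OF x] iter_in[OF y] floor_frac floor_frac] by (simp_all add: cov_def)
  have "y = iter (- \<lfloor>r\<rfloor>) (iter \<lfloor>r\<rfloor> y)" using iter_add[OF y, of "- \<lfloor>r\<rfloor>" "\<lfloor>r\<rfloor>"] by simp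
  also have "\<dots> = iter (\<lfloor>s\<rfloor> - \<lfloor>r\<rfloor>) x" using iter_add[OF x, of "- \<lfloor>r\<rfloor>" "\<lfloor>s\<rfloor>"] eq(1) by simp
  finally show "\<exists>n::int. y = iter n x \<and> r = s - of_int n"
    using eq(2) by (intro exI[of _ "\<lfloor>s\<rfloor> - \<lfloor>r\<rfloor>"]) auto
next
  assume "\<exists>n::int. y = iter n x \<and> r = s - of_int n"
  then show "cov (x, s) = cov (y, r)" using cov_iter[OF x] by auto
qed

lemma quotient_q: "quotient_map (prod_topology X (top_of_set {0..1})) M q"
  unfolding torus_def by (rule quotient_map_quotient_topology)

lemma topspace_M: "topspace M = q ` cyl"
  using quotient_imp_surjective_map[OF quotient_q] by simp

lemma q_in: "x \<in> topspace X \<Longrightarrow> 0 \<le> t \<Longrightarrow> t \<le> 1 \<Longrightarrow> q (x, t) \<in> topspace M"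
  by (simp add: topspace_M)

lemma cov_in: "x \<in> topspace X \<Longrightarrow> cov (x, s) \<in> topspace M"
  using q_in[OF iter_in floor_frac(1) less_imp_le[OF floor_frac(2)]] by (simp add: cov_def)

lemma torus_cases:
  assumes "p \<in> topspace M"
  obtains x t where "x \<in> topspace X" "0 \<le> t" "t < 1" "p = q (x, t)" "p = cov (x, t)"
proof -
  obtain x t where xt: "x \<in> topspace X" "0 \<le> t" "t \<le> 1" "p = q (x, t)"
    using assms by (auto simp: topspace_M)
  show thesis
  proof (cases "t = 1")
    case True
    then show ?thesis using that[of "f x" 0] xt q_glue f_in cov_unit[of "f x" 0] by simp
  next
    case False
    then show ?thesis using that[of x t] xt cov_unit[of x t] by simp
  qed
qed

text \<open>The closed sets \<open>X \<times> [n, n + 1]\<close> form a locally finite cover, and on each of them \<open>cov\<close> is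
  the quotient map after a homeomorphism onto \<open>X \<times> [0, 1]\<close>.\<close>

lemma continuous_map_cov: "continuous_map (prod_topology X euclideanreal) M cov"
proof (rule pasting_lemma_locally_finite[where I = UNIV and T = "\<lambda>n. topspace X \<times> {of_int n..of_int n + 1}"
      and f = "\<lambda>n (x, s). q (iter n x, s - of_int n)"])
  fix p assume p: "p \<in> topspace (prod_topology X euclideanreal)"
  show "\<exists>V. openin (prod_topology X euclideanreal) V \<and> p \<in> V \<and>
      finite {n \<in> UNIV. topspace X \<times> {real_of_int n..real_of_int n + 1} \<inter> V \<noteq> {}}"
  proof (intro exI[of _ "topspace X \<times> {snd p - 1<..<snd p + 1}"] conjI)
    have "{n \<in> UNIV. topspace X \<times> {real_of_int n..real_of_int n + 1} \<inter> topspace X \<times> {snd p - 1<..<snd p + 1} \<noteq> {}}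
        \<subseteq> {\<lfloor>snd p\<rfloor> - 2..\<lfloor>snd p\<rfloor> + 2}"
    proof
      fix n assume "n \<in> {n \<in> UNIV. topspace X \<times> {real_of_int n..real_of_int n + 1} \<inter> topspace X \<times> {snd p - 1<..<snd p + 1} \<noteq> {}}"
      then have "\<exists>s. real_of_int n \<le> s \<and> s \<le> real_of_int n + 1 \<and> snd p - 1 < s \<and> s < snd p + 1" by auto
      then have "real_of_int n < snd p + 1" "snd p - 2 < real_of_int n" by auto
      then have "n \<le> \<lfloor>snd p\<rfloor> + 2" "\<lfloor>snd p\<rfloor> - 2 \<le> n" by linarith+
      then show "n \<in> {\<lfloor>snd p\<rfloor> - 2..\<lfloor>snd p\<rfloor> + 2}" by simp
    qed
    then show "finite {n \<in> UNIV. topspace X \<times> {real_of_int n..real_of_int n + 1} \<inter>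
        topspace X \<times> {snd p - 1<..<snd p + 1} \<noteq> {}}"
      by (rule finite_subset) simp
  qed (use p in \<open>auto simp: openin_prod_Times_iff\<close>)
next
  fix n :: int
  show "closedin (prod_topology X euclideanreal) (topspace X \<times> {real_of_int n..real_of_int n + 1})"
    by (simp add: closedin_prod_Times_iff)
  have "continuous_map (prod_topology X (top_of_set {real_of_int n..real_of_int n + 1}))
      (prod_topology X (top_of_set {0..1})) (\<lambda>p. (iter n (fst p), snd p - of_int n))"
  proof (intro continuous_map_pairedI)
    show "continuous_map (prod_topology X (top_of_set {real_of_int n..real_of_int n + 1})) X (\<lambda>p. iter n (fst p))"
      using continuous_map_compose[OF continuous_map_fst continuous_map_int_iter[OF homeo]]
      by (simp add: o_def)
    have "continuous_map (top_of_set {real_of_int n..real_of_int n + 1}) (top_of_set {0..1}) (\<lambda>s. s - of_int n)"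
      by (auto simp: continuous_map_in_subtopology intro!: continuous_intros)
    from continuous_map_compose[OF continuous_map_snd this]
    show "continuous_map (prod_topology X (top_of_set {real_of_int n..real_of_int n + 1}))
        (top_of_set {0..1}) (\<lambda>p. snd p - of_int n)" by (simp add: o_def)
  qed
  from continuous_map_compose[OF this quotient_imp_continuous_map[OF quotient_q]]
  show "continuous_map (subtopology (prod_topology X euclideanreal)
      (topspace X \<times> {real_of_int n..real_of_int n + 1})) M (\<lambda>(x, s). q (iter n x, s - of_int n))"
    by (simp add: o_def case_prod_unfold prod_topology_subtopology)
next
  fix m n :: int and p
  assume p: "p \<in> topspace (prod_topology X euclideanreal) \<inter> topspace X \<times> {real_of_int m..real_of_int m + 1}
    \<inter> topspace X \<times> {real_of_int n..real_of_int n + 1}"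
  obtain x s where "p = (x, s)" by (cases p)
  then show "(case p of (x, s) \<Rightarrow> q (iter m x, s - of_int m)) = (case p of (x, s) \<Rightarrow> q (iter n x, s - of_int n))"
    using p cov_cell[of x m s] cov_cell[of x n s] by simp
next
  fix p assume p: "p \<in> topspace (prod_topology X euclideanreal)"
  then show "\<exists>n. n \<in> UNIV \<and> p \<in> topspace X \<times> {real_of_int n..real_of_int n + 1} \<and>
      cov p = (case p of (x, s) \<Rightarrow> q (iter n x, s - of_int n))"
    by (intro exI[of _ "\<lfloor>snd p\<rfloor>"]) (auto simp: cov_def floor_frac less_imp_le)
qed

text \<open>The preimage of \<open>cov ` W\<close> in \<open>X \<times> \<real>\<close> is the union of the translates of \<open>W\<close> by deck
  transformations, which is open; the part over \<open>X \<times> [0, 1]\<close> is what the quotient topology asks for.\<close>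

lemma open_map_cov: "open_map (prod_topology X euclideanreal) M cov"
  unfolding open_map_def
proof (intro allI impI)
  fix W assume W: "openin (prod_topology X euclideanreal) W"
  have WX: "\<And>x s. (x, s) \<in> W \<Longrightarrow> x \<in> topspace X" using openin_subset[OF W] by auto
  define W' where "W' n = {p \<in> topspace (prod_topology X euclideanreal). (iter n (fst p), snd p - of_int n) \<in> W}" for n
  have "openin (prod_topology X euclideanreal) (W' n)" for n
  proof -
    have "continuous_map (prod_topology X euclideanreal) X (\<lambda>p. iter n (fst p))"
      using continuous_map_compose[OF continuous_map_fst continuous_map_int_iter[OF homeo]]
      by (simp add: o_def)
    then have "continuous_map (prod_topology X euclideanreal) (prod_topology X euclideanreal)
        (\<lambda>p. (iter n (fst p), snd p - of_int n))"
      by (intro continuous_map_pairedI continuous_map_diff continuous_map_snd) auto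
    then show ?thesis unfolding W'_def using W by (rule openin_continuous_map_preimage)
  qed
  then have UW: "openin (prod_topology X euclideanreal) (\<Union>n. W' n)" by blast
  have *: "q (x, t) \<in> cov ` W \<longleftrightarrow> (x, t) \<in> (\<Union>n. W' n)" if "x \<in> topspace X" "0 \<le> t" "t \<le> 1" for x t
  proof -
    have "q (x, t) \<in> cov ` W \<longleftrightarrow> (\<exists>(y, r)\<in>W. cov (x, t) = cov (y, r))"
      using cov_unit[OF that] by force
    also have "\<dots> \<longleftrightarrow> (\<exists>(y, r)\<in>W. \<exists>n::int. y = iter n x \<and> r = t - of_int n)"
      using cov_eq_iff[OF that(1) WX] by fast
    also have "\<dots> \<longleftrightarrow> (x, t) \<in> (\<Union>n. W' n)" using that(1) by (auto simp: W'_def)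
    finally show ?thesis .
  qed
  have "{z \<in> topspace (prod_topology X (top_of_set {0..1})). q z \<in> cov ` W} = (\<Union>n. W' n) \<inter> topspace X \<times> {0..1}"
  proof (rule set_eqI)
    fix z :: "'u \<times> real"
    obtain x t where z: "z = (x, t)" by (cases z)
    show "z \<in> {z \<in> topspace (prod_topology X (top_of_set {0..1})). q z \<in> cov ` W} \<longleftrightarrow>
        z \<in> (\<Union>n. W' n) \<inter> topspace X \<times> {0..1}"
      using *[of x t] by (cases "x \<in> topspace X \<and> 0 \<le> t \<and> t \<le> 1") (simp_all add: z, blast)
  qed
  then have "openin (prod_topology X (top_of_set {0..1}))
      {z \<in> topspace (prod_topology X (top_of_set {0..1})). q z \<in> cov ` W}"
    unfolding prod_topology_subtopology using UW by (auto simp: openin_subtopology)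
  moreover have "cov ` W \<subseteq> topspace M" using cov_in WX by auto
  ultimately show "openin M (cov ` W)"
    using quotient_q unfolding quotient_map_def by blast
qed

lemma cov_surj: "cov ` topspace (prod_topology X euclideanreal) = topspace M"
proof
  show "cov ` topspace (prod_topology X euclideanreal) \<subseteq> topspace M" using cov_in by auto
  show "topspace M \<subseteq> cov ` topspace (prod_topology X euclideanreal)"
  proof
    fix p assume "p \<in> topspace M"
    then obtain x t where "x \<in> topspace X" "p = cov (x, t)" by (rule torus_cases)
    then show "p \<in> cov ` topspace (prod_topology X euclideanreal)" by simp
  qed
qed

lemma quotient_cov: "quotient_map (prod_topology X euclideanreal) M cov"
  using continuous_map_cov open_map_cov cov_surj by (rule continuous_open_imp_quotient_map)

text \<open>Two points are represented by \<open>(x, s)\<close> and \<open>(y, r)\<close> with \<open>\<bar>s - r\<bar> \<le> 1 / 2\<close>. If \<open>s \<noteq> r\<close>,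
  disjoint intervals around \<open>s\<close> and \<open>r\<close>
  of radius at most \<open>1 / 4\<close> remain disjoint after translation by any integer. If \<open>s = r\<close>, disjoint neighbourhoods of
  \<open>x\<close> and \<open>y\<close> in \<open>X\<close> do the job, as the times are too close for a deck transformation other than the identity.\<close>

lemma Hausdorff_torus:
  assumes X: "Hausdorff_space X" shows "Hausdorff_space M"
  unfolding Hausdorff_space_def
proof (intro allI impI, elim conjE)
  fix p p' assume p: "p \<in> topspace M" and p': "p' \<in> topspace M" and ne: "p \<noteq> p'"
  obtain x s where xs: "x \<in> topspace X" "p = cov (x, s)" using p by (rule torus_cases)
  obtain z u where zu: "z \<in> topspace X" "p' = cov (z, u)" using p' by (rule torus_cases)
  define y r where "y = iter (round (u - s)) z" and "r = u - of_int (round (u - s))"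
  have yr: "y \<in> topspace X" "p' = cov (y, r)"
    using zu by (simp_all add: y_def r_def iter_in cov_iter)
  have near: "\<bar>s - r\<bar> \<le> 1/2"
    using of_int_round_abs_le[of "u - s"] unfolding r_def by linarith
  have *: "\<exists>U V. openin M U \<and> openin M V \<and> p \<in> U \<and> p' \<in> V \<and> disjnt U V"
    if A: "openin X A" "x \<in> A" and B: "openin X B" "y \<in> B" and e: "0 < e" "e \<le> 1/4"
      and disj: "\<And>a b n. \<lbrakk>a \<in> A; iter n a \<in> B; \<bar>b - s\<bar> < e; \<bar>b - of_int n - r\<bar> < e\<rbrakk> \<Longrightarrow> False" for A B e
  proof (intro exI conjI)
    have o: "openin (prod_topology X euclideanreal) (A \<times> {s - e<..<s + e})"
      "openin (prod_topology X euclideanreal) (B \<times> {r - e<..<r + e})"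
      using A B by (simp_all add: openin_prod_Times_iff)
    show "openin M (cov ` (A \<times> {s - e<..<s + e}))" "openin M (cov ` (B \<times> {r - e<..<r + e}))"
      using open_map_cov o unfolding open_map_def by blast+
    show "p \<in> cov ` (A \<times> {s - e<..<s + e})" "p' \<in> cov ` (B \<times> {r - e<..<r + e})"
      using A B e xs yr by auto
    show "disjnt (cov ` (A \<times> {s - e<..<s + e})) (cov ` (B \<times> {r - e<..<r + e}))"
    proof (rule ccontr)
      assume "\<not> ?thesis"
      then obtain a b c d where abcd: "a \<in> A" "s - e < b" "b < s + e" "c \<in> B" "r - e < d" "d < r + e"
        "cov (a, b) = cov (c, d)"
        by (auto simp: disjnt_iff)
      moreover have "a \<in> topspace X" "c \<in> topspace X"
        using abcd A B openin_subset by blast+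
      ultimately obtain n where "c = iter n a" "d = b - of_int n" using cov_eq_iff by blast
      then show False using abcd by (intro disj[of a n b]) auto
    qed
  qed
  show "\<exists>U V. openin M U \<and> openin M V \<and> p \<in> U \<and> p' \<in> V \<and> disjnt U V"
  proof (cases "s = r")
    case True
    then have "x \<noteq> y" using ne xs yr by auto
    then obtain A B where AB: "openin X A" "openin X B" "x \<in> A" "y \<in> B" "disjnt A B"
      using X xs yr unfolding Hausdorff_space_def by blast
    show ?thesis
    proof (rule *[OF AB(1,3) AB(2,4), of "1/4"])
      fix a b and n :: int
      assume a: "a \<in> A" "iter n a \<in> B" and b: "\<bar>b - s\<bar> < 1/4" "\<bar>b - of_int n - r\<bar> < 1/4"
      have "\<bar>of_int n :: real\<bar> < 1" using b True by linarith
      then have "n = 0" by linarith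
      then show False using a AB(5) by (auto simp: disjnt_iff)
    qed auto
  next
    case False
    show ?thesis
    proof (rule *[OF openin_topspace xs(1) openin_topspace yr(1), of "\<bar>s - r\<bar> / 2"])
      fix a b and n :: int
      assume b: "\<bar>b - s\<bar> < \<bar>s - r\<bar> / 2" "\<bar>b - of_int n - r\<bar> < \<bar>s - r\<bar> / 2"
      have "\<bar>of_int n - (s - r)\<bar> = \<bar>(b - s) - (b - of_int n - r)\<bar>" by simp
      also have "\<dots> \<le> \<bar>b - s\<bar> + \<bar>b - of_int n - r\<bar>" by (rule abs_triangle_ineq4)
      also have "\<dots> < \<bar>s - r\<bar> / 2 + \<bar>s - r\<bar> / 2" using b by (rule add_strict_mono)
      finally have *: "\<bar>of_int n - (s - r)\<bar> < \<bar>s - r\<bar>" by simp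
      then have "\<bar>of_int n :: real\<bar> < 1" using near by linarith
      then have "n = 0" by linarith
      then show False using * by simp
    qed (use near False in auto)
  qed
qed

text \<open>Deck transformations other than the identity move a strip of width 1 off itself, so the
  covering is injective on the strip.\<close>

lemma homeomorphic_map_cov_strip:
  assumes U: "openin X U"
  shows "openin M (cov ` (U \<times> {s - 1/2<..<s + 1/2}))"
    and "homeomorphic_map (subtopology (prod_topology X euclideanreal) (U \<times> {-1/2<..<1/2}))
      (subtopology M (cov ` (U \<times> {s - 1/2<..<s + 1/2}))) (\<lambda>(x, r). cov (x, s + r))"
proof -
  let ?E = "prod_topology X euclideanreal"
  have Us: "openin ?E (U \<times> {s - 1/2<..<s + 1/2})" and U0: "openin ?E (U \<times> {-1/2<..<1/2})"
    using U by (simp_all add: openin_prod_Times_iff)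
  then show "openin M (cov ` (U \<times> {s - 1/2<..<s + 1/2}))"
    using open_map_cov unfolding open_map_def by blast
  have UX: "U \<subseteq> topspace X" using openin_subset[OF U] .
  let ?g = "\<lambda>p. (fst p, s + snd p) :: 'u \<times> real"
  let ?C = "cov ` (U \<times> {s - 1/2<..<s + 1/2})"
  have g: "homeomorphic_maps ?E ?E ?g (\<lambda>p. (fst p, snd p - s))"
    unfolding homeomorphic_maps_def
    by (intro conjI continuous_map_pairedI continuous_map_add continuous_map_diff) 
      (auto simp: continuous_map_fst continuous_map_snd)
  then have hg: "homeomorphic_map ?E ?E ?g" by (rule homeomorphic_maps_imp_map)
  have om: "open_map ?E M (cov \<circ> ?g)"
    by (rule open_map_compose[OF homeomorphic_imp_open_map[OF hg] open_map_cov])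
  have cm: "continuous_map ?E M (cov \<circ> ?g)"
    by (rule continuous_map_compose[OF homeomorphic_imp_continuous_map[OF hg] continuous_map_cov])
  have img: "(cov \<circ> ?g) ` (U \<times> {-1/2<..<1/2}) = ?C"
  proof -
    have "?g ` (U \<times> {-1/2<..<1/2}) = U \<times> {s - 1/2<..<s + 1/2}"
    proof
      show "U \<times> {s - 1/2<..<s + 1/2} \<subseteq> ?g ` (U \<times> {-1/2<..<1/2})"
      proof
        fix p assume "p \<in> U \<times> {s - 1/2<..<s + 1/2}"
        then show "p \<in> ?g ` (U \<times> {-1/2<..<1/2})"
          by (intro image_eqI[of _ _ "(fst p, snd p - s)"]) auto
      qed
    qed auto
    then show ?thesis by (metis image_comp)
  qed
  have top: "topspace (subtopology ?E (U \<times> {-1/2<..<1/2})) = U \<times> {-1/2<..<1/2}"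
    using UX by auto
  have "homeomorphic_map (subtopology ?E (U \<times> {-1/2<..<1/2})) (subtopology M ?C) (cov \<circ> ?g)"
  proof (rule bijective_open_imp_homeomorphic_map)
    show "continuous_map (subtopology ?E (U \<times> {-1/2<..<1/2})) (subtopology M ?C) (cov \<circ> ?g)"
      using cm img unfolding continuous_map_in_subtopology top
      by (auto simp: continuous_map_from_subtopology)
    show "open_map (subtopology ?E (U \<times> {-1/2<..<1/2})) (subtopology M ?C) (cov \<circ> ?g)"
    proof (intro open_map_into_subtopology open_map_from_subtopology om U0)
      show "cov \<circ> ?g \<in> topspace (subtopology ?E (U \<times> {-1/2<..<1/2})) \<rightarrow> ?C"
        unfolding top using img by blast
    qed
    have "?C \<subseteq> topspace M" using UX cov_in by auto
    then show "(cov \<circ> ?g) ` topspace (subtopology ?E (U \<times> {-1/2<..<1/2})) = topspace (subtopology M ?C)"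
      unfolding top img by auto
    show "inj_on (cov \<circ> ?g) (topspace (subtopology ?E (U \<times> {-1/2<..<1/2})))"
      unfolding top
    proof (rule inj_onI)
      fix a b assume a: "a \<in> U \<times> {-1/2<..<1/2}" and b: "b \<in> U \<times> {-1/2<..<1/2}"
        and eq: "(cov \<circ> ?g) a = (cov \<circ> ?g) b"
      then have "cov (fst a, s + snd a) = cov (fst b, s + snd b)" "fst a \<in> topspace X" "fst b \<in> topspace X"
        using UX by auto
      then obtain n where n: "fst b = iter n (fst a)" "s + snd b = s + snd a - of_int n"
        using cov_eq_iff by blast
      then have "\<bar>of_int n :: real\<bar> < 1" using a b by auto
      then have "n = 0" by linarith
      then show "a = b" using n by (simp add: prod_eq_iff)
    qed
  qed
  then show "homeomorphic_map (subtopology ?E (U \<times> {-1/2<..<1/2})) (subtopology M ?C) (\<lambda>(x, r). cov (x, s + r))"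
    by (simp add: o_def case_prod_unfold)
qed

lemma cov_flow_box:
  assumes U: "openin X U" and \<phi>: "homeomorphic_map (subtopology X U) (Euclidean_space m) \<phi>"
  obtains \<kappa> where
    "homeomorphic_map (subtopology M (cov ` (U \<times> {s - 1/2<..<s + 1/2}))) (Euclidean_space (Suc m)) \<kappa>"
    "\<And>x r. x \<in> U \<Longrightarrow> \<bar>r\<bar> < 1/2 \<Longrightarrow> \<kappa> (cov (x, s + r)) = flow_box_chart m \<phi> (x, r)"
proof -
  let ?E = "subtopology (prod_topology X euclideanreal) (U \<times> {-1/2<..<1/2})"
  obtain k where k: "homeomorphic_maps ?E (subtopology M (cov ` (U \<times> {s - 1/2<..<s + 1/2})))
      (\<lambda>(x, r). cov (x, s + r)) k"
    using homeomorphic_map_cov_strip(2)[OF U] unfolding homeomorphic_map_maps by blast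
  then have "homeomorphic_map (subtopology M (cov ` (U \<times> {s - 1/2<..<s + 1/2}))) ?E k"
    using homeomorphic_maps_map by blast
  from homeomorphic_map_compose[OF this homeomorphic_map_flow_box_chart[OF \<phi>]]
  show thesis
  proof (rule that)
    fix x and r :: real assume "x \<in> U" "\<bar>r\<bar> < 1/2"
    moreover from this have "(x, r) \<in> topspace ?E" using openin_subset[OF U] by (auto simp: abs_less_iff)
    ultimately have "k (cov (x, s + r)) = (x, r)"
      using k unfolding homeomorphic_maps_def by (metis (mono_tags, lifting) case_prod_conv)
    then show "(flow_box_chart m \<phi> \<circ> k) (cov (x, s + r)) = flow_box_chart m \<phi> (x, r)" by simp
  qed
qed

lemma manifold_torus:
  assumes X: "manifold m X" shows "manifold (Suc m) M"
  unfolding manifold_def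
proof (intro conjI ballI)
  show "Hausdorff_space M" using X by (intro Hausdorff_torus) (simp add: manifold_def)
  show "second_countable M"
    using X second_countable_open_map_image[OF continuous_map_cov open_map_cov cov_surj]
      second_countable_prod_real unfolding manifold_def by blast
  fix p assume "p \<in> topspace M"
  then obtain x s where xs: "x \<in> topspace X" "p = cov (x, s)" by (rule torus_cases)
  obtain U \<phi> where U: "openin X U" "x \<in> U" "homeomorphic_map (subtopology X U) (Euclidean_space m) \<phi>"
    using manifold_chart[OF X xs(1)] .
  obtain \<kappa> where "homeomorphic_map (subtopology M (cov ` (U \<times> {s - 1/2<..<s + 1/2}))) (Euclidean_space (Suc m)) \<kappa>"
    using cov_flow_box[OF U(1,3)] by blast
  then have h: "subtopology M (cov ` (U \<times> {s - 1/2<..<s + 1/2})) homeomorphic_space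
      subtopology (Euclidean_space (Suc m)) (topspace (Euclidean_space (Suc m)))"
    by (simp add: homeomorphic_map_imp_homeomorphic_space)
  have "p \<in> cov ` (U \<times> {s - 1/2<..<s + 1/2})" unfolding xs(2) using U(2) by (intro imageI) auto
  then show "\<exists>U V. openin M U \<and> p \<in> U \<and> openin (Euclidean_space (Suc m)) V \<and>
      subtopology M U homeomorphic_space subtopology (Euclidean_space (Suc m)) V"
    using h homeomorphic_map_cov_strip(1)[OF U(1)] openin_topspace by blast
qed

end

section \<open>The suspension flow and its section\<close>

context suspension
begin

abbreviation sus where "sus \<equiv> suspension_flow code f X"
definition base where "base = {q (x, 0) | x. x \<in> topspace X}"

lemma torus_coord_q:
  assumes "x \<in> topspace X" "0 \<le> t" "t < 1"
  shows "torus_coord code f X (q (x, t)) = (x, t)"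
  unfolding torus_coord_def
proof (rule the_equality)
  fix p assume "case p of (y, s) \<Rightarrow> y \<in> topspace X \<and> 0 \<le> s \<and> s < 1 \<and> q (x, t) = q (y, s)"
  then show "p = (x, t)" using q_inj[OF assms(1) _ assms(2,3)] by (cases p) (metis (mono_tags, lifting) case_prod_conv)
qed (use assms in simp)

lemma suspension_flow_cov:
  assumes x: "x \<in> topspace X"
  shows "sus (cov (x, s), t) = cov (x, s + t)"
proof -
  define u where "u = s - of_int \<lfloor>s\<rfloor>"
  have c: "torus_coord code f X (cov (x, s)) = (iter \<lfloor>s\<rfloor> x, u)"
    using torus_coord_q[OF iter_in[OF x] floor_frac] by (simp add: cov_def u_def)
  have "(THE n :: int. t + u - 1 < real_of_int n \<and> real_of_int n \<le> t + u) = \<lfloor>t + u\<rfloor>"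
    by (rule the_equality) (linarith, simp add: floor_unique[symmetric] algebra_simps)
  then have "sus (cov (x, s), t) = cov (iter \<lfloor>s\<rfloor> x, t + u)"
    using cov_in[OF x] c by (simp add: suspension_flow_def cov_def Let_def)
  also have "\<dots> = cov (x, s + t)" by (simp add: cov_iter[OF x] u_def add.commute)
  finally show ?thesis .
qed

text \<open>The flow is covered by the translation of \<open>X \<times> \<real>\<close>, and \<open>cov \<times> id\<close> is again a quotient map
  because \<open>\<real>\<close> is locally compact.\<close>

lemma continuous_map_suspension_flow:
  "continuous_map (prod_topology M euclideanreal) M sus"
proof (rule continuous_compose_quotient_map)
  show "quotient_map (prod_topology (prod_topology X euclideanreal) euclideanreal)
      (prod_topology M euclideanreal) (\<lambda>(p, t). (cov p, t))"
    by (intro quotient_map_prod_left locally_compact_space_euclidean quotient_cov) simp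
  have "continuous_map (prod_topology (prod_topology X euclideanreal) euclideanreal)
      (prod_topology X euclideanreal) (\<lambda>p. (fst (fst p), snd (fst p) + snd p))"
    using continuous_map_compose[OF continuous_map_fst continuous_map_fst]
      continuous_map_compose[OF continuous_map_fst continuous_map_snd]
    by (intro continuous_map_pairedI continuous_map_add continuous_map_snd) (simp_all add: o_def)
  from continuous_map_compose[OF this continuous_map_cov]
  show "continuous_map (prod_topology (prod_topology X euclideanreal) euclideanreal) M
      (sus \<circ> (\<lambda>(p, t). (cov p, t)))"
    by (rule continuous_map_eq) (auto simp: suspension_flow_cov)
qed

lemma is_flow_suspension:
  assumes X: "manifold m X" shows "is_flow sus M"
  unfolding is_flow_def
proof (intro conjI ballI allI)
  show "top_manifold M" using manifold_torus[OF X] by (auto simp: top_manifold_def)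
  show "sus \<in> extensional (topspace M \<times> UNIV)" by (simp add: suspension_flow_def)
  fix p assume "p \<in> topspace M"
  then obtain x s where x: "x \<in> topspace X" "p = cov (x, s)" by (rule torus_cases)
  then show "sus (p, 0) = p" by (simp add: suspension_flow_cov)
  show "sus (sus (p, t), s) = sus (p, t + s)" for t s
    using x by (simp add: suspension_flow_cov add.assoc)
qed (rule continuous_map_suspension_flow)

lemma cov_in_base_iff: 
  assumes x: "x \<in> topspace X" shows "cov (x, s) \<in> base \<longleftrightarrow> s \<in> \<int>"
proof
  assume "cov (x, s) \<in> base"
  then obtain y where "y \<in> topspace X" "cov (x, s) = cov (y, 0)"
    using cov_unit[of _ 0] by (auto simp: base_def)
  then show "s \<in> \<int>" using cov_eq_iff[OF x, of y s 0] by auto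
next
  assume "s \<in> \<int>"
  then obtain n where "s = of_int n" by (elim Ints_cases)
  then have "cov (x, s) = q (iter n x, 0)" by (simp add: cov_def)
  then show "cov (x, s) \<in> base" using iter_in[OF x] by (auto simp: base_def)
qed

lemma base_cases:
  assumes "p \<in> base" obtains x where "x \<in> topspace X" "p = cov (x, 0)" "p = q (x, 0)"
  using assms cov_unit[of _ 0] by (auto simp: base_def)

lemma closedin_base: "closedin M base"
proof -
  have sub: "base \<subseteq> topspace M" using q_in by (auto simp: base_def)
  have eq: "{p. p \<in> topspace (prod_topology X euclideanreal) \<and> cov p \<in> base} = topspace X \<times> \<int>"
    using cov_in_base_iff by auto
  have cl: "closedin (prod_topology X euclideanreal) (topspace X \<times> \<int>)"
    by (simp add: closedin_prod_Times_iff)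
  have qm: "\<forall>C. C \<subseteq> topspace M \<longrightarrow>
      (closedin (prod_topology X euclideanreal) {p. p \<in> topspace (prod_topology X euclideanreal) \<and> cov p \<in> C}
        \<longleftrightarrow> closedin M C)"
    using quotient_cov unfolding quotient_map_closedin by (rule conjunct2)
  show ?thesis using qm[rule_format, OF sub] cl unfolding eq by blast
qed

lemma base_strip:
  assumes U: "U \<subseteq> topspace X"
  shows "cov ` (U \<times> {0 - 1/2<..<0 + 1/2}) \<inter> base = (\<lambda>x. cov (x, 0)) ` U"
proof
  show "cov ` (U \<times> {0 - 1/2<..<0 + 1/2}) \<inter> base \<subseteq> (\<lambda>x. cov (x, 0)) ` U"
  proof
    fix p assume "p \<in> cov ` (U \<times> {0 - 1/2<..<0 + 1/2}) \<inter> base"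
    then obtain x r where p: "x \<in> U" "- 1/2 < r" "r < 1/2" "p = cov (x, r)" "cov (x, r) \<in> base"
      by auto
    then have "r \<in> \<int>" using cov_in_base_iff U by blast
    then obtain n where n: "r = of_int n" by (elim Ints_cases)
    have "n = 0" using p(2,3) unfolding n by linarith
    then have "r = 0" using n by simp
    then show "p \<in> (\<lambda>x. cov (x, 0)) ` U" using p by auto
  qed
  show "(\<lambda>x. cov (x, 0)) ` U \<subseteq> cov ` (U \<times> {0 - 1/2<..<0 + 1/2}) \<inter> base"
  proof
    fix p assume "p \<in> (\<lambda>x. cov (x, 0)) ` U"
    then obtain x where x: "x \<in> U" "p = cov (x, 0)" by blast
    then have "p \<in> base" using cov_in_base_iff[of x 0] subsetD[OF U x(1)] by simp
    moreover have "p \<in> cov ` (U \<times> {0 - 1/2<..<0 + 1/2})"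
      unfolding x(2) using x(1) by (intro imageI) simp
    ultimately show "p \<in> cov ` (U \<times> {0 - 1/2<..<0 + 1/2}) \<inter> base" by blast
  qed
qed

lemma base_eq: "base = (\<lambda>x. cov (x, 0)) ` topspace X"
  using cov_unit[of _ 0] by (force simp: base_def)

lemma homeomorphic_map_base: "homeomorphic_map X (subtopology M base) (\<lambda>x. cov (x, 0))"
proof (rule bijective_open_imp_homeomorphic_map)
  have "continuous_map X (prod_topology X euclideanreal) (\<lambda>x. (x, 0))"
    by (simp add: continuous_map_pairwise o_def)
  from continuous_map_compose[OF this continuous_map_cov]
  show "continuous_map X (subtopology M base) (\<lambda>x. cov (x, 0))"
    using base_eq by (simp add: continuous_map_in_subtopology o_def)
  show "open_map X (subtopology M base) (\<lambda>x. cov (x, 0))"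
    unfolding open_map_def
  proof (intro allI impI)
    fix U assume U: "openin X U"
    show "openin (subtopology M base) ((\<lambda>x. cov (x, 0)) ` U)"
      unfolding base_strip[OF openin_subset[OF U], symmetric]
      by (intro openin_subtopology_Int homeomorphic_map_cov_strip(1) U)
  qed
  show "(\<lambda>x. cov (x, 0)) ` topspace X = topspace (subtopology M base)"
    using closedin_subset[OF closedin_base] base_eq by (simp add: Int_absorb1)
  show "inj_on (\<lambda>x. cov (x, 0)) (topspace X)"
    using cov_unit[of _ 0] by (auto intro!: inj_onI simp: q_inj)
qed

text \<open>In this chart around a point of the section, the section is the hyperplane and the sign of
  the last coordinate is the sign of the time.\<close>

lemma cov_flow_box_base:
  assumes U: "openin X U" and \<phi>: "homeomorphic_map (subtopology X U) (Euclidean_space m) \<phi>"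
  obtains \<kappa> where
    "homeomorphic_map (subtopology M (cov ` (U \<times> {0 - 1/2<..<0 + 1/2}))) (Euclidean_space (Suc m)) \<kappa>"
    "\<kappa> ` (cov ` (U \<times> {0 - 1/2<..<0 + 1/2}) \<inter> base) = topspace (Euclidean_space m)"
    "\<And>x r. x \<in> U \<Longrightarrow> \<bar>r\<bar> < 1/2 \<Longrightarrow> \<kappa> (cov (x, r)) m = tan (pi * r)"
proof -
  obtain \<kappa> where \<kappa>: "homeomorphic_map (subtopology M (cov ` (U \<times> {0 - 1/2<..<0 + 1/2}))) (Euclidean_space (Suc m)) \<kappa>"
    "\<And>x r. x \<in> U \<Longrightarrow> \<bar>r\<bar> < 1/2 \<Longrightarrow> \<kappa> (cov (x, 0 + r)) = flow_box_chart m \<phi> (x, r)"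
    by (rule cov_flow_box[OF U \<phi>, of 0]) (rule that)
  have UX: "U \<subseteq> topspace X" using openin_subset[OF U] .
  have im: "\<phi> ` U = topspace (Euclidean_space m)"
    using homeomorphic_imp_surjective_map[OF \<phi>] UX by (simp add: Int_absorb1)
  have "\<kappa> (cov (x, 0)) = \<phi> x" if "x \<in> U" for x
  proof -
    have "\<phi> x \<in> topspace (Euclidean_space m)" using im that by blast
    then have "\<phi> x m = 0" by (simp add: topspace_Euclidean_space)
    then have "(\<phi> x)(m := 0) = \<phi> x" by (metis fun_upd_triv)
    then show ?thesis using \<kappa>(2)[OF that, of 0] by (simp add: flow_box_chart_def)
  qed
  then have "\<kappa> ` (\<lambda>x. cov (x, 0)) ` U = \<phi> ` U" by (simp add: image_image)
  then have "\<kappa> ` (cov ` (U \<times> {0 - 1/2<..<0 + 1/2}) \<inter> base) = topspace (Euclidean_space m)"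
    unfolding base_strip[OF UX] im .
  then show thesis using that[OF \<kappa>(1)] \<kappa>(2) by (simp add: flow_box_chart_def)
qed

text \<open>The last coordinate of the flow box chart vanishes on no point of \<open>B - base\<close>, but is \<open>-1\<close> and
  \<open>1\<close> at the times \<open>-1/4\<close> and \<open>1/4\<close>, so no connected subset contains both points.\<close>

lemma base_sides:
  assumes U: "openin X U" "x \<in> U" and \<phi>: "homeomorphic_map (subtopology X U) (Euclidean_space m) \<phi>"
  defines "B \<equiv> cov ` (U \<times> {0 - 1/2<..<0 + 1/2})"
  shows "\<exists>C\<in>connected_components_of (subtopology M (B - base)).
    \<exists>D\<in>connected_components_of (subtopology M (B - base)).
      C \<noteq> D \<and> sus ` ({cov (x, 0)} \<times> {- 1/4..<0}) \<subseteq> C \<and> sus ` ({cov (x, 0)} \<times> {0<..1/4}) \<subseteq> D"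
proof -
  let ?T = "subtopology M (B - base)"
  have xX: "x \<in> topspace X" using U openin_subset by blast
  have B: "openin M B" unfolding B_def by (rule homeomorphic_map_cov_strip(1)[OF U(1)])
  obtain \<kappa> where \<kappa>: "homeomorphic_map (subtopology M B) (Euclidean_space (Suc m)) \<kappa>"
    "\<And>x r. x \<in> U \<Longrightarrow> \<bar>r\<bar> < 1/2 \<Longrightarrow> \<kappa> (cov (x, r)) m = tan (pi * r)"
    by (rule cov_flow_box_base[OF U(1) \<phi>, folded B_def]) (rule that)
  have "continuous_map euclideanreal (prod_topology X euclideanreal) (\<lambda>t. (x, t))"
    using xX by (simp add: continuous_map_pairwise o_def)
  from continuous_map_compose[OF this continuous_map_cov]
  have path: "continuous_map euclideanreal M (\<lambda>t. cov (x, t))" by (simp add: o_def)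
  have conn: "\<exists>C\<in>connected_components_of ?T. (\<lambda>t. cov (x, t)) ` I \<subseteq> C"
    if I: "connected I" "I \<noteq> {}" "I \<subseteq> {-1/4..1/4} - {0}" for I
  proof -
    have sub: "(\<lambda>t. cov (x, t)) ` I \<subseteq> B - base"
    proof (rule image_subsetI)
      fix t assume t: "t \<in> I"
      then have "- 1/4 \<le> t" "t \<le> 1/4" "t \<noteq> 0" using I(3) by auto
      then have t': "\<bar>t\<bar> \<le> 1/4" "t \<noteq> 0" by linarith+
      have "t \<notin> \<int>"
      proof
        assume "t \<in> \<int>"
        then obtain n where "t = of_int n" by (elim Ints_cases)
        moreover from this have "n = 0" using t' by linarith
        ultimately show False using t' by simp
      qed
      moreover have "cov (x, t) \<in> B" unfolding B_def using U(2) t' by (intro imageI) auto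
      ultimately show "cov (x, t) \<in> B - base" using cov_in_base_iff[OF xX, of t] by blast
    qed
    have "connectedin M ((\<lambda>t. cov (x, t)) ` I)"
      using I(1) by (intro connectedin_continuous_map_image[OF path]) (simp add: connectedin_iff_connected)
    then have "connectedin ?T ((\<lambda>t. cov (x, t)) ` I)"
      using sub by (simp add: connectedin_subtopology)
    moreover have "?T \<noteq> trivial_topology"
      using sub I(2) openin_subset[OF B] by (auto simp flip: null_topspace_iff_trivial)
    ultimately show ?thesis using exists_connected_component_of_superset by blast
  qed
  have flow: "sus ` ({cov (x, 0)} \<times> I) = (\<lambda>t. cov (x, t)) ` I" for I
  proof -
    have "{cov (x, 0)} \<times> I = (\<lambda>t. (cov (x, 0), t)) ` I" by auto
    then show ?thesis by (simp add: image_image suspension_flow_cov[OF xX])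
  qed
  obtain C where C: "C \<in> connected_components_of ?T" "(\<lambda>t. cov (x, t)) ` {- 1/4..<0} \<subseteq> C"
    using conn[of "{- 1/4..<0}"] by force
  obtain D where D: "D \<in> connected_components_of ?T" "(\<lambda>t. cov (x, t)) ` {0<..1/4} \<subseteq> D"
    using conn[of "{0<..1/4}"] by force
  have "C \<noteq> D"
  proof
    assume eq: "C = D"
    have "connectedin ?T C" using C(1) by (rule connectedin_connected_components_of)
    then have cC: "connectedin (subtopology M B) C" and CB: "C \<subseteq> B - base"
      unfolding connectedin_subtopology by auto
    have "continuous_map (subtopology M B) euclideanreal (\<lambda>p. \<kappa> p m)"
      using continuous_map_compose[OF homeomorphic_imp_continuous_map[OF \<kappa>(1)]
          continuous_map_Euclidean_space_coordinate[of "Suc m" m]] by (simp add: o_def)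
    then have "connectedin euclideanreal ((\<lambda>p. \<kappa> p m) ` C)"
      by (rule connectedin_continuous_map_image[OF _ cC])
    then have "connected ((\<lambda>p. \<kappa> p m) ` C)" by (simp add: connectedin_iff_connected)
    moreover have "cov (x, - 1/4) \<in> C" using C(2) by (auto simp: image_subset_iff)
    then have "- 1 \<in> (\<lambda>p. \<kappa> p m) ` C"
      using \<kappa>(2)[OF U(2), of "- 1/4"] tan_45 by (intro image_eqI[of _ _ "cov (x, - 1/4)"]) auto
    moreover have "cov (x, 1/4) \<in> C" using D(2) eq by (auto simp: image_subset_iff)
    then have "1 \<in> (\<lambda>p. \<kappa> p m) ` C"
      using \<kappa>(2)[OF U(2), of "1/4"] tan_45 by (intro image_eqI[of _ _ "cov (x, 1/4)"]) auto
    ultimately have "0 \<in> (\<lambda>p. \<kappa> p m) ` C" by (rule connectedD_interval) auto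
    then obtain p where p: "p \<in> C" "\<kappa> p m = 0" by auto
    have "p \<in> B" using p(1) CB by blast
    then obtain y r where "y \<in> U" "- 1/2 < r" "r < 1/2" "p = cov (y, r)" by (auto simp: B_def)
    then have y: "y \<in> U" "\<bar>r\<bar> < 1/2" "p = cov (y, r)" by (simp_all add: abs_less_iff)
    then have "tan (pi * r) = tan (pi * 0)" using \<kappa>(2)[of y r] p(2) by simp
    moreover have "r \<in> topspace (top_of_set {-1/2<..<1/2})" "0 \<in> topspace (top_of_set {-1/2<..<1/2::real})"
      using y(2) by auto
    ultimately have "r = 0"
      by (rule inj_onD[OF homeomorphic_imp_injective_map[OF homeomorphic_map_tan]])
    then have "p \<in> base"
      using y(3) cov_in_base_iff[of y 0] subsetD[OF openin_subset[OF U(1)] y(1)] by simp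
    then show False using p(1) CB by blast
  qed
  then show ?thesis unfolding flow using C D by blast
qed

text \<open>All orbits return after time exactly 1, so constant return-free times of \<open>1/4\<close> work at all
  points, and the flow box around a point serves as the neighbourhood required in all the
  conditions.\<close>

lemma transversal_base:
  assumes X: "manifold m X" shows "transversal_dim m sus M base"
  unfolding transversal_dim_def
proof (intro conjI)
  show "manifold (Suc m) M" using X by (rule manifold_torus)
  show "closedin M base" by (rule closedin_base)
  show "manifold m (subtopology M base)"
    using X homeomorphic_map_base by (rule manifold_homeomorphic_space)
  have chart: "\<exists>U \<phi>. openin X U \<and> x \<in> U \<and> homeomorphic_map (subtopology X U) (Euclidean_space m) \<phi>"
    if "x \<in> topspace X" for x
    using manifold_chart[OF X that] by blast
  show "locally_flat m M base"
    unfolding locally_flat_def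
  proof
    fix p assume "p \<in> base"
    then obtain x where x: "x \<in> topspace X" "p = cov (x, 0)" by (rule base_cases)
    obtain U \<phi> where U: "openin X U" "x \<in> U" "homeomorphic_map (subtopology X U) (Euclidean_space m) \<phi>"
      using chart[OF x(1)] by blast
    have "p \<in> cov ` (U \<times> {0 - 1/2<..<0 + 1/2})" unfolding x(2) using U(2) by (intro imageI) simp
    then show "\<exists>U \<phi>. openin M U \<and> p \<in> U \<and>
        homeomorphic_map (subtopology M U) (Euclidean_space (Suc m)) \<phi> \<and>
        \<phi> ` (U \<inter> base) = topspace (Euclidean_space m)"
      using cov_flow_box_base[OF U(1,3)] homeomorphic_map_cov_strip(1)[OF U(1), of 0] by metis
  qed
  show "\<forall>y\<in>topspace M. \<forall>a b. compactin (subtopology M base) (sus ` ({y} \<times> {a..b}) \<inter> base)"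
  proof (intro ballI allI)
    fix y and a b :: real assume y: "y \<in> topspace M"
    have "compactin (prod_topology M euclideanreal) ({y} \<times> {a..b})"
      using y by (simp add: compactin_Times)
    then have "compactin M (sus ` ({y} \<times> {a..b}))"
      by (rule image_compactin[OF _ continuous_map_suspension_flow])
    then have "compactin M (sus ` ({y} \<times> {a..b}) \<inter> base)"
      using closed_Int_compactin[OF closedin_base] by (metis Int_commute)
    then show "compactin (subtopology M base) (sus ` ({y} \<times> {a..b}) \<inter> base)"
      by (simp add: compactin_subtopology)
  qed
  show "\<exists>\<delta>\<^sub>p \<delta>\<^sub>m :: 'u \<Rightarrow> real. \<forall>x\<in>base. \<delta>\<^sub>p x > 0 \<and> \<delta>\<^sub>m x < 0 \<and>
        (\<exists>U \<phi>. openin M U \<and> x \<in> U \<and>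
           homeomorphic_map (subtopology M U)
             (subtopology (Euclidean_space (Suc m)) (unit_ball (Suc m))) \<phi> \<and>
           \<phi> ` (U \<inter> base) = unit_ball (Suc m) \<inter> topspace (Euclidean_space m) \<and>
           (\<exists>C\<in>connected_components_of (subtopology M (U - base)).
            \<exists>D\<in>connected_components_of (subtopology M (U - base)).
              C \<noteq> D \<and> sus ` ({x} \<times> {\<delta>\<^sub>m x..<0}) \<subseteq> C \<and> sus ` ({x} \<times> {0<..\<delta>\<^sub>p x}) \<subseteq> D) \<and>
           sus ` ({x} \<times> {\<delta>\<^sub>m x..\<delta>\<^sub>p x}) \<inter> base = {x} \<and>
           (\<exists>V \<delta>. openin M V \<and> x \<in> V \<and> V \<subseteq> U \<and> \<delta> > 0 \<and>
              (\<forall>y\<in>V \<inter> base. \<delta>\<^sub>p y > \<delta> \<and> \<delta>\<^sub>m y < -\<delta>)))"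
  proof (rule exI[of _ "\<lambda>_. 1/4"], rule exI[of _ "\<lambda>_. - 1/4"], rule ballI)
    fix p assume "p \<in> base"
    then obtain x where x: "x \<in> topspace X" "p = cov (x, 0)" by (rule base_cases)
    obtain U \<phi> where U: "openin X U" "x \<in> U" "homeomorphic_map (subtopology X U) (Euclidean_space m) \<phi>"
      using chart[OF x(1)] by blast
    let ?B = "cov ` (U \<times> {0 - 1/2<..<0 + 1/2})"
    obtain \<kappa> where \<kappa>: "homeomorphic_map (subtopology M ?B) (Euclidean_space (Suc m)) \<kappa>"
      "\<kappa> ` (?B \<inter> base) = topspace (Euclidean_space m)"
      using cov_flow_box_base[OF U(1,3)] by metis
    have B: "openin M ?B" "p \<in> ?B"
      using homeomorphic_map_cov_strip(1)[OF U(1), of 0] U(2) unfolding x(2) by auto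
    have hom: "homeomorphic_map (subtopology M ?B)
        (subtopology (Euclidean_space (Suc m)) (unit_ball (Suc m))) (ball_map (Suc m) (\<lambda>_. 0) 1 \<circ> \<kappa>)"
      using \<kappa>(1) homeomorphic_map_unit_ball by (rule homeomorphic_map_compose)
    have im: "(ball_map (Suc m) (\<lambda>_. 0) 1 \<circ> \<kappa>) ` (?B \<inter> base) = unit_ball (Suc m) \<inter> topspace (Euclidean_space m)"
      using \<kappa>(2) ball_map_hyperplane by (metis image_comp)
    have only: "sus ` ({p} \<times> {- 1/4..1/4}) \<inter> base = {p}"
    proof
      show "sus ` ({p} \<times> {- 1/4..1/4}) \<inter> base \<subseteq> {p}"
      proof
        fix z assume z: "z \<in> sus ` ({p} \<times> {- 1/4..1/4}) \<inter> base"
        then obtain t where t: "- 1/4 \<le> t" "t \<le> 1/4" "z = cov (x, t)"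
          using suspension_flow_cov[OF x(1), of 0] by (auto simp: x(2))
        then have "t \<in> \<int>" using z cov_in_base_iff[OF x(1), of t] by blast
        then obtain n where n: "t = of_int n" by (elim Ints_cases)
        have "n = 0" using t(1,2) unfolding n by linarith
        then have "t = 0" using n by simp
        then show "z \<in> {p}" using t x by simp
      qed
      have "sus (p, 0) = p" using suspension_flow_cov[OF x(1), of 0 0] x(2) by simp
      then have "p \<in> sus ` ({p} \<times> {- 1/4..1/4})" by (intro image_eqI[of _ _ "(p, 0)"]) auto
      then show "{p} \<subseteq> sus ` ({p} \<times> {- 1/4..1/4}) \<inter> base" using \<open>p \<in> base\<close> by simp
    qed
    have unif: "\<exists>V \<delta>. openin M V \<and> p \<in> V \<and> V \<subseteq> ?B \<and> \<delta> > 0 \<and>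
        (\<forall>y\<in>V \<inter> base. (1/4::real) > \<delta> \<and> - 1/4 < -\<delta>)"
      using B by (intro exI[of _ ?B] exI[of _ "1/8"]) auto
    show "0 < (1/4::real) \<and> - 1/4 < (0::real) \<and>
        (\<exists>U \<phi>. openin M U \<and> p \<in> U \<and>
           homeomorphic_map (subtopology M U)
             (subtopology (Euclidean_space (Suc m)) (unit_ball (Suc m))) \<phi> \<and>
           \<phi> ` (U \<inter> base) = unit_ball (Suc m) \<inter> topspace (Euclidean_space m) \<and>
           (\<exists>C\<in>connected_components_of (subtopology M (U - base)).
            \<exists>D\<in>connected_components_of (subtopology M (U - base)).
              C \<noteq> D \<and> sus ` ({p} \<times> {- 1/4..<0}) \<subseteq> C \<and> sus ` ({p} \<times> {0<..1/4}) \<subseteq> D) \<and>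
           sus ` ({p} \<times> {- 1/4..1/4}) \<inter> base = {p} \<and>
           (\<exists>V \<delta>. openin M V \<and> p \<in> V \<and> V \<subseteq> U \<and> \<delta> > 0 \<and>
              (\<forall>y\<in>V \<inter> base. (1/4::real) > \<delta> \<and> - 1/4 < -\<delta>)))"
      by (intro conjI, simp, simp, rule exI[of _ ?B],
          rule exI[of _ "ball_map (Suc m) (\<lambda>_. 0) 1 \<circ> \<kappa>"],
          intro conjI B hom im only unif base_sides[OF U, folded x(2)])
  qed
qed

lemma suspension_in_flow_objs:
  assumes "top_manifold X"
  shows "(sus, M, base) \<in> flow_objs"
proof -
  obtain m where m: "manifold m X" using assms by (auto simp: top_manifold_def)
  have "global_section sus M base"
    unfolding global_section_def
  proof (intro conjI ballI)
    show "transversal sus M base" using transversal_base[OF m] by (auto simp: transversal_def)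
    fix p assume "p \<in> topspace M"
    then obtain x s where x: "x \<in> topspace X" "p = cov (x, s)" by (rule torus_cases)
    have "sus (p, of_int n - s) \<in> base" for n
      using cov_in_base_iff[OF x(1), of "of_int n"] suspension_flow_cov[OF x(1)] x(2) by simp
    moreover have "of_int (\<lfloor>s\<rfloor> + 1) - s > 0" "of_int (\<lceil>s\<rceil> - 1) - s < 0" by linarith+
    ultimately show "\<exists>t>0. sus (p, t) \<in> base" "\<exists>t<0. sus (p, t) \<in> base" by blast+
  qed
  then show ?thesis using is_flow_suspension[OF m] by (simp add: flow_objs_def)
qed

lemma return_time_base:
  assumes x: "x \<in> topspace X" shows "return_time sus base (q (x, 0)) = 1"
proof (rule return_time_eqI)
  have q: "sus (q (x, 0), s) = cov (x, s)" for s
    using suspension_flow_cov[OF x, of 0 s] cov_unit[OF x, of 0] by simp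
  show "sus (q (x, 0), 1) \<in> base" unfolding q using cov_in_base_iff[OF x, of 1] by simp
  fix s :: real assume "0 < s" "s < 1"
  then have "s \<notin> \<int>" by (auto elim!: Ints_cases)
  then show "sus (q (x, 0), s) \<notin> base" unfolding q using cov_in_base_iff[OF x, of s] by blast
qed simp

lemma poincare_map_base:
  assumes x: "x \<in> topspace X" shows "poincare_map sus base (q (x, 0)) = q (f x, 0)"
proof -
  have "poincare_map sus base (q (x, 0)) = sus (cov (x, 0), 1)"
    using x return_time_base[OF x] cov_unit[OF x, of 0] by (auto simp: poincare_map_def base_def)
  also have "\<dots> = q (f x, 0)"
    using suspension_flow_cov[OF x] cov_unit[OF x, of 1] q_glue[OF x] by simp
  finally show ?thesis .
qed

end

section \<open>The categories\<close>

lemma map_homs_compose: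
  assumes "(f, X) \<in> map_objs" and "g \<in> map_homs (f, X) (f', Y)" and "h \<in> map_homs (f', Y) (f'', Z)"
  shows "compose (topspace X) h g \<in> map_homs (f, X) (f'', Z)"
proof -
  have f: "homeomorphic_map X X f"
    and g: "continuous_map X Y g" "\<And>x. x \<in> topspace X \<Longrightarrow> g (f x) = f' (g x)"
    and h: "continuous_map Y Z h" "\<And>y. y \<in> topspace Y \<Longrightarrow> h (f' y) = f'' (h y)"
    using assms by (auto simp: map_homs_def map_objs_def)
  have "continuous_map X Z (compose (topspace X) h g)"
    by (rule continuous_map_eq[OF continuous_map_compose[OF g(1) h(1)]]) (simp add: compose_def)
  moreover have "f x \<in> topspace X" "g x \<in> topspace Y" if "x \<in> topspace X" for x
    using that homeomorphic_imp_surjective_map[OF f] continuous_map_funspace[OF g(1)] by auto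
  ultimately show ?thesis
    using g h by (auto simp: map_homs_def compose_eq)
qed

lemma is_category_MapCat: "is_category (MapCat :: ('u map_obj, 'u \<Rightarrow> 'u) cat)"
  unfolding is_category_def
proof (intro conjI ballI)
  fix A :: "'u map_obj" assume "A \<in> objs MapCat"
  then show "ident MapCat A \<in> homs MapCat A A"
    by (cases A) (auto simp: MapCat_def map_homs_def map_objs_def homeomorphic_imp_continuous_map
      continuous_map_image_subset_topspace[THEN subsetD, OF homeomorphic_imp_continuous_map]
      intro: continuous_map_eq[OF continuous_map_id])
next
  fix A B C :: "'u map_obj" and g h
  assume "A \<in> objs MapCat" and "g \<in> homs MapCat A B" "h \<in> homs MapCat B C"
  then show "cmp MapCat A B C h g \<in> homs MapCat A C"
    by (cases A; cases B; cases C) (simp add: MapCat_def map_homs_compose)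
next
  fix A B :: "'u map_obj" and g
  assume g: "g \<in> homs MapCat A B"
  obtain f X where A: "A = (f, X)" by (cases A)
  obtain f' Y where B: "B = (f', Y)" by (cases B)
  have "g \<in> topspace X \<rightarrow> topspace Y" "g \<in> extensional (topspace X)"
    using g by (auto simp: A B MapCat_def map_homs_def continuous_map_def)
  then show "cmp MapCat A A B g (ident MapCat A) = g" "cmp MapCat A B B (ident MapCat B) g = g"
    by (simp_all add: A B MapCat_def compose_Id Id_compose)
next
  fix A B C D :: "'u map_obj" and g h k
  assume g: "g \<in> homs MapCat A B"
  obtain f X where A: "A = (f, X)" by (cases A)
  obtain f' Y where B: "B = (f', Y)" by (cases B)
  have "g \<in> topspace X \<rightarrow> topspace Y"
    using g by (auto simp: A B MapCat_def map_homs_def continuous_map_def)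
  then show "cmp MapCat A C D k (cmp MapCat A B C h g) = cmp MapCat A B D (cmp MapCat B C D k h) g"
    using compose_assoc[of g "topspace X" "topspace Y" k h] by (simp add: A B MapCat_def)
qed

lemma flow_objs_section_flow: "(\<Phi>, X, S) \<in> flow_objs \<Longrightarrow> section_flow X \<Phi> S"
  by (simp add: flow_objs_def global_section_imp_section_flow)

lemma weak_homs_iff:
  "(h, \<tau>) \<in> weak_homs (\<Phi>, X, S) (\<Psi>, Y, S') \<longleftrightarrow>
     h \<in> extensional (topspace X) \<and> \<tau> \<in> extensional (topspace X \<times> UNIV) \<and>
     continuous_map X Y h \<and>
     (\<forall>x\<in>topspace X. \<forall>t. h (\<Phi> (x, t)) = \<Psi> (h x, \<tau> (x, t))) \<and>
     (\<forall>x\<in>topspace X. strict_mono (\<lambda>t. \<tau> (x, t)) \<and>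
        homeomorphic_map euclideanreal euclideanreal (\<lambda>t. \<tau> (x, t)) \<and> \<tau> (x, 0) = 0) \<and>
     S = {x \<in> topspace X. h x \<in> S'}"
  by (simp add: weak_homs_def)

lemma weak_homs_cont: "(h, \<tau>) \<in> weak_homs (\<Phi>, X, S) (\<Psi>, Y, S') \<Longrightarrow> continuous_map X Y h"
  by (simp add: weak_homs_iff)

lemma weak_homs_in:
  "(h, \<tau>) \<in> weak_homs (\<Phi>, X, S) (\<Psi>, Y, S') \<Longrightarrow> x \<in> topspace X \<Longrightarrow> h x \<in> topspace Y"
  using weak_homs_cont continuous_map_funspace by blast

lemma weak_homs_section:
  "(h, \<tau>) \<in> weak_homs (\<Phi>, X, S) (\<Psi>, Y, S') \<Longrightarrow> x \<in> S \<Longrightarrow> h x \<in> S'"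
  unfolding weak_homs_iff by blast

lemma weak_homs_return:
  assumes "section_flow X \<Phi> S" "section_flow Y \<Psi> S'"
    and "(h, \<tau>) \<in> weak_homs (\<Phi>, X, S) (\<Psi>, Y, S')" "x \<in> S"
  shows "return_time \<Psi> S' (h x) = \<tau> (x, return_time \<Phi> S x)"
    and "h (poincare_map \<Phi> S x) = poincare_map \<Psi> S' (h x)"
  using assms(3,4) weak_morphism_return[OF assms(1,2), of h \<tau> x] by (simp_all add: weak_homs_iff)

lemma rate_preserving_iff:
  assumes "section_flow X \<Phi> S" "section_flow Y \<Psi> S'"
  shows "rate_preserving (\<Phi>, X, S) (\<Psi>, Y, S') (h, \<sigma>) \<longleftrightarrow>
    (\<forall>x\<in>S. \<forall>t s. 0 \<le> t \<and> t < 1 \<longrightarrow>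
       \<sigma> (\<Phi> (x, t * return_time \<Phi> S x),
          section_flow.hit \<Phi> S x (s + t) - t * return_time \<Phi> S x) =
       section_flow.hit \<Psi> S' (h x) (s + t) - t * return_time \<Psi> S' (h x))"
  by (simp add: rate_preserving_def section_flow.integral_rate[OF assms(1)]
      section_flow.integral_rate[OF assms(2)])

text \<open>This is the instance \<open>t = 0\<close> of the definition.\<close>

lemma rate_preserving_section:
  assumes "section_flow X \<Phi> S" "section_flow Y \<Psi> S'"
    and "rate_preserving (\<Phi>, X, S) (\<Psi>, Y, S') (h, \<sigma>)" "x \<in> S"
  shows "\<sigma> (x, section_flow.hit \<Phi> S x s) = section_flow.hit \<Psi> S' (h x) s"
proof -
  interpret A: section_flow X \<Phi> S by fact
  have "\<sigma> (\<Phi> (x, 0 * A.T x), A.hit x (s + 0) - 0 * A.T x) =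
      section_flow.hit \<Psi> S' (h x) (s + 0) - 0 * return_time \<Psi> S' (h x)"
    using assms(3)[unfolded rate_preserving_iff[OF assms(1,2)], rule_format, OF assms(4), of 0 s]
    by simp
  then show ?thesis using A.flow_0[OF A.in_space[OF assms(4)]] by simp
qed

text \<open>A morphism of flows preserves return times, hence also rates.\<close>

lemma flow_homs_rate_preserving:
  assumes A: "(\<Phi>, X, S) \<in> flow_objs" and B: "(\<Psi>, Y, S') \<in> flow_objs"
    and h: "h \<in> flow_homs (\<Phi>, X, S) (\<Psi>, Y, S')"
  defines "\<tau> \<equiv> \<lambda>(x, t)\<in>topspace X \<times> UNIV. t"
  shows "(h, \<tau>) \<in> homs RWFlowGS (\<Phi>, X, S) (\<Psi>, Y, S')"
proof -
  interpret A: section_flow X \<Phi> S using A by (rule flow_objs_section_flow)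
  interpret B: section_flow Y \<Psi> S' using B by (rule flow_objs_section_flow)
  have id: "\<tau> (x, t) = t" if "x \<in> topspace X" for x t using that by (simp add: \<tau>_def)
  have "homeomorphic_map euclideanreal euclideanreal (\<lambda>t. t)"
    by (intro strict_mono_surj_homeomorphic_map strict_monoI) auto
  moreover have "strict_mono (\<lambda>t::real. t)" by (simp add: strict_mono_def)
  moreover have "\<tau> \<in> extensional (topspace X \<times> UNIV)" by (simp add: \<tau>_def)
  ultimately have weak: "(h, \<tau>) \<in> weak_homs (\<Phi>, X, S) (\<Psi>, Y, S')"
    using h by (simp add: flow_homs_def weak_homs_iff id)
  note hS = weak_homs_section[OF weak]
  note ret = weak_homs_return[OF A.section_flow_axioms B.section_flow_axioms weak]
  have T: "B.T (h x) = A.T x" if "x \<in> S" for x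
    using ret(1)[OF that] id A.in_space[OF that] by simp
  have "B.iter i (h x) = h (A.iter i x)" if "x \<in> S" for x i
    using int_iter_semiconj[where h = h, OF A.poincare_bij B.poincare_bij hS ret(2) that] by simp
  then have hit: "B.hit (h x) v = A.hit x v" if "x \<in> S" for x v
    using that T A.iter_in by (simp add: A.hit_def B.hit_def)
  have "rate_preserving (\<Phi>, X, S) (\<Psi>, Y, S') (h, \<tau>)"
    unfolding rate_preserving_iff[OF A.section_flow_axioms B.section_flow_axioms]
    using A.flow_in[OF A.in_space] T hit by (simp add: id)
  then show ?thesis using weak by (simp add: RWFlowGS_def)
qed

text \<open>The condition on the second morphism can be applied because the first one maps the point at
  the fraction \<open>t\<close> of a return to the point at the same fraction of the return of the image.\<close>

lemma rate_preserving_comp: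
  assumes "section_flow X \<Phi> S" "section_flow Y \<Psi> S'" "section_flow Z \<Xi> S''"
    and h: "(h, \<sigma>) \<in> weak_homs (\<Phi>, X, S) (\<Psi>, Y, S')" "rate_preserving (\<Phi>, X, S) (\<Psi>, Y, S') (h, \<sigma>)"
    and k: "(k, \<tau>) \<in> weak_homs (\<Psi>, Y, S') (\<Xi>, Z, S'')" "rate_preserving (\<Psi>, Y, S') (\<Xi>, Z, S'') (k, \<tau>)"
  shows "rate_preserving (\<Phi>, X, S) (\<Xi>, Z, S'')
    (weak_comp (\<Phi>, X, S) (\<Psi>, Y, S') (\<Xi>, Z, S'') (k, \<tau>) (h, \<sigma>))"
proof -
  interpret A: section_flow X \<Phi> S by fact
  interpret B: section_flow Y \<Psi> S' by fact
  interpret C: section_flow Z \<Xi> S'' by fact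
  note hS = weak_homs_section[OF h(1)] and kS = weak_homs_section[OF k(1)]
  note rh = h(2)[unfolded rate_preserving_iff[OF assms(1,2)], rule_format]
  note rk = k(2)[unfolded rate_preserving_iff[OF assms(2,3)], rule_format]
  show ?thesis
    unfolding weak_comp_def prod.case
      rate_preserving_iff[OF assms(1,3)]
  proof (intro ballI allI impI)
    fix x and t s :: real assume x: "x \<in> S" and t: "0 \<le> t \<and> t < 1"
    have in1: "\<Phi> (x, t * A.T x) \<in> topspace X" by (intro A.flow_in A.in_space x)
    have "\<sigma> (x, A.hit x t) = B.hit (h x) t"
      by (rule rate_preserving_section[OF assms(1,2) h(2) x])
    then have "\<sigma> (x, t * A.T x) = t * B.T (h x)" using t by (simp add: A.hit_unit B.hit_unit)
    then have "h (\<Phi> (x, t * A.T x)) = \<Psi> (h x, t * B.T (h x))"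
      using h(1) A.in_space[OF x] by (simp add: weak_homs_iff)
    then show "(\<lambda>(x, t)\<in>topspace X \<times> UNIV. \<tau> (h x, \<sigma> (x, t)))
        (\<Phi> (x, t * A.T x), A.hit x (s + t) - t * A.T x) =
        C.hit (compose (topspace X) k h x) (s + t) - t * C.T (compose (topspace X) k h x)"
      using rh[OF x t, of s] rk[OF hS[OF x] t, of s] in1 A.in_space[OF x] by (simp add: compose_def)
  qed
qed

lemma weak_homs_comp:
  assumes "section_flow X \<Phi> S"
    and h: "(h, \<sigma>) \<in> weak_homs (\<Phi>, X, S) (\<Psi>, Y, S')"
    and k: "(k, \<tau>) \<in> weak_homs (\<Psi>, Y, S') (\<Xi>, Z, S'')"
  shows "weak_comp (\<Phi>, X, S) (\<Psi>, Y, S') (\<Xi>, Z, S'') (k, \<tau>) (h, \<sigma>) \<in> weak_homs (\<Phi>, X, S) (\<Xi>, Z, S'')"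
  unfolding weak_comp_def prod.case weak_homs_iff
proof (intro conjI ballI allI)
  interpret A: section_flow X \<Phi> S by fact
  show "compose (topspace X) k h \<in> extensional (topspace X)" by simp
  show "(\<lambda>(x, t)\<in>topspace X \<times> UNIV. \<tau> (h x, \<sigma> (x, t))) \<in> extensional (topspace X \<times> UNIV)" by simp
  show "continuous_map X Z (compose (topspace X) k h)"
    by (rule continuous_map_eq[OF continuous_map_compose[OF weak_homs_cont[OF h] weak_homs_cont[OF k]]])
      (simp add: compose_def)
  have "S = {x \<in> topspace X. h x \<in> S'}" "S' = {y \<in> topspace Y. k y \<in> S''}"
    using h k by (auto simp: weak_homs_iff)
  then show "S = {x \<in> topspace X. compose (topspace X) k h x \<in> S''}"
    using weak_homs_in[OF h] by (auto simp: compose_def)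
  fix x assume x: "x \<in> topspace X"
  note hx = weak_homs_in[OF h x]
  have \<sigma>: "strict_mono (\<lambda>t. \<sigma> (x, t))" "homeomorphic_map euclideanreal euclideanreal (\<lambda>t. \<sigma> (x, t))" "\<sigma> (x, 0) = 0"
    and \<tau>: "strict_mono (\<lambda>t. \<tau> (h x, t))" "homeomorphic_map euclideanreal euclideanreal (\<lambda>t. \<tau> (h x, t))" "\<tau> (h x, 0) = 0"
    using h k x hx by (simp_all add: weak_homs_iff)
  show "compose (topspace X) k h (\<Phi> (x, t)) =
      \<Xi> (compose (topspace X) k h x, (\<lambda>(x, t)\<in>topspace X \<times> UNIV. \<tau> (h x, \<sigma> (x, t))) (x, t))" for t
    using h k x hx A.flow_in[OF x, of t] by (simp add: compose_def weak_homs_iff)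
  show "strict_mono (\<lambda>t. (\<lambda>(x, t)\<in>topspace X \<times> UNIV. \<tau> (h x, \<sigma> (x, t))) (x, t))"
    using \<sigma>(1) \<tau>(1) x by (simp add: strict_mono_def)
  show "homeomorphic_map euclideanreal euclideanreal (\<lambda>t. (\<lambda>(x, t)\<in>topspace X \<times> UNIV. \<tau> (h x, \<sigma> (x, t))) (x, t))"
    using homeomorphic_map_compose[OF \<sigma>(2) \<tau>(2)] x by (simp add: o_def)
  show "(\<lambda>(x, t)\<in>topspace X \<times> UNIV. \<tau> (h x, \<sigma> (x, t))) (x, 0) = 0"
    using \<sigma>(3) \<tau>(3) x by simp
qed

lemma RWFlowGS_simps:
  "objs RWFlowGS = flow_objs" "ident RWFlowGS = weak_ident" "cmp RWFlowGS = weak_comp"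
  "k \<in> homs RWFlowGS A B \<longleftrightarrow> k \<in> weak_homs A B \<and> rate_preserving A B k"
  by (simp_all add: RWFlowGS_def)

lemma weak_comp_assoc:
  assumes "(h, \<sigma>) \<in> weak_homs (\<Phi>, X, S) (\<Psi>, Y, S')"
  shows "weak_comp (\<Phi>, X, S) C D k2 (weak_comp (\<Phi>, X, S) (\<Psi>, Y, S') C k1 (h, \<sigma>)) =
    weak_comp (\<Phi>, X, S) (\<Psi>, Y, S') D (weak_comp (\<Psi>, Y, S') C D k2 k1) (h, \<sigma>)"
proof -
  have "h \<in> topspace X \<rightarrow> topspace Y" using weak_homs_in[OF assms] by blast
  then show ?thesis
    by (cases k1; cases k2) (auto simp: weak_comp_def compose_assoc restrict_def fun_eq_iff compose_def)
qed

lemma is_category_RWFlowGS: "is_category (RWFlowGS :: ('u flow_obj, 'u weak_arr) cat)"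
  unfolding is_category_def RWFlowGS_simps
proof (intro conjI ballI)
  fix A :: "'u flow_obj" assume A: "A \<in> flow_objs"
  obtain \<Phi> X S where A_eq: "A = (\<Phi>, X, S)" by (cases A)
  interpret A: section_flow X \<Phi> S using A unfolding A_eq by (rule flow_objs_section_flow)
  have "(\<lambda>x\<in>topspace X. x) \<in> flow_homs A A"
    unfolding A_eq flow_homs_def prod.case using A.flow_in A.in_space
    by (auto intro: continuous_map_eq[OF continuous_map_id])
  from flow_homs_rate_preserving[OF A[unfolded A_eq] A[unfolded A_eq] this[unfolded A_eq]]
  have "weak_ident A \<in> homs RWFlowGS A A" unfolding A_eq weak_ident_def prod.case .
  then show "weak_ident A \<in> weak_homs A A" "rate_preserving A A (weak_ident A)"
    by (simp_all add: RWFlowGS_simps)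
next
  fix A B C :: "'u flow_obj" and h k :: "'u weak_arr"
  assume ABC: "A \<in> flow_objs" "B \<in> flow_objs" "C \<in> flow_objs"
    and h: "h \<in> homs RWFlowGS A B" and k: "k \<in> homs RWFlowGS B C"
  obtain \<Phi> X S where A: "A = (\<Phi>, X, S)" by (cases A)
  obtain \<Psi> Y S' where B: "B = (\<Psi>, Y, S')" by (cases B)
  obtain \<Xi> Z S'' where C: "C = (\<Xi>, Z, S'')" by (cases C)
  obtain h1 \<sigma> where h1: "h = (h1, \<sigma>)" by (cases h)
  obtain k1 \<tau> where k1: "k = (k1, \<tau>)" by (cases k)
  note s = ABC[unfolded A B C, THEN flow_objs_section_flow]
  show "weak_comp A B C k h \<in> weak_homs A C" "rate_preserving A C (weak_comp A B C k h)"
    using h k rate_preserving_comp[OF s] weak_homs_comp[OF s(1)]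
    unfolding A B C h1 k1 RWFlowGS_simps by blast+
next
  fix A B :: "'u flow_obj" and h :: "'u weak_arr"
  assume h: "h \<in> homs RWFlowGS A B"
  obtain \<Phi> X S where A: "A = (\<Phi>, X, S)" by (cases A)
  obtain \<Psi> Y S' where B: "B = (\<Psi>, Y, S')" by (cases B)
  obtain h1 \<sigma> where h1: "h = (h1, \<sigma>)" by (cases h)
  have w: "(h1, \<sigma>) \<in> weak_homs (\<Phi>, X, S) (\<Psi>, Y, S')"
    using h by (simp add: RWFlowGS_simps A B h1)
  have in': "h1 \<in> topspace X \<rightarrow> topspace Y" using weak_homs_in[OF w] by blast
  have ext: "h1 \<in> extensional (topspace X)" "\<sigma> \<in> extensional (topspace X \<times> UNIV)"
    using w by (simp_all add: weak_homs_iff)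
  show "weak_comp A A B h (weak_ident A) = h"
    unfolding A B h1 weak_comp_def weak_ident_def prod.case
    using compose_Id[OF in' ext(1)] ext(2) by (auto simp: fun_eq_iff restrict_def extensional_def)
  show "weak_comp A B B (weak_ident B) h = h"
    unfolding A B h1 weak_comp_def weak_ident_def prod.case
    using Id_compose[OF in' ext(1)] ext(2) in' by (auto simp: fun_eq_iff restrict_def extensional_def)
next
  fix A B C D :: "'u flow_obj" and h k1 k2 :: "'u weak_arr"
  assume h: "h \<in> homs RWFlowGS A B"
  obtain \<Phi> X S where A: "A = (\<Phi>, X, S)" by (cases A)
  obtain \<Psi> Y S' where B: "B = (\<Psi>, Y, S')" by (cases B)
  obtain h1 \<sigma> where h1: "h = (h1, \<sigma>)" by (cases h)
  show "weak_comp A C D k2 (weak_comp A B C k1 h) = weak_comp A B D (weak_comp B C D k2 k1) h"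
    unfolding A B h1 using h by (intro weak_comp_assoc) (simp add: RWFlowGS_simps A B h1)
qed

section \<open>The functors\<close>

lemma Poincare_obj:
  assumes "(\<Phi>, X, S) \<in> flow_objs"
  shows "(poincare_map \<Phi> S, subtopology X S) \<in> map_objs"
proof -
  interpret A: section_flow X \<Phi> S using assms by (rule flow_objs_section_flow)
  have "top_manifold (subtopology X S)"
    using assms by (auto simp: flow_objs_def global_section_def transversal_def transversal_dim_def top_manifold_def)
  moreover have "topspace (subtopology X S) = S"
    using closedin_subset[OF A.closed] by auto
  ultimately show ?thesis
    using A.homeomorphic_map_poincare by (simp add: map_objs_def poincare_map_def)
qed

lemma is_functor_Poincare:
  "is_functor RWFlowGS MapCat (Poincare \<circ>\<^sub>F Jplus :: ('u flow_obj, 'u weak_arr, 'u map_obj, 'u \<Rightarrow> 'u) func)"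
  (is "is_functor _ _ ?R")
proof -
  have om: "omap ?R (\<Phi>, X, S) = (poincare_map \<Phi> S, subtopology X S)" for \<Phi> :: "'u \<times> real \<Rightarrow> 'u" and X S
    by (simp add: fcomp_def Poincare_def Jplus_def)
  have am: "amap ?R (\<Phi>, X, S) B (h, \<tau>) = restrict h S" for \<Phi> :: "'u \<times> real \<Rightarrow> 'u" and X S B h \<tau>
    by (simp add: fcomp_def Poincare_def Jplus_def)
  have top: "topspace (subtopology X S) = S" if "(\<Phi>, X, S) \<in> flow_objs" for \<Phi> :: "'u \<times> real \<Rightarrow> 'u" and X S
    using closedin_subset[OF section_flow.closed[OF flow_objs_section_flow[OF that]]] by auto
  show ?thesis
    unfolding is_functor_def
  proof (intro conjI ballI)
    show "is_category (RWFlowGS :: ('u flow_obj, 'u weak_arr) cat)" by (rule is_category_RWFlowGS)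
    show "is_category (MapCat :: ('u map_obj, 'u \<Rightarrow> 'u) cat)" by (rule is_category_MapCat)
    show "src ?R = RWFlowGS" "tgt ?R = MapCat" by (simp_all add: fcomp_def Poincare_def Jplus_def)
  next
    fix A :: "'u flow_obj" assume A: "A \<in> objs RWFlowGS"
    obtain \<Phi> X S where A_eq: "A = (\<Phi>, X, S)" by (cases A)
    have o: "(\<Phi>, X, S) \<in> flow_objs" using A by (simp add: A_eq RWFlowGS_simps)
    show "omap ?R A \<in> objs MapCat"
      using Poincare_obj[OF o] by (simp add: A_eq om MapCat_def)
    have "S \<subseteq> topspace X" using top[OF o] by auto
    then show "amap ?R A A (ident RWFlowGS A) = ident MapCat (omap ?R A)"
      using top[OF o] by (auto simp: A_eq om am RWFlowGS_simps weak_ident_def MapCat_def restrict_def fun_eq_iff)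
  next
    fix A B :: "'u flow_obj" and h :: "'u weak_arr"
    assume AB: "A \<in> objs RWFlowGS" "B \<in> objs RWFlowGS" and h: "h \<in> homs RWFlowGS A B"
    obtain \<Phi> X S where A: "A = (\<Phi>, X, S)" by (cases A)
    obtain \<Psi> Y S' where B: "B = (\<Psi>, Y, S')" by (cases B)
    obtain h1 \<sigma> where h1: "h = (h1, \<sigma>)" by (cases h)
    have o: "(\<Phi>, X, S) \<in> flow_objs" "(\<Psi>, Y, S') \<in> flow_objs" using AB by (simp_all add: A B RWFlowGS_simps)
    interpret A: section_flow X \<Phi> S using o(1) by (rule flow_objs_section_flow)
    have w: "(h1, \<sigma>) \<in> weak_homs (\<Phi>, X, S) (\<Psi>, Y, S')" using h by (simp add: RWFlowGS_simps A B h1)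
    have "continuous_map (subtopology X S) Y (restrict h1 S)"
      by (rule continuous_map_eq[OF continuous_map_from_subtopology[OF weak_homs_cont[OF w]]]) auto
    then have "continuous_map (subtopology X S) (subtopology Y S') (restrict h1 S)"
      using weak_homs_section[OF w] by (auto simp: continuous_map_in_subtopology)
    then show "amap ?R A B h \<in> homs MapCat (omap ?R A) (omap ?R B)"
      using weak_homs_return(2)[OF o[THEN flow_objs_section_flow] w] A.poincare_map_in top[OF o(1)]
      by (auto simp: A B h1 om am MapCat_def map_homs_def simp del: topspace_subtopology)
  next
    fix A B C :: "'u flow_obj" and h k :: "'u weak_arr"
    assume AB: "A \<in> objs RWFlowGS" "B \<in> objs RWFlowGS" and h: "h \<in> homs RWFlowGS A B"
    obtain \<Phi> X S where A: "A = (\<Phi>, X, S)" by (cases A)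
    obtain \<Psi> Y S' where B: "B = (\<Psi>, Y, S')" by (cases B)
    obtain \<Xi> Z S'' where C: "C = (\<Xi>, Z, S'')" by (cases C)
    obtain h1 \<sigma> where h1: "h = (h1, \<sigma>)" by (cases h)
    obtain k1 \<tau> where k1: "k = (k1, \<tau>)" by (cases k)
    have o: "(\<Phi>, X, S) \<in> flow_objs" using AB by (simp_all add: A B RWFlowGS_simps)
    have w: "(h1, \<sigma>) \<in> weak_homs (\<Phi>, X, S) (\<Psi>, Y, S')" using h by (simp add: RWFlowGS_simps A B h1)
    have "S \<subseteq> topspace X" using top[OF o] by auto
    then show "amap ?R A C (cmp RWFlowGS A B C k h) =
        cmp MapCat (omap ?R A) (omap ?R B) (omap ?R C) (amap ?R B C k) (amap ?R A B h)"
      using top[OF o] weak_homs_section[OF w]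
      by (auto simp: A B C h1 k1 om am RWFlowGS_simps weak_comp_def MapCat_def compose_def restrict_def fun_eq_iff)
  qed
qed

text \<open>The map induced on mapping tori is covered by \<open>h \<times> id\<close> on \<open>X \<times> \<real>\<close>, which commutes with
  translations and preserves \<open>X \<times> \<int>\<close>.\<close>

lemma Suspension_arrow:
  assumes code: "inj code" and A: "(f, X) \<in> map_objs" and B: "(g, Y) \<in> map_objs"
    and h: "h \<in> map_homs (f, X) (g, Y)"
  defines "H \<equiv> amap (Suspension code) (f, X) (g, Y) h"
  shows "\<And>x s. x \<in> topspace X \<Longrightarrow> H (suspension.cov code f X (x, s)) = suspension.cov code g Y (h x, s)"
    and "\<And>x. x \<in> topspace X \<Longrightarrow> H (torus_pt code f X (x, 0)) = torus_pt code g Y (h x, 0)"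
    and "H \<in> flow_homs (omap (Suspension code) (f, X)) (omap (Suspension code) (g, Y))"
proof -
  interpret F: suspension code f X using code A by unfold_locales (auto simp: map_objs_def)
  interpret G: suspension code g Y using code B by unfold_locales (auto simp: map_objs_def)
  have hc: "continuous_map X Y h" and hf: "\<And>x. x \<in> topspace X \<Longrightarrow> h (f x) = g (h x)"
    using h by (auto simp: map_homs_def)
  have hin: "x \<in> topspace X \<Longrightarrow> h x \<in> topspace Y" for x
    using continuous_map_funspace[OF hc] by blast
  have H: "H (F.q (x, t)) = G.q (h x, t)" if "x \<in> topspace X" "0 \<le> t" "t < 1" for x t
    using that F.q_in[of x t] F.torus_coord_q[of x t] by (simp add: H_def Suspension_def)
  then show "H (F.q (x, 0)) = G.q (h x, 0)" if "x \<in> topspace X" for x using that by simp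
  show Hcov: "H (F.cov (x, s)) = G.cov (h x, s)" if x: "x \<in> topspace X" for x s
    using H[OF F.iter_in[OF x] F.floor_frac, of "\<lfloor>s\<rfloor>" s] int_iter_semiconj[where h = h, OF F.bij G.bij hin hf x]
    by (simp add: F.cov_def G.cov_def)
  have "continuous_map F.M G.M H"
  proof (rule continuous_compose_quotient_map[OF F.quotient_cov])
    have "continuous_map (prod_topology X euclideanreal) (prod_topology Y euclideanreal) (\<lambda>p. (h (fst p), snd p))"
      using continuous_map_compose[OF continuous_map_fst hc]
      by (intro continuous_map_pairedI continuous_map_snd) (simp add: o_def)
    from continuous_map_compose[OF this G.continuous_map_cov]
    show "continuous_map (prod_topology X euclideanreal) G.M (H \<circ> F.cov)"
      by (rule continuous_map_eq) (auto simp: Hcov)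
  qed
  moreover have "H (F.sus (p, t)) = G.sus (H p, t)" if p: "p \<in> topspace F.M" for p t
  proof -
    obtain x s where "x \<in> topspace X" "p = F.cov (x, s)" using p by (rule F.torus_cases)
    then show ?thesis by (simp add: F.suspension_flow_cov G.suspension_flow_cov Hcov hin)
  qed
  moreover have "p \<in> F.base \<longleftrightarrow> H p \<in> G.base" if p: "p \<in> topspace F.M" for p
  proof -
    obtain x s where "x \<in> topspace X" "p = F.cov (x, s)" using p by (rule F.torus_cases)
    then show ?thesis by (simp add: F.cov_in_base_iff G.cov_in_base_iff Hcov hin)
  qed
  then have "F.base = {p \<in> topspace F.M. H p \<in> G.base}"
    using closedin_subset[OF F.closedin_base] by blast
  moreover have "H \<in> extensional (topspace F.M)" by (simp add: H_def Suspension_def)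
  ultimately show "H \<in> flow_homs (omap (Suspension code) (f, X)) (omap (Suspension code) (g, Y))"
    unfolding F.base_def G.base_def by (simp add: Suspension_def flow_homs_def)
qed

lemma Suspension_obj:
  assumes "inj code" "(f, X) \<in> map_objs"
  shows "omap (Suspension code) (f, X) \<in> flow_objs"
proof -
  interpret F: suspension code f X using assms by unfold_locales (auto simp: map_objs_def)
  show ?thesis
    using F.suspension_in_flow_objs assms(2) unfolding F.base_def by (simp add: Suspension_def map_objs_def)
qed

lemma is_functor_Suspension:
  fixes code :: "'u \<times> real \<Rightarrow> 'u"
  assumes code: "inj code"
  shows "is_functor MapCat RWFlowGS (Jminus \<circ>\<^sub>F Suspension code)" (is "is_functor _ _ ?L")
proof -
  have om: "omap ?L A = omap (Suspension code) A" for A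
    by (simp add: fcomp_def Jminus_def)
  have am: "amap ?L (f, X) B h = (amap (Suspension code) (f, X) B h,
      \<lambda>(p, t)\<in>topspace (torus code f X) \<times> UNIV. t)" for f X B h
    by (simp add: fcomp_def Jminus_def Suspension_def case_prod_unfold)
  have ext: "amap (Suspension code) (f, X) B h \<in> extensional (topspace (torus code f X))" for f X B h
    by (simp add: Suspension_def case_prod_unfold)
  show ?thesis
    unfolding is_functor_def
  proof (intro conjI ballI)
    show "is_category (RWFlowGS :: ('u flow_obj, 'u weak_arr) cat)" by (rule is_category_RWFlowGS)
    show "is_category (MapCat :: ('u map_obj, 'u \<Rightarrow> 'u) cat)" by (rule is_category_MapCat)
    show "src ?L = MapCat" "tgt ?L = RWFlowGS" by (simp_all add: fcomp_def Suspension_def Jminus_def)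
  next
    fix A :: "'u map_obj" assume A: "A \<in> objs MapCat"
    obtain f X where A_eq: "A = (f, X)" by (cases A)
    have o: "(f, X) \<in> map_objs" using A by (simp add: A_eq MapCat_def)
    show "omap ?L A \<in> objs RWFlowGS"
      using Suspension_obj[OF code o] by (simp add: A_eq om RWFlowGS_simps)
    interpret F: suspension code f X using code o by unfold_locales (auto simp: map_objs_def)
    have i: "(\<lambda>x\<in>topspace X. x) \<in> map_homs (f, X) (f, X)"
      using is_category_MapCat A unfolding is_category_def by (auto simp: A_eq MapCat_def)
    have "amap (Suspension code) (f, X) (f, X) (\<lambda>x\<in>topspace X. x) = (\<lambda>p\<in>topspace F.M. p)"
    proof (rule extensionalityI[OF ext])
      fix p assume p: "p \<in> topspace F.M"
      then obtain x s where "x \<in> topspace X" "p = F.cov (x, s)" by (rule F.torus_cases)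
      then show "amap (Suspension code) (f, X) (f, X) (\<lambda>x\<in>topspace X. x) p = (\<lambda>p\<in>topspace F.M. p) p"
        using Suspension_arrow(1)[OF code o o i] p by simp
    qed simp
    then show "amap ?L A A (ident MapCat A) = ident RWFlowGS (omap ?L A)"
      by (simp add: A_eq om am RWFlowGS_simps MapCat_def weak_ident_def) (simp add: Suspension_def)
  next
    fix A B :: "'u map_obj" and h
    assume AB: "A \<in> objs MapCat" "B \<in> objs MapCat" and h: "h \<in> homs MapCat A B"
    obtain f X where A: "A = (f, X)" by (cases A)
    obtain g Y where B: "B = (g, Y)" by (cases B)
    have o: "(f, X) \<in> map_objs" "(g, Y) \<in> map_objs" and h': "h \<in> map_homs (f, X) (g, Y)"
      using AB h by (simp_all add: A B MapCat_def)
    obtain \<Phi> S where SA: "omap (Suspension code) (f, X) = (\<Phi>, torus code f X, S)" by (simp add: Suspension_def)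
    obtain \<Psi> Y' S' where SB: "omap (Suspension code) (g, Y) = (\<Psi>, Y', S')" by (metis prod_cases3)
    show "amap ?L A B h \<in> homs RWFlowGS (omap ?L A) (omap ?L B)"
      unfolding A B om am SA SB
      by (rule flow_homs_rate_preserving[OF Suspension_obj[OF code o(1), unfolded SA]
            Suspension_obj[OF code o(2), unfolded SB] Suspension_arrow(3)[OF code o h', unfolded SA SB]])
  next
    fix A B C :: "'u map_obj" and h k
    assume ABC: "A \<in> objs MapCat" "B \<in> objs MapCat" "C \<in> objs MapCat"
      and h: "h \<in> homs MapCat A B" and k: "k \<in> homs MapCat B C"
    obtain f X where A: "A = (f, X)" by (cases A)
    obtain g Y where B: "B = (g, Y)" by (cases B)
    obtain e Z where C: "C = (e, Z)" by (cases C)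
    have o: "(f, X) \<in> map_objs" "(g, Y) \<in> map_objs" "(e, Z) \<in> map_objs"
      and h': "h \<in> map_homs (f, X) (g, Y)" and k': "k \<in> map_homs (g, Y) (e, Z)"
      using ABC h k by (simp_all add: A B C MapCat_def)
    have kh: "compose (topspace X) k h \<in> map_homs (f, X) (e, Z)"
      using o(1) h' k' by (rule map_homs_compose)
    interpret F: suspension code f X using code o by unfold_locales (auto simp: map_objs_def)
    interpret G: suspension code g Y using code o by unfold_locales (auto simp: map_objs_def)
    have hin: "x \<in> topspace X \<Longrightarrow> h x \<in> topspace Y" for x
      using h' continuous_map_funspace by (fastforce simp: map_homs_def)
    let ?H = "amap (Suspension code) (f, X) (g, Y) h" and ?K = "amap (Suspension code) (g, Y) (e, Z) k"
    have Hin: "?H p \<in> topspace G.M" if p: "p \<in> topspace F.M" for p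
    proof -
      obtain x s where "x \<in> topspace X" "p = F.cov (x, s)" using p by (rule F.torus_cases)
      then show ?thesis using Suspension_arrow(1)[OF code o(1,2) h'] hin G.cov_in by simp
    qed
    have eq1: "amap (Suspension code) (f, X) (e, Z) (compose (topspace X) k h) = compose (topspace F.M) ?K ?H"
    proof (rule extensionalityI[OF ext])
      fix p assume p: "p \<in> topspace F.M"
      then obtain x s where "x \<in> topspace X" "p = F.cov (x, s)" by (rule F.torus_cases)
      then show "amap (Suspension code) (f, X) (e, Z) (compose (topspace X) k h) p = compose (topspace F.M) ?K ?H p"
        using Suspension_arrow(1)[OF code o(1,3) kh] Suspension_arrow(1)[OF code o(1,2) h']
          Suspension_arrow(1)[OF code o(2,3) k'] p hin by (simp add: compose_eq)
    qed simp
    have eq2: "(\<lambda>(p, t)\<in>topspace F.M \<times> UNIV. t) = (\<lambda>(p, t)\<in>topspace F.M \<times> UNIV.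
        (\<lambda>(p, t)\<in>topspace G.M \<times> UNIV. t) (?H p, (\<lambda>(p, t)\<in>topspace F.M \<times> UNIV. t :: real) (p, t)))"
      using Hin by (auto simp: fun_eq_iff restrict_def)
    have cmp_eq: "cmp MapCat A B C k h = compose (topspace X) k h"
      by (simp add: A B C MapCat_def)
    obtain \<Phi> S where SA: "omap (Suspension code) (f, X) = (\<Phi>, F.M, S)" by (simp add: Suspension_def)
    show "amap ?L A C (cmp MapCat A B C k h) =
        cmp RWFlowGS (omap ?L A) (omap ?L B) (omap ?L C) (amap ?L B C k) (amap ?L A B h)"
      unfolding cmp_eq unfolding A B C om am RWFlowGS_simps SA weak_comp_def prod.case eq1
      by (intro arg_cong2[where f = Pair] refl eq2)
  qed
qed

section \<open>The adjunction\<close>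

locale suspension_target = suspension code f X + tgt: section_flow Y \<Psi> S'
  for code :: "'u \<times> real \<Rightarrow> 'u" and f X and Y :: "'u topology" and \<Psi> S' +
  assumes manifold: "top_manifold X"
begin

sublocale dom: section_flow M sus base
  using suspension_in_flow_objs[OF manifold] by (rule flow_objs_section_flow)

lemma return_time_base': "p \<in> base \<Longrightarrow> dom.T p = 1"
  using return_time_base by (auto simp: base_def)

lemma hit_base: "p \<in> base \<Longrightarrow> dom.hit p v = v"
  using dom.iter_in return_time_base' by (simp add: dom.hit_def step_integral_const_1)

lemma q_in_base: "x \<in> topspace X \<Longrightarrow> q (x, 0) \<in> base"
  by (auto simp: base_def)

lemma suspension_flow_q:
  "x \<in> topspace X \<Longrightarrow> 0 \<le> t \<Longrightarrow> t \<le> 1 \<Longrightarrow> sus (q (x, 0), t) = q (x, t)"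
  using suspension_flow_cov[of x 0 t] cov_unit[of x 0] cov_unit[of x t] by simp

text \<open>On the orbit of \<open>q (x, 0)\<close>, the time part has to turn the time scale of the suspension, on
  which the \<open>n\<close>-th return happens at time \<open>n\<close>, into the piecewise linear function \<open>hit\<close> of the
  target. These orbits fill the mapping torus, so a morphism is determined by its values on the
  section.\<close>

lemma morphism_determined:
  assumes k: "(k, \<sigma>) \<in> weak_homs (sus, M, base) (\<Psi>, Y, S')"
    and rate: "rate_preserving (sus, M, base) (\<Psi>, Y, S') (k, \<sigma>)"
    and x: "x \<in> topspace X" and t: "0 \<le> t" "t < 1"
  shows "\<sigma> (q (x, t), s) = tgt.hit (k (q (x, 0))) (s + t) - t * tgt.T (k (q (x, 0)))"
    and "k (q (x, t)) = \<Psi> (k (q (x, 0)), t * tgt.T (k (q (x, 0))))"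
proof -
  note p = q_in_base[OF x]
  have r: "\<sigma> (q (x, t), s) = tgt.hit (k (q (x, 0))) (s + t) - t * tgt.T (k (q (x, 0)))"
    if t: "0 \<le> t" "t < 1" for s t
    using rate[unfolded rate_preserving_iff[OF dom.section_flow_axioms tgt.section_flow_axioms],
        rule_format, OF p, of t s] t x
    by (simp add: return_time_base'[OF p] hit_base[OF p] suspension_flow_q)
  show "\<sigma> (q (x, t), s) = tgt.hit (k (q (x, 0))) (s + t) - t * tgt.T (k (q (x, 0)))"
    using t by (rule r)
  have "k (sus (q (x, 0), t)) = \<Psi> (k (q (x, 0)), \<sigma> (q (x, 0), t))"
    using k q_in[OF x, of 0] by (simp add: weak_homs_iff)
  then show "k (q (x, t)) = \<Psi> (k (q (x, 0)), t * tgt.T (k (q (x, 0))))"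
    using r[of 0 t] t x by (simp add: suspension_flow_q tgt.hit_unit)
qed

text \<open>The inverse of restriction to the section; the formulas are forced by \<open>morphism_determined\<close>.\<close>

definition lift :: "('u \<Rightarrow> 'u) \<Rightarrow> 'u weak_arr" where
  "lift g = (\<lambda>p\<in>topspace M. let (x, t) = torus_coord code f X p in \<Psi> (g x, t * tgt.T (g x)),
     \<lambda>(p, s)\<in>topspace M \<times> UNIV. let (x, t) = torus_coord code f X p
       in tgt.hit (g x) (s + t) - t * tgt.T (g x))"

context
  fixes g
  assumes g: "continuous_map X (subtopology Y S') g"
    and gf: "\<And>x. x \<in> topspace X \<Longrightarrow> g (f x) = tgt.P (g x)"
begin

lemma g_in: "x \<in> topspace X \<Longrightarrow> g x \<in> S'"
  using g by (auto simp: continuous_map_in_subtopology)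

lemma g_in_space: "x \<in> topspace X \<Longrightarrow> g x \<in> topspace Y"
  using g_in tgt.in_space by blast

lemma lift_q:
  assumes "x \<in> topspace X" "0 \<le> t" "t < 1"
  shows "fst (lift g) (q (x, t)) = \<Psi> (g x, t * tgt.T (g x))"
    and "snd (lift g) (q (x, t), s) = tgt.hit (g x) (s + t) - t * tgt.T (g x)"
  using assms q_in[of x t] torus_coord_q[of x t] by (simp_all add: lift_def)

text \<open>The factor \<open>t T\<close> interpolates between consecutive returns, and \<open>g\<close> maps the \<open>n\<close>-th iterate of
  \<open>f\<close> to the \<open>n\<close>-th return.\<close>

lemma lift_cov:
  assumes x: "x \<in> topspace X"
  shows "fst (lift g) (cov (x, s)) = \<Psi> (g x, tgt.hit (g x) s)"
proof -
  have "g (iter n x) = tgt.iter n (g x)" for n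
    using int_iter_semiconj[where h = g, OF bij tgt.poincare_bij g_in gf x] by simp
  then show ?thesis
    using lift_q(1)[OF iter_in[OF x] floor_frac, of "\<lfloor>s\<rfloor>" s] tgt.hit_flow[OF g_in[OF x], of s]
    by (simp add: cov_def)
qed

text \<open>On \<open>X \<times> [0, 1]\<close> the map is given by one continuous formula, including \<open>t = 1\<close>, where
  \<open>g \<circ> f = P \<circ> g\<close>
  is used.\<close>

lemma lift_continuous: "continuous_map M Y (fst (lift g))"
proof (rule continuous_compose_quotient_map[OF quotient_q])
  have gY: "continuous_map X Y g" using g by (simp add: continuous_map_in_subtopology)
  have T: "continuous_map X euclideanreal (\<lambda>x. tgt.T (g x))"
    using continuous_map_compose[OF g tgt.continuous_map_return_time] by (simp add: o_def)
  have "continuous_map (prod_topology X (top_of_set {0..1})) euclideanreal snd"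
    using continuous_map_snd continuous_map_in_subtopology by blast
  then have "continuous_map (prod_topology X (top_of_set {0..1})) (prod_topology Y euclideanreal)
      (\<lambda>p. (g (fst p), snd p * tgt.T (g (fst p))))"
    using continuous_map_compose[OF continuous_map_fst gY] continuous_map_compose[OF continuous_map_fst T]
    by (intro continuous_map_pairedI continuous_map_real_mult) (simp_all add: o_def)
  from continuous_map_compose[OF this tgt.cont]
  show "continuous_map (prod_topology X (top_of_set {0..1})) Y (fst (lift g) \<circ> q)"
  proof (rule continuous_map_eq)
    fix p assume "p \<in> topspace (prod_topology X (top_of_set {0..1::real}))"
    then obtain x t where p: "p = (x, t)" "x \<in> topspace X" "0 \<le> t" "t \<le> 1" by auto
    then show "(\<Psi> \<circ> (\<lambda>p. (g (fst p), snd p * tgt.T (g (fst p))))) p = (fst (lift g) \<circ> q) p"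
      using lift_cov[OF p(2), of t] cov_unit[OF p(2-4)] by (simp add: tgt.hit_unit)
  qed
qed

text \<open>The orbit of \<open>[x, t]\<close> is that of \<open>[x, 0]\<close> with times shifted by \<open>t\<close>; in the target the shift
  becomes \<open>hit (g x) t\<close>, which is \<open>t T (g x)\<close>. A fraction \<open>0 < t < 1\<close> of a return is not a return,
  so only the points \<open>[x, 0]\<close> are mapped into the section.\<close>

lemma lift_in_homs: "lift g \<in> homs RWFlowGS (sus, M, base) (\<Psi>, Y, S')"
proof -
  obtain k \<sigma> where l: "lift g = (k, \<sigma>)" by (cases "lift g")
  note kq = lift_q(1)[unfolded l fst_conv] and \<sigma>q = lift_q(2)[unfolded l snd_conv]
    and kcov = lift_cov[unfolded l fst_conv]
  have weak: "(k, \<sigma>) \<in> weak_homs (sus, M, base) (\<Psi>, Y, S')"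
    unfolding weak_homs_iff
  proof (intro conjI ballI allI)
    show "k \<in> extensional (topspace M)" "\<sigma> \<in> extensional (topspace M \<times> UNIV)"
      using l by (auto simp: lift_def)
    show "continuous_map M Y k" using lift_continuous l by simp
    have "p \<in> base \<longleftrightarrow> k p \<in> S'" if p: "p \<in> topspace M" for p
    proof -
      obtain x t where x: "x \<in> topspace X" "0 \<le> t" "t < 1" "p = q (x, t)" "p = cov (x, t)"
        using p by (rule torus_cases)
      have "t \<in> \<int> \<longleftrightarrow> t = 0" using x(2,3) by (auto elim!: Ints_cases)
      then have "p \<in> base \<longleftrightarrow> t = 0" using cov_in_base_iff[OF x(1), of t] x(5) by simp
      moreover have "k p \<in> S' \<longleftrightarrow> t = 0"
      proof (cases "t = 0")
        case True
        then show ?thesis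
          using kq[OF x(1-3)] x(4) tgt.flow_0[OF g_in_space[OF x(1)]] g_in[OF x(1)] by simp
      next
        case False
        then have "0 < t * tgt.T (g x)" "t * tgt.T (g x) < tgt.T (g x)"
          using x(2,3) tgt.return_time_pos[OF g_in[OF x(1)]] by simp_all
        then have "\<Psi> (g x, t * tgt.T (g x)) \<notin> S'" by (rule tgt.return_time_first[OF g_in[OF x(1)]])
        then show ?thesis using False kq[OF x(1-3)] x(4) by simp
      qed
      ultimately show ?thesis by simp
    qed
    then show "base = {p \<in> topspace M. k p \<in> S'}"
      using closedin_subset[OF closedin_base] by blast
    fix p assume p: "p \<in> topspace M"
    then obtain x t where x: "x \<in> topspace X" "0 \<le> t" "t < 1" "p = q (x, t)" "p = cov (x, t)"
      by (rule torus_cases)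
    note gx = g_in[OF x(1)]
    have \<sigma>: "\<sigma> (p, s) = tgt.hit (g x) (s + t) - t * tgt.T (g x)" for s
      using \<sigma>q[OF x(1-3)] x(4) by simp
    show "k (sus (p, s)) = \<Psi> (k p, \<sigma> (p, s))" for s
    proof -
      have "k (sus (p, s)) = \<Psi> (g x, tgt.hit (g x) (t + s))"
        unfolding x(5) suspension_flow_cov[OF x(1)] by (rule kcov[OF x(1)])
      also have "\<dots> = \<Psi> (\<Psi> (g x, t * tgt.T (g x)), \<sigma> (p, s))"
        unfolding \<sigma> using tgt.flow_add[OF g_in_space[OF x(1)]] by (simp add: add.commute)
      also have "\<Psi> (g x, t * tgt.T (g x)) = k p" using kq[OF x(1-3)] x(4) by simp
      finally show ?thesis .
    qed
    show mono: "strict_mono (\<lambda>s. \<sigma> (p, s))"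
      using tgt.hit_strict_mono[OF gx] unfolding \<sigma> by (simp add: strict_mono_def)
    have "\<exists>s. \<sigma> (p, s) = r" for r
    proof -
      obtain v where "r + t * tgt.T (g x) = tgt.hit (g x) v"
        using tgt.hit_surj[OF gx] by (rule surjE)
      then show ?thesis unfolding \<sigma> by (intro exI[of _ "v - t"]) simp
    qed
    then have "surj (\<lambda>s. \<sigma> (p, s))" by (metis surjI)
    with mono show "homeomorphic_map euclideanreal euclideanreal (\<lambda>s. \<sigma> (p, s))"
      by (rule strict_mono_surj_homeomorphic_map)
    show "\<sigma> (p, 0) = 0" unfolding \<sigma> using x(2,3) by (simp add: tgt.hit_unit)
  qed
  have "rate_preserving (sus, M, base) (\<Psi>, Y, S') (k, \<sigma>)"
    unfolding rate_preserving_iff[OF dom.section_flow_axioms tgt.section_flow_axioms]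
  proof (intro ballI allI impI)
    fix p and t s :: real assume p: "p \<in> base" and t: "0 \<le> t \<and> t < 1"
    obtain x where x: "x \<in> topspace X" "p = q (x, 0)" using p by (rule base_cases)
    have "k p = g x"
      using kq[OF x(1), of 0] x(2) tgt.flow_0[OF g_in_space[OF x(1)]] by simp
    then show "\<sigma> (sus (p, t * dom.T p), dom.hit p (s + t) - t * dom.T p) =
        tgt.hit (k p) (s + t) - t * tgt.T (k p)"
      using \<sigma>q[OF x(1), of t s] t suspension_flow_q[OF x(1), of t] x(2) q_in_base[OF x(1)]
      by (simp add: return_time_base' hit_base)
  qed
  with weak show ?thesis by (simp add: RWFlowGS_simps l)
qed

end

lemma bij_betw_restriction:
  "bij_betw (\<lambda>k. \<lambda>x\<in>topspace X. fst k (q (x, 0)))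
    (homs RWFlowGS (sus, M, base) (\<Psi>, Y, S')) (map_homs (f, X) (tgt.P, subtopology Y S'))"
proof (rule bij_betwI[where g = lift])
  show "(\<lambda>k. \<lambda>x\<in>topspace X. fst k (q (x, 0))) \<in>
      homs RWFlowGS (sus, M, base) (\<Psi>, Y, S') \<rightarrow> map_homs (f, X) (tgt.P, subtopology Y S')"
  proof
    fix k assume k: "k \<in> homs RWFlowGS (sus, M, base) (\<Psi>, Y, S')"
    obtain h \<sigma> where h: "k = (h, \<sigma>)" by (cases k)
    have w: "(h, \<sigma>) \<in> weak_homs (sus, M, base) (\<Psi>, Y, S')" using k by (simp add: h RWFlowGS_simps)
    have "continuous_map X M (\<lambda>x. cov (x, 0))"
      using homeomorphic_imp_continuous_map[OF homeomorphic_map_base]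
      by (simp add: continuous_map_in_subtopology)
    from continuous_map_compose[OF this weak_homs_cont[OF w]]
    have "continuous_map X Y (\<lambda>x\<in>topspace X. h (q (x, 0)))"
      by (rule continuous_map_eq) (simp add: cov_unit)
    moreover have "h (q (f x, 0)) = tgt.P (h (q (x, 0)))" if "x \<in> topspace X" for x
      using weak_homs_return(2)[OF dom.section_flow_axioms tgt.section_flow_axioms w q_in_base[OF that]]
        poincare_map_base[OF that] by (simp add: base_def)
    ultimately show "(\<lambda>x\<in>topspace X. fst k (q (x, 0))) \<in> map_homs (f, X) (tgt.P, subtopology Y S')"
      using weak_homs_section[OF w q_in_base] f_in
      by (auto simp: map_homs_def h continuous_map_in_subtopology)
  qed
  show "lift \<in> map_homs (f, X) (tgt.P, subtopology Y S') \<rightarrow> homs RWFlowGS (sus, M, base) (\<Psi>, Y, S')"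
    using lift_in_homs by (auto simp: map_homs_def)
next
  fix k assume k: "k \<in> homs RWFlowGS (sus, M, base) (\<Psi>, Y, S')"
  obtain h \<sigma> where h: "k = (h, \<sigma>)" by (cases k)
  have w: "(h, \<sigma>) \<in> weak_homs (sus, M, base) (\<Psi>, Y, S')"
    and r: "rate_preserving (sus, M, base) (\<Psi>, Y, S') (h, \<sigma>)"
    using k by (simp_all add: h RWFlowGS_simps)
  let ?g = "\<lambda>x\<in>topspace X. h (q (x, 0))"
  have 1: "fst (lift ?g) = h"
  proof (rule extensionalityI)
    show "fst (lift ?g) \<in> extensional (topspace M)" by (simp add: lift_def)
    show "h \<in> extensional (topspace M)" using w by (simp add: weak_homs_iff)
    fix p assume p: "p \<in> topspace M"
    then obtain x t where x: "x \<in> topspace X" "0 \<le> t" "t < 1" "p = q (x, t)" by (rule torus_cases)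
    then show "fst (lift ?g) p = h p"
      using p morphism_determined(2)[OF w r x(1-3)] torus_coord_q[OF x(1-3)] by (simp add: lift_def)
  qed
  have 2: "snd (lift ?g) = \<sigma>"
  proof (rule extensionalityI)
    show "snd (lift ?g) \<in> extensional (topspace M \<times> UNIV)" by (simp add: lift_def)
    show "\<sigma> \<in> extensional (topspace M \<times> UNIV)" using w by (simp add: weak_homs_iff)
    fix ps assume "ps \<in> topspace M \<times> (UNIV :: real set)"
    then obtain p s where p: "ps = (p, s)" "p \<in> topspace M" by auto
    from p(2) obtain x t where x: "x \<in> topspace X" "0 \<le> t" "t < 1" "p = q (x, t)" by (rule torus_cases)
    then show "snd (lift ?g) ps = \<sigma> ps"
      using p morphism_determined(1)[OF w r x(1-3)] torus_coord_q[OF x(1-3)] by (simp add: lift_def)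
  qed
  show "lift (\<lambda>x\<in>topspace X. fst k (q (x, 0))) = k"
    using 1 2 by (simp add: h prod_eq_iff)
next
  fix g assume "g \<in> map_homs (f, X) (tgt.P, subtopology Y S')"
  then have g: "continuous_map X (subtopology Y S') g" "\<And>x. x \<in> topspace X \<Longrightarrow> g (f x) = tgt.P (g x)"
    "g \<in> extensional (topspace X)"
    by (auto simp: map_homs_def)
  show "(\<lambda>x\<in>topspace X. fst (lift g) (q (x, 0))) = g"
  proof (rule extensionalityI[OF _ g(3)])
    fix x assume x: "x \<in> topspace X"
    then show "(\<lambda>x\<in>topspace X. fst (lift g) (q (x, 0))) x = g x"
      using lift_q(1)[OF g(1,2) x, of 0] tgt.flow_0[OF g_in_space[OF g(1,2) x]] by simp
  qed simp
qed

end

text \<open>Naturality can be read off at the points \<open>[x, 0]\<close>: the map induced by \<open>a\<close> sends \<open>[x, 0]\<close> to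
  \<open>[a x, 0]\<close>.\<close>

theorem theorem4p14:
  fixes code :: "'u \<times> real \<Rightarrow> 'u"
  assumes "inj code"
  shows "left_adjoint MapCat RWFlowGS (Jminus \<circ>\<^sub>F Suspension code) (Poincare \<circ>\<^sub>F Jplus)"
  unfolding left_adjoint_def
proof (intro conjI exI ballI)
  let ?L = "Jminus \<circ>\<^sub>F Suspension code" and ?R = "Poincare \<circ>\<^sub>F Jplus"
  let ?\<theta> = "\<lambda>(f, X) (B :: 'u flow_obj) (k :: 'u weak_arr). \<lambda>x\<in>topspace X. fst k (torus_pt code f X (x, 0))"
  show "is_functor MapCat RWFlowGS ?L" using assms by (rule is_functor_Suspension)
  show "is_functor RWFlowGS MapCat ?R" by (rule is_functor_Poincare)
  have Lobj: "omap ?L (f, X) = (suspension_flow code f X, torus code f X, suspension.base code f X)"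
    if "(f, X) \<in> map_objs" for f X
  proof -
    interpret suspension code f X using assms that by unfold_locales (auto simp: map_objs_def)
    show ?thesis by (simp add: fcomp_def Jminus_def Suspension_def base_def)
  qed
  have Robj: "omap ?R (\<Psi>, Y, S') = (poincare_map \<Psi> S', subtopology Y S')" for \<Psi> :: "'u \<times> real \<Rightarrow> 'u" and Y S'
    by (simp add: fcomp_def Jplus_def Poincare_def)
  {
    fix A :: "'u map_obj" and B :: "'u flow_obj"
    assume A: "A \<in> objs MapCat" and B: "B \<in> objs RWFlowGS"
    obtain f X where A_eq: "A = (f, X)" by (cases A)
    obtain \<Psi> Y S' where B_eq: "B = (\<Psi>, Y, S')" by (cases B)
    have o: "(f, X) \<in> map_objs" "(\<Psi>, Y, S') \<in> flow_objs"
      using A B by (simp_all add: A_eq B_eq MapCat_def RWFlowGS_simps)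
    interpret tgt: section_flow Y \<Psi> S' using o(2) by (rule flow_objs_section_flow)
    interpret suspension_target code f X Y \<Psi> S'
      using assms o(1) by unfold_locales (auto simp: map_objs_def)
    show "bij_betw (?\<theta> A B) (homs RWFlowGS (omap ?L A) B) (homs MapCat A (omap ?R B))"
      using bij_betw_restriction by (simp add: A_eq B_eq Lobj[OF o(1)] Robj MapCat_def)
  }
  fix A A' :: "'u map_obj" and B B' :: "'u flow_obj" and a b k
  assume A: "A \<in> objs MapCat" and A': "A' \<in> objs MapCat" and B: "B \<in> objs RWFlowGS" and B': "B' \<in> objs RWFlowGS"
    and a: "a \<in> homs MapCat A' A" and b: "b \<in> homs RWFlowGS B B'" and k: "k \<in> homs RWFlowGS (omap ?L A) B"
  obtain f X where A_eq: "A = (f, X)" by (cases A)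
  obtain f' X' where A'_eq: "A' = (f', X')" by (cases A')
  obtain \<Psi> Y S where B_eq: "B = (\<Psi>, Y, S)" by (cases B)
  obtain \<Psi>' Y' S' where B'_eq: "B' = (\<Psi>', Y', S')" by (cases B')
  obtain b1 \<tau> where b1: "b = (b1, \<tau>)" by (cases b)
  obtain k1 \<sigma> where k1: "k = (k1, \<sigma>)" by (cases k)
  have o: "(f, X) \<in> map_objs" "(f', X') \<in> map_objs" and a': "a \<in> map_homs (f', X') (f, X)"
    using A A' a by (simp_all add: A_eq A'_eq MapCat_def)
  interpret F: suspension code f X using assms o(1) by unfold_locales (auto simp: map_objs_def)
  interpret F': suspension code f' X' using assms o(2) by unfold_locales (auto simp: map_objs_def)
  have w: "(k1, \<sigma>) \<in> weak_homs (F.sus, F.M, F.base) (\<Psi>, Y, S)"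
    using k by (simp add: A_eq Lobj[OF o(1)] B_eq k1 RWFlowGS_simps)
  have ain: "a x \<in> topspace X" if "x \<in> topspace X'" for x
    using a' that continuous_map_funspace by (fastforce simp: map_homs_def)
  have L: "fst (amap ?L A' A a) = amap (Suspension code) (f', X') (f, X) a"
    by (simp add: fcomp_def Jminus_def A_eq A'_eq case_prod_unfold)
  let ?H = "amap (Suspension code) (f', X') (f, X) a"
  have lhs: "fst (cmp RWFlowGS (omap ?L A') B B' b (cmp RWFlowGS (omap ?L A') (omap ?L A) B k (amap ?L A' A a))) =
      compose (topspace F'.M) b1 (compose (topspace F'.M) k1 ?H)"
    using L by (cases "amap ?L A' A a") (simp add: RWFlowGS_simps A'_eq Lobj[OF o(2)] weak_comp_def b1 k1)
  have kin: "k1 (F.q (a x, 0)) \<in> S" if "x \<in> topspace X'" for x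
    by (rule weak_homs_section[OF w]) (use ain[OF that] in \<open>auto simp: F.base_def\<close>)
  have rhs: "cmp MapCat A' (omap ?R B) (omap ?R B') (amap ?R B B' b) (cmp MapCat A' A (omap ?R B) (?\<theta> A B k) a) =
      compose (topspace X') (restrict b1 S) (compose (topspace X') (\<lambda>x\<in>topspace X. k1 (F.q (x, 0))) a)"
    by (simp add: MapCat_def A'_eq A_eq B_eq b1 k1 fcomp_def Jplus_def Poincare_def)
  have "(\<lambda>x\<in>topspace X'. compose (topspace F'.M) b1 (compose (topspace F'.M) k1 ?H) (F'.q (x, 0))) =
      compose (topspace X') (restrict b1 S) (compose (topspace X') (\<lambda>x\<in>topspace X. k1 (F.q (x, 0))) a)"
  proof (rule extensionalityI)
    fix x assume x: "x \<in> topspace X'"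
    then show "(\<lambda>x\<in>topspace X'. compose (topspace F'.M) b1 (compose (topspace F'.M) k1 ?H) (F'.q (x, 0))) x =
      compose (topspace X') (restrict b1 S) (compose (topspace X') (\<lambda>x\<in>topspace X. k1 (F.q (x, 0))) a) x"
      using F'.q_in[OF x, of 0] Suspension_arrow(2)[OF assms o(2,1) a' x] ain[OF x] kin[OF x]
      by (simp add: compose_eq)
  qed simp_all
  then show "?\<theta> A' B' (cmp RWFlowGS (omap ?L A') B B' b (cmp RWFlowGS (omap ?L A') (omap ?L A) B k (amap ?L A' A a))) =
      cmp MapCat A' (omap ?R B) (omap ?R B') (amap ?R B B' b) (cmp MapCat A' A (omap ?R B) (?\<theta> A B k) a)"
    unfolding rhs using lhs by (simp add: A'_eq)
qed

end
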